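(* Let $\Bbbk$ be a field. For any cocommutative coalgebra $C$ over $\Bbbk$, the free Hopf algebra $F(C)$ is $\mathcal{E}$-projective.
   Context: $\mathsf{Hopf}_{\Bbbk,\mathrm{coc}}$ and $\mathsf{Coalg}_{\Bbbk,\mathrm{coc}}$ are the categories of cocommutative Hopf algebras and of cocommutative coalgebras over $\Bbbk$. $F\colon\mathsf{Coalg}_{\Bbbk,\mathrm{coc}}\to\mathsf{Hopf}_{\Bbbk,\mathrm{coc}}$ is the left adjoint of the forgetful functor $U\colon\mathsf{Hopf}_{\Bbbk,\mathrm{coc}}\to\mathsf{Coalg}_{\Bbbk,\mathrm{coc}}$; $F(C)$ is Takeuchi's free Hopf algebra generated by the coalgebra $C$ (which is cocommutative when $C$ is). Concretely, with $V_0=C$, $V_{i+1}=V_i^{\mathrm{cop}}$, $V=\bigoplus_{i\ge0}V_i$, and $S\colon T(V)\to T(V)^{\mathrm{op,cop}}$ the bialgebra map induced by the shift $(x_0,x_1,\dots)\mapsto(0,x_0,x_1,\dots)$, one has $F(C)=T(V)/I$ with $I$ the two-sided ideal generated by $x_1S(x_2)-\varepsilon(x)1$ and $S(x_1)x_2-\varepsilon(x)1$ for $x\in V$. $\mathcal{E}$ is the class of morphisms $p\colon M\to N$ in $\mathsf{Hopf}_{\Bbbk,\mathrm{coc}}$ that have a section $N\to M$ which is a morphism of coalgebras. A cocommutative Hopf algebra $A$ is $\mathcal{E}$-projective if for every morphism $\phi\colon A\to N$ in $\mathsf{Hopf}_{\Bbbk,\mathrm{coc}}$ and every $p\colon M\to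 N$ in $\mathcal{E}$ there is $\psi\colon A\to M$ in $\mathsf{Hopf}_{\Bbbk,\mathrm{coc}}$ with $p\psi=\phi$. *)

theory Defs
  imports "HOL-Algebra.Module" "HOL-Algebra.QuotRing"
begin

section \<open>Linear maps, quotients and free modules\<close>

text \<open>All objects are carrier-based, in the style of HOL-Algebra. The record type of modules extends
  the one of rings, so it also serves for algebras; for a mere module or coalgebra the fields
  \<open>mult\<close> and \<open>one\<close> are irrelevant.\<close>

definition linear_maps ::
    "('k, 'r) ring_scheme \<Rightarrow> ('k, 'a, 'm) module_scheme \<Rightarrow> ('k, 'b, 'n) module_scheme \<Rightarrow> ('a \<Rightarrow> 'b) set"
  where "linear_maps K M N =
    {f \<in> carrier M \<rightarrow> carrier N.
      (\<forall>x \<in> carrier M. \<forall>y \<in> carrier M. f (x \<oplus>\<^bsub>M\<^esub> y) = f x \<oplus>\<^bsub>N\<^esub> f y) \<and>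
      (\<forall>a \<in> carrier K. \<forall>x \<in> carrier M. f (a \<odot>\<^bsub>M\<^esub> x) = a \<odot>\<^bsub>N\<^esub> f x)}"

definition submodule_span ::
    "('k, 'r) ring_scheme \<Rightarrow> ('k, 'a, 'm) module_scheme \<Rightarrow> 'a set \<Rightarrow> 'a set"
  where "submodule_span K M R = \<Inter>{N. submodule N K M \<and> R \<subseteq> N}"

text \<open>The quotient of a module by a submodule, or of an algebra by an ideal: the factor ring
  of \<^const>\<open>FactRing\<close> together with the induced scalar multiplication.\<close>

definition quotient_module :: "('k, 'a, 'm) module_scheme \<Rightarrow> 'a set \<Rightarrow> ('k, 'a set) module"
  where "quotient_module M N =
    \<lparr>carrier = a_rcosets\<^bsub>M\<^esub> N, mult = rcoset_mult M N, one = N +>\<^bsub>M\<^esub> \<one>\<^bsub>M\<^esub>,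
     zero = N, add = set_add M, smult = (\<lambda>a X. \<Union>x\<in>X. N +>\<^bsub>M\<^esub> (a \<odot>\<^bsub>M\<^esub> x))\<rparr>"

text \<open>The map on cosets induced by a map that is constant on each coset.\<close>

definition quotient_lift :: "('a \<Rightarrow> 'b) \<Rightarrow> 'a set \<Rightarrow> 'b"
  where "quotient_lift h X = the_elem (h ` X)"

definition support :: "('k, 'r) ring_scheme \<Rightarrow> ('g \<Rightarrow> 'k) \<Rightarrow> 'g set"
  where "support K f = {x. f x \<noteq> \<zero>\<^bsub>K\<^esub>}"

definition basis_elt :: "('k, 'r) ring_scheme \<Rightarrow> 'g \<Rightarrow> 'g \<Rightarrow> 'k"
  where "basis_elt K x = (\<lambda>y. if y = x then \<one>\<^bsub>K\<^esub> else \<zero>\<^bsub>K\<^esub>)"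

text \<open>The free module on the carrier of \<open>G\<close>, realised as finitely supported functions, with the
  convolution product; it is an algebra if \<open>G\<close> is a monoid.\<close>

definition monoid_algebra ::
    "('k, 'r) ring_scheme \<Rightarrow> ('g, 'n) monoid_scheme \<Rightarrow> ('k, 'g \<Rightarrow> 'k) module"
  where "monoid_algebra K G =
    \<lparr>carrier = {f. range f \<subseteq> carrier K \<and> support K f \<subseteq> carrier G \<and> finite (support K f)},
     mult = (\<lambda>f g z. \<Oplus>\<^bsub>K\<^esub>p \<in> {p \<in> support K f \<times> support K g. fst p \<otimes>\<^bsub>G\<^esub> snd p = z}.
               f (fst p) \<otimes>\<^bsub>K\<^esub> g (snd p)),
     one = basis_elt K \<one>\<^bsub>G\<^esub>,
     zero = (\<lambda>_. \<zero>\<^bsub>K\<^esub>),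
     add = (\<lambda>f g x. f x \<oplus>\<^bsub>K\<^esub> g x),
     smult = (\<lambda>a f x. a \<otimes>\<^bsub>K\<^esub> f x)\<rparr>"

definition linear_extension ::
    "('k, 'r) ring_scheme \<Rightarrow> ('k, 'w, 'n) module_scheme \<Rightarrow> ('g \<Rightarrow> 'w) \<Rightarrow> ('g \<Rightarrow> 'k) \<Rightarrow> 'w"
  where "linear_extension K W h f = (\<Oplus>\<^bsub>W\<^esub>x \<in> support K f. f x \<odot>\<^bsub>W\<^esub> h x)"

definition self_module :: "('k, 'r) ring_scheme \<Rightarrow> ('k, 'k) module"
  where "self_module K =
    \<lparr>carrier = carrier K, mult = mult K, one = \<one>\<^bsub>K\<^esub>, zero = \<zero>\<^bsub>K\<^esub>, add = add K, smult = mult K\<rparr>"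


section \<open>Tensor products\<close>

text \<open>\<open>M \<otimes> N\<close> is the free module on pairs modulo the bilinearity relations. When \<open>M\<close> and \<open>N\<close> are
  algebras, the product inherited from the monoid algebra of \<open>M \<times>\<times> N\<close> is the usual one,
  \<open>(a \<otimes> b) (a' \<otimes> b') = a a' \<otimes> b b'\<close>.\<close>

definition tensor_relations ::
    "('k, 'r) ring_scheme \<Rightarrow> ('k, 'a, 'm) module_scheme \<Rightarrow> ('k, 'b, 'n) module_scheme
      \<Rightarrow> ('a \<times> 'b \<Rightarrow> 'k) set"
  where "tensor_relations K M N = (let P = monoid_algebra K (M \<times>\<times> N); e = basis_elt K in
    submodule_span K P
     ({e (a \<oplus>\<^bsub>M\<^esub> a', b) \<ominus>\<^bsub>P\<^esub> (e (a, b) \<oplus>\<^bsub>P\<^esub> e (a', b)) | a a' b.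
         a \<in> carrier M \<and> a' \<in> carrier M \<and> b \<in> carrier N} \<union>
      {e (a, b \<oplus>\<^bsub>N\<^esub> b') \<ominus>\<^bsub>P\<^esub> (e (a, b) \<oplus>\<^bsub>P\<^esub> e (a, b')) | a b b'.
         a \<in> carrier M \<and> b \<in> carrier N \<and> b' \<in> carrier N} \<union>
      {e (c \<odot>\<^bsub>M\<^esub> a, b) \<ominus>\<^bsub>P\<^esub> c \<odot>\<^bsub>P\<^esub> e (a, b) | c a b.
         c \<in> carrier K \<and> a \<in> carrier M \<and> b \<in> carrier N} \<union>
      {e (a, c \<odot>\<^bsub>N\<^esub> b) \<ominus>\<^bsub>P\<^esub> c \<odot>\<^bsub>P\<^esub> e (a, b) | c a b.
         c \<in> carrier K \<and> a \<in> carrier M \<and> b \<in> carrier N}))"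

definition tensor ::
    "('k, 'r) ring_scheme \<Rightarrow> ('k, 'a, 'm) module_scheme \<Rightarrow> ('k, 'b, 'n) module_scheme
      \<Rightarrow> ('k, ('a \<times> 'b \<Rightarrow> 'k) set) module"
  where "tensor K M N = quotient_module (monoid_algebra K (M \<times>\<times> N)) (tensor_relations K M N)"

definition pure_tensor ::
    "('k, 'r) ring_scheme \<Rightarrow> ('k, 'a, 'm) module_scheme \<Rightarrow> ('k, 'b, 'n) module_scheme
      \<Rightarrow> 'a \<Rightarrow> 'b \<Rightarrow> ('a \<times> 'b \<Rightarrow> 'k) set"
  where "pure_tensor K M N a b =
    tensor_relations K M N +>\<^bsub>monoid_algebra K (M \<times>\<times> N)\<^esub> basis_elt K (a, b)"

text \<open>The linear map out of a tensor product that corresponds to a bilinear map \<open>f\<close> into \<open>W\<close>.\<close>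

definition tensor_lift ::
    "('k, 'r) ring_scheme \<Rightarrow> ('k, 'w, 'n) module_scheme \<Rightarrow> ('a \<Rightarrow> 'b \<Rightarrow> 'w)
      \<Rightarrow> ('a \<times> 'b \<Rightarrow> 'k) set \<Rightarrow> 'w"
  where "tensor_lift K W f = quotient_lift (linear_extension K W (\<lambda>(a, b). f a b))"

text \<open>\<open>f \<otimes> g\<close>, where \<open>M\<close> and \<open>N\<close> are the codomains of \<open>f\<close> and \<open>g\<close>.\<close>

definition tensor_map ::
    "('k, 'r) ring_scheme \<Rightarrow> ('k, 'a, 'm) module_scheme \<Rightarrow> ('k, 'b, 'n) module_scheme
      \<Rightarrow> ('c \<Rightarrow> 'a) \<Rightarrow> ('d \<Rightarrow> 'b) \<Rightarrow> ('c \<times> 'd \<Rightarrow> 'k) set \<Rightarrow> ('a \<times> 'b \<Rightarrow> 'k) set"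
  where "tensor_map K M N f g =
    tensor_lift K (tensor K M N) (\<lambda>a b. pure_tensor K M N (f a) (g b))"

definition tensor_swap ::
    "('k, 'r) ring_scheme \<Rightarrow> ('k, 'a, 'm) module_scheme \<Rightarrow> ('k, 'b, 'n) module_scheme
      \<Rightarrow> ('a \<times> 'b \<Rightarrow> 'k) set \<Rightarrow> ('b \<times> 'a \<Rightarrow> 'k) set"
  where "tensor_swap K M N =
    tensor_lift K (tensor K N M) (\<lambda>a b. pure_tensor K N M b a)"

text \<open>The associativity isomorphism \<open>(L \<otimes> M) \<otimes> N \<rightarrow> L \<otimes> (M \<otimes> N)\<close>.\<close>

definition tensor_assoc ::
    "('k, 'r) ring_scheme \<Rightarrow> ('k, 'a, 'l) module_scheme \<Rightarrow> ('k, 'b, 'm) module_scheme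
      \<Rightarrow> ('k, 'c, 'n) module_scheme
      \<Rightarrow> (('a \<times> 'b \<Rightarrow> 'k) set \<times> 'c \<Rightarrow> 'k) set \<Rightarrow> ('a \<times> ('b \<times> 'c \<Rightarrow> 'k) set \<Rightarrow> 'k) set"
  where "tensor_assoc K L M N = (let T = tensor K L (tensor K M N) in
    tensor_lift K T (\<lambda>x c.
      tensor_lift K T (\<lambda>a b. pure_tensor K L (tensor K M N) a (pure_tensor K M N b c)) x))"


section \<open>Coalgebras and Hopf algebras\<close>

record ('k, 'a) coalg = "('k, 'a) module" +
  comult :: "'a \<Rightarrow> ('a \<times> 'a \<Rightarrow> 'k) set"
  counit :: "'a \<Rightarrow> 'k"

record ('k, 'a) hopf = "('k, 'a) coalg" +
  antipode :: "'a \<Rightarrow> 'a"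

locale coalgebra = module K C
  for K :: "('k, 'r) ring_scheme" and C :: "('k, 'a, 'm) coalg_scheme" +
  assumes comult_linear: "comult C \<in> linear_maps K C (tensor K C C)"
    and counit_linear: "counit C \<in> linear_maps K C (self_module K)"
    and coassoc: "x \<in> carrier C \<Longrightarrow>
      tensor_assoc K C C C (tensor_map K (tensor K C C) C (comult C) id (comult C x)) =
      tensor_map K C (tensor K C C) id (comult C) (comult C x)"
    and counit_left: "x \<in> carrier C \<Longrightarrow>
      tensor_lift K C (\<lambda>a b. counit C a \<odot>\<^bsub>C\<^esub> b) (comult C x) = x"
    and counit_right: "x \<in> carrier C \<Longrightarrow>
      tensor_lift K C (\<lambda>a b. counit C b \<odot>\<^bsub>C\<^esub> a) (comult C x) = x"

definition cocommutative :: "('k, 'r) ring_scheme \<Rightarrow> ('k, 'a, 'm) coalg_scheme \<Rightarrow> bool"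
  where "cocommutative K C \<longleftrightarrow> (\<forall>x \<in> carrier C. tensor_swap K C C (comult C x) = comult C x)"

locale cocommutative_coalgebra = coalgebra +
  assumes cocommutative: "cocommutative K C"

locale assoc_algebra = module K A + A: ring A
  for K :: "('k, 'r) ring_scheme" and A :: "('k, 'a, 'm) module_scheme" +
  assumes smult_mult_left: "\<lbrakk>c \<in> carrier K; x \<in> carrier A; y \<in> carrier A\<rbrakk> \<Longrightarrow>
      (c \<odot>\<^bsub>A\<^esub> x) \<otimes>\<^bsub>A\<^esub> y = c \<odot>\<^bsub>A\<^esub> (x \<otimes>\<^bsub>A\<^esub> y)"
    and smult_mult_right: "\<lbrakk>c \<in> carrier K; x \<in> carrier A; y \<in> carrier A\<rbrakk> \<Longrightarrow>
      x \<otimes>\<^bsub>A\<^esub> (c \<odot>\<^bsub>A\<^esub> y) = c \<odot>\<^bsub>A\<^esub> (x \<otimes>\<^bsub>A\<^esub> y)"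

locale bialgebra = coalgebra K H + assoc_algebra K H
  for K :: "('k, 'r) ring_scheme" and H :: "('k, 'a, 'm) coalg_scheme" +
  assumes comult_hom: "comult H \<in> ring_hom H (tensor K H H)"
    and counit_hom: "counit H \<in> ring_hom H K"

locale hopf_algebra = bialgebra K H
  for K :: "('k, 'r) ring_scheme" and H :: "('k, 'a, 'm) hopf_scheme" +
  assumes antipode_linear: "antipode H \<in> linear_maps K H H"
    and antipode_left: "x \<in> carrier H \<Longrightarrow>
      tensor_lift K H (\<lambda>a b. antipode H a \<otimes>\<^bsub>H\<^esub> b) (comult H x) = counit H x \<odot>\<^bsub>H\<^esub> \<one>\<^bsub>H\<^esub>"
    and antipode_right: "x \<in> carrier H \<Longrightarrow>
      tensor_lift K H (\<lambda>a b. a \<otimes>\<^bsub>H\<^esub> antipode H b) (comult H x) = counit H x \<odot>\<^bsub>H\<^esub> \<one>\<^bsub>H\<^esub>"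

locale cocommutative_hopf_algebra = hopf_algebra +
  assumes cocommutative: "cocommutative K H"

definition coalgebra_hom ::
    "('k, 'r) ring_scheme \<Rightarrow> ('k, 'a, 'm) coalg_scheme \<Rightarrow> ('k, 'b, 'n) coalg_scheme \<Rightarrow> ('a \<Rightarrow> 'b) set"
  where "coalgebra_hom K C D =
    {f \<in> linear_maps K C D. \<forall>x \<in> carrier C.
      comult D (f x) = tensor_map K D D f f (comult C x) \<and> counit D (f x) = counit C x}"

definition hopf_hom ::
    "('k, 'r) ring_scheme \<Rightarrow> ('k, 'a, 'm) hopf_scheme \<Rightarrow> ('k, 'b, 'n) hopf_scheme \<Rightarrow> ('a \<Rightarrow> 'b) set"
  where "hopf_hom K H L =
    {f \<in> coalgebra_hom K H L \<inter> ring_hom H L. \<forall>x \<in> carrier H. f (antipode H x) = antipode L (f x)}"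


section \<open>The tensor algebra\<close>

definition word_monoid :: "'a set \<Rightarrow> 'a list monoid"
  where "word_monoid X = \<lparr>carrier = lists X, mult = append, one = []\<rparr>"

text \<open>The free module on words over \<open>V\<close>, modulo multilinearity in every letter, is
  \<open>\<Oplus>n. V\<^sup>\<otimes>\<^sup>n\<close>: the relations are homogeneous in the length \<open>n\<close> of the words.
  The product is induced by concatenation.\<close>

definition multilinear_relations ::
    "('k, 'r) ring_scheme \<Rightarrow> ('k, 'a, 'm) module_scheme \<Rightarrow> ('a list \<Rightarrow> 'k) set"
  where "multilinear_relations K V =
    (let P = monoid_algebra K (word_monoid (carrier V)); e = basis_elt K in
    submodule_span K P
     ({e (u @ [x \<oplus>\<^bsub>V\<^esub> y] @ w) \<ominus>\<^bsub>P\<^esub> (e (u @ [x] @ w) \<oplus>\<^bsub>P\<^esub> e (u @ [y] @ w)) | u w x y.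
         u \<in> lists (carrier V) \<and> w \<in> lists (carrier V) \<and> x \<in> carrier V \<and> y \<in> carrier V} \<union>
      {e (u @ [c \<odot>\<^bsub>V\<^esub> x] @ w) \<ominus>\<^bsub>P\<^esub> c \<odot>\<^bsub>P\<^esub> e (u @ [x] @ w) | u w c x.
         u \<in> lists (carrier V) \<and> w \<in> lists (carrier V) \<and> c \<in> carrier K \<and> x \<in> carrier V}))"

definition tensor_algebra ::
    "('k, 'r) ring_scheme \<Rightarrow> ('k, 'a, 'm) module_scheme \<Rightarrow> ('k, ('a list \<Rightarrow> 'k) set) module"
  where "tensor_algebra K V =
    quotient_module (monoid_algebra K (word_monoid (carrier V))) (multilinear_relations K V)"

definition tensor_algebra_inc ::
    "('k, 'r) ring_scheme \<Rightarrow> ('k, 'a, 'm) module_scheme \<Rightarrow> 'a \<Rightarrow> ('a list \<Rightarrow> 'k) set"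
  where "tensor_algebra_inc K V x =
    multilinear_relations K V +>\<^bsub>monoid_algebra K (word_monoid (carrier V))\<^esub> basis_elt K [x]"

text \<open>The algebra map from the tensor algebra of \<open>V\<close> to \<open>A\<close> that extends a linear map \<open>f\<close> from \<open>V\<close>
  to \<open>A\<close>; it sends \<open>x\<^sub>1 \<otimes> \<dots> \<otimes> x\<^sub>n\<close> to \<open>f x\<^sub>1 \<cdots> f x\<^sub>n\<close>.\<close>

definition tensor_algebra_lift ::
    "('k, 'r) ring_scheme \<Rightarrow> ('k, 'w, 'n) module_scheme \<Rightarrow> ('a \<Rightarrow> 'w) \<Rightarrow> ('a list \<Rightarrow> 'k) set \<Rightarrow> 'w"
  where "tensor_algebra_lift K A f =
    quotient_lift (linear_extension K A (\<lambda>w. foldr (\<lambda>x y. f x \<otimes>\<^bsub>A\<^esub> y) w \<one>\<^bsub>A\<^esub>))"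

definition tensor_bialgebra ::
    "('k, 'r) ring_scheme \<Rightarrow> ('k, 'a, 'm) coalg_scheme \<Rightarrow> ('k, ('a list \<Rightarrow> 'k) set) coalg"
  where "tensor_bialgebra K V =
    (let T = tensor_algebra K V; \<iota> = tensor_algebra_inc K V in
     module.extend T (coalg.fields
       (tensor_algebra_lift K (tensor K T T) (\<lambda>x. tensor_map K T T \<iota> \<iota> (comult V x)))
       (tensor_algebra_lift K (self_module K) (counit V))))"


section \<open>The free Hopf algebra generated by a coalgebra\<close>

definition co_opposite ::
    "('k, 'r) ring_scheme \<Rightarrow> ('k, 'a, 'm) coalg_scheme \<Rightarrow> ('k, 'a, 'm) coalg_scheme"
  where "co_opposite K C = C\<lparr>comult := \<lambda>x. tensor_swap K C C (comult C x)\<rparr>"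

definition opposite :: "('k, 'a, 'm) module_scheme \<Rightarrow> ('k, 'a, 'm) module_scheme"
  where "opposite A = A\<lparr>mult := \<lambda>x y. y \<otimes>\<^bsub>A\<^esub> x\<rparr>"

definition direct_sum :: "('i \<Rightarrow> ('k, 'a, 'm) module_scheme) \<Rightarrow> ('k, 'i \<Rightarrow> 'a) module"
  where "direct_sum M =
    \<lparr>carrier = {x. (\<forall>i. x i \<in> carrier (M i)) \<and> finite {i. x i \<noteq> \<zero>\<^bsub>M i\<^esub>}},
     mult = undefined, one = undefined,
     zero = (\<lambda>i. \<zero>\<^bsub>M i\<^esub>),
     add = (\<lambda>x y i. x i \<oplus>\<^bsub>M i\<^esub> y i),
     smult = (\<lambda>a x i. a \<odot>\<^bsub>M i\<^esub> x i)\<rparr>"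

definition direct_sum_inc :: "('i \<Rightarrow> ('k, 'a, 'm) module_scheme) \<Rightarrow> 'i \<Rightarrow> 'a \<Rightarrow> 'i \<Rightarrow> 'a"
  where "direct_sum_inc M i x = (\<lambda>j. if j = i then x else \<zero>\<^bsub>M j\<^esub>)"

definition direct_sum_coalgebra ::
    "('k, 'r) ring_scheme \<Rightarrow> ('i \<Rightarrow> ('k, 'a, 'm) coalg_scheme) \<Rightarrow> ('k, 'i \<Rightarrow> 'a) coalg"
  where "direct_sum_coalgebra K D =
    (let V = direct_sum D; supp = (\<lambda>x. {i. x i \<noteq> \<zero>\<^bsub>D i\<^esub>}); \<iota> = direct_sum_inc D in
     module.extend V (coalg.fields
       (\<lambda>x. \<Oplus>\<^bsub>tensor K V V\<^esub>i \<in> supp x. tensor_map K V V (\<iota> i) (\<iota> i) (comult (D i) (x i)))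
       (\<lambda>x. \<Oplus>\<^bsub>K\<^esub>i \<in> supp x. counit (D i) (x i))))"

definition takeuchi_coalgebra ::
    "('k, 'r) ring_scheme \<Rightarrow> ('k, 'a, 'm) coalg_scheme \<Rightarrow> ('k, nat \<Rightarrow> 'a) coalg"
  where "takeuchi_coalgebra K C = direct_sum_coalgebra K (\<lambda>i. (co_opposite K ^^ i) C)"

definition takeuchi_shift :: "('k, 'a, 'm) coalg_scheme \<Rightarrow> (nat \<Rightarrow> 'a) \<Rightarrow> nat \<Rightarrow> 'a"
  where "takeuchi_shift C x = case_nat \<zero>\<^bsub>C\<^esub> x"

text \<open>The algebra map \<open>T(V) \<rightarrow> T(V)\<^sup>o\<^sup>p\<close> induced by the shift.\<close>

definition takeuchi_antipode ::
    "('k, 'r) ring_scheme \<Rightarrow> ('k, 'a, 'm) coalg_scheme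
      \<Rightarrow> ((nat \<Rightarrow> 'a) list \<Rightarrow> 'k) set \<Rightarrow> ((nat \<Rightarrow> 'a) list \<Rightarrow> 'k) set"
  where "takeuchi_antipode K C = (let V = takeuchi_coalgebra K C in
    tensor_algebra_lift K (opposite (tensor_algebra K V))
      (\<lambda>x. tensor_algebra_inc K V (takeuchi_shift C x)))"

definition takeuchi_ideal ::
    "('k, 'r) ring_scheme \<Rightarrow> ('k, 'a, 'm) coalg_scheme \<Rightarrow> ((nat \<Rightarrow> 'a) list \<Rightarrow> 'k) set set"
  where "takeuchi_ideal K C =
    (let V = takeuchi_coalgebra K C; T = tensor_algebra K V; \<iota> = tensor_algebra_inc K V;
         S = takeuchi_antipode K C in
     Idl\<^bsub>T\<^esub> (\<Union>x \<in> carrier V.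
       {tensor_lift K T (\<lambda>a b. \<iota> a \<otimes>\<^bsub>T\<^esub> S (\<iota> b)) (comult V x) \<ominus>\<^bsub>T\<^esub> counit V x \<odot>\<^bsub>T\<^esub> \<one>\<^bsub>T\<^esub>,
        tensor_lift K T (\<lambda>a b. S (\<iota> a) \<otimes>\<^bsub>T\<^esub> \<iota> b) (comult V x) \<ominus>\<^bsub>T\<^esub> counit V x \<odot>\<^bsub>T\<^esub> \<one>\<^bsub>T\<^esub>}))"

text \<open>The structure induced on \<open>B / I\<close> by the bialgebra \<open>B\<close> and the map \<open>S\<close>.\<close>

definition quotient_hopf ::
    "('k, 'r) ring_scheme \<Rightarrow> ('k, 'a, 'm) coalg_scheme \<Rightarrow> ('a \<Rightarrow> 'a) \<Rightarrow> 'a set \<Rightarrow> ('k, 'a set) hopf"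
  where "quotient_hopf K B S I =
    (let Q = quotient_module B I; \<pi> = (\<lambda>x. I +>\<^bsub>B\<^esub> x) in
     coalg.extend
       (module.extend Q (coalg.fields
         (quotient_lift (\<lambda>x. tensor_map K Q Q \<pi> \<pi> (comult B x)))
         (quotient_lift (counit B))))
       (hopf.fields (quotient_lift (\<lambda>x. \<pi> (S x)))))"

definition free_hopf ::
    "('k, 'r) ring_scheme \<Rightarrow> ('k, 'a, 'm) coalg_scheme
      \<Rightarrow> ('k, ((nat \<Rightarrow> 'a) list \<Rightarrow> 'k) set set) hopf"
  where "free_hopf K C =
    quotient_hopf K (tensor_bialgebra K (takeuchi_coalgebra K C))
      (takeuchi_antipode K C) (takeuchi_ideal K C)"


section \<open>Projectivity\<close>

text \<open>The class of morphisms of cocommutative Hopf algebras that split as coalgebra maps.\<close>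

definition coalgebra_split_epi ::
    "('k, 'r) ring_scheme \<Rightarrow> ('k, 'a) hopf \<Rightarrow> ('k, 'b) hopf \<Rightarrow> ('a \<Rightarrow> 'b) \<Rightarrow> bool"
  where "coalgebra_split_epi K M N p \<longleftrightarrow>
    p \<in> hopf_hom K M N \<and> (\<exists>s \<in> coalgebra_hom K N M. \<forall>x \<in> carrier N. p (s x) = x)"

text \<open>The test objects \<open>M\<close> and \<open>N\<close> range over the cocommutative Hopf algebras whose carriers are
  sets in the types \<open>'m\<close> and \<open>'n\<close>. A definition cannot quantify over types; a theorem that states this
  property for type variables \<open>'m\<close> and \<open>'n\<close> covers all types.\<close>

definition E_projective ::
    "'m itself \<Rightarrow> 'n itself \<Rightarrow> ('k, 'r) ring_scheme \<Rightarrow> ('k, 'a) hopf \<Rightarrow> bool"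
  where "E_projective _ _ K A \<longleftrightarrow>
    cocommutative_hopf_algebra K A \<and>
    (\<forall>(M :: ('k, 'm) hopf) (N :: ('k, 'n) hopf) p \<phi>.
      cocommutative_hopf_algebra K M \<longrightarrow> cocommutative_hopf_algebra K N \<longrightarrow>
      coalgebra_split_epi K M N p \<longrightarrow> \<phi> \<in> hopf_hom K A N \<longrightarrow>
      (\<exists>\<psi> \<in> hopf_hom K A M. \<forall>x \<in> carrier A. p (\<psi> x) = \<phi> x))"

end

theory Submission
  imports Defs
begin

text \<open>
  Given a coalgebra section \<open>s\<close> of \<open>p : M \<rightarrow> N\<close> and a Hopf map \<open>\<phi> : F(C) \<rightarrow> N\<close>, the composite of \<open>s\<close>, \<open>\<phi>\<close>
  and \<open>C \<rightarrow> F(C)\<close> is a coalgebra map \<open>g : C \<rightarrow> M\<close>. As \<open>M\<close> is cocommutative, its antipode \<open>S\<close> is a coalgebra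
  map, so \<open>(x\<^sub>i)\<^sub>i \<mapsto> \<Sum>\<^sub>i S\<^sup>i(g x\<^sub>i)\<close> is a coalgebra map \<open>V \<rightarrow> M\<close> that turns the shift into \<open>S\<close>. It therefore
  satisfies Takeuchi's relations and extends to \<open>\<psi> : F(C) \<rightarrow> M\<close>; the algebra maps \<open>p \<psi>\<close> and \<open>\<phi>\<close> agree on \<open>V\<close>.

  That \<open>F(C)\<close> is a cocommutative Hopf algebra is checked on the image of \<open>V\<close>, which generates it as an
  algebra; no bialgebra structure on \<open>T(V)\<close> is needed. The maps \<open>\<Delta>\<close> and \<open>S\<close> descend from \<open>T(V)\<close> to \<open>F(C)\<close>
  because cocommutativity makes the convolution inverse of \<open>j : V \<rightarrow> F(C)\<close> induce one of
  \<open>(j \<otimes> j) \<Delta>\<close>.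

  Sweedler sums \<open>\<Sum> f(x\<^sub>1, x\<^sub>2)\<close> are the values of \<^const>\<open>tensor_lift\<close> at \<open>\<Delta> x\<close>.
\<close>

section \<open>Linear maps\<close>

text \<open>Every structure map of F(C) is an algebra map out of T(V)/I, into an opposite algebra in
  the case of the antipode, so it exists as soon as its values on V respect the relations.
  Coassociativity, cocommutativity and the counit law compare algebra maps and may be tested on V.
  The antipode laws are not of this kind: \<Sum> S(\<open>x\<^sub>1\<close>)
  \<open>x\<^sub>2\<close> is not visibly multiplicative in x, and the laws are instead shown to
  survive left multiplication by elements of V.

  The obstacle to lifting is that the section s respects only coalgebras, so s \<circ> \<phi> need
  not preserve products. Only its restriction to \<open>V\<^sub>0\<close> = C is kept, and freeness
  rebuilds a Hopf map from it. On the other summands \<open>V\<^sub>i\<close> the equation p \<psi>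
  = \<phi> follows by induction on i, because p and \<phi> commute with antipodes.

  The objects are concrete: finitely supported functions modulo spans, with induced maps read off
  from images of cosets by \<open>the_elem\<close>. The linear algebra serves to replace these
  representatives by universal properties; the Hopf-theoretic arguments then speak only of bilinear
  maps and generators.\<close>

lemma linear_mapsI:
  assumes "\<And>x. x \<in> carrier M \<Longrightarrow> f x \<in> carrier N"
    and "\<And>x y. \<lbrakk>x \<in> carrier M; y \<in> carrier M\<rbrakk> \<Longrightarrow> f (x \<oplus>\<^bsub>M\<^esub> y) = f x \<oplus>\<^bsub>N\<^esub> f y"
    and "\<And>a x. \<lbrakk>a \<in> carrier K; x \<in> carrier M\<rbrakk> \<Longrightarrow> f (a \<odot>\<^bsub>M\<^esub> x) = a \<odot>\<^bsub>N\<^esub> f x"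
  shows "f \<in> linear_maps K M N"
  using assms by (auto simp: linear_maps_def)

lemma linear_closed: "f \<in> linear_maps K M N \<Longrightarrow> x \<in> carrier M \<Longrightarrow> f x \<in> carrier N"
  by (auto simp: linear_maps_def)

lemma linear_add:
  "\<lbrakk>f \<in> linear_maps K M N; x \<in> carrier M; y \<in> carrier M\<rbrakk> \<Longrightarrow> f (x \<oplus>\<^bsub>M\<^esub> y) = f x \<oplus>\<^bsub>N\<^esub> f y"
  by (auto simp: linear_maps_def)

lemma linear_smult:
  "\<lbrakk>f \<in> linear_maps K M N; a \<in> carrier K; x \<in> carrier M\<rbrakk> \<Longrightarrow> f (a \<odot>\<^bsub>M\<^esub> x) = a \<odot>\<^bsub>N\<^esub> f x"
  by (auto simp: linear_maps_def)

lemma linear_zero: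
  assumes "module K M" "module K N" "f \<in> linear_maps K M N"
  shows "f \<zero>\<^bsub>M\<^esub> = \<zero>\<^bsub>N\<^esub>"
proof -
  interpret M: module K M by fact
  interpret N: module K N by fact
  have "f (\<zero>\<^bsub>K\<^esub> \<odot>\<^bsub>M\<^esub> \<zero>\<^bsub>M\<^esub>) = \<zero>\<^bsub>K\<^esub> \<odot>\<^bsub>N\<^esub> f \<zero>\<^bsub>M\<^esub>"
    using assms(3) by (rule linear_smult) auto
  then show ?thesis
    using linear_closed[OF assms(3)] by simp
qed

lemma linear_minus:
  assumes "module K M" "module K N" "f \<in> linear_maps K M N" "x \<in> carrier M" "y \<in> carrier M"
  shows "f (x \<ominus>\<^bsub>M\<^esub> y) = f x \<ominus>\<^bsub>N\<^esub> f y"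
proof -
  interpret M: module K M by fact
  interpret N: module K N by fact
  note c = linear_closed[OF assms(3)]
  have "f (x \<ominus>\<^bsub>M\<^esub> y) \<oplus>\<^bsub>N\<^esub> f y = f x"
    using linear_add[OF assms(3), of "x \<ominus>\<^bsub>M\<^esub> y" y] assms(4,5)
    by (simp add: M.minus_eq M.a_assoc M.l_neg)
  then show ?thesis
    using c assms(4,5) by (metis M.minus_closed N.add.inv_solve_right N.minus_eq)
qed

lemma linear_finsum:
  assumes "module K M" "module K N" "f \<in> linear_maps K M N" "finite A" "g \<in> A \<rightarrow> carrier M"
  shows "f (\<Oplus>\<^bsub>M\<^esub>i\<in>A. g i) = (\<Oplus>\<^bsub>N\<^esub>i\<in>A. f (g i))"
proof -
  interpret M: module K M by fact
  interpret N: module K N by fact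
  show ?thesis using assms(4,5)
  proof (induction A rule: finite_induct)
    case empty
    then show ?case using linear_zero[OF assms(1-3)] by simp
  next
    case (insert x F)
    then have "g \<in> F \<rightarrow> carrier M" "g x \<in> carrier M" by auto
    moreover from this have "(\<lambda>i. f (g i)) \<in> F \<rightarrow> carrier N" "f (g x) \<in> carrier N"
      using linear_closed[OF assms(3)] by auto
    ultimately show ?case
      using insert linear_add[OF assms(3), of "g x" "finsum M g F"] by simp
  qed
qed

lemma linear_id: "(\<lambda>x. x) \<in> linear_maps K M M"
  by (rule linear_mapsI) auto

lemma linear_comp:
  "\<lbrakk>h \<in> linear_maps K N W; g \<in> linear_maps K M N\<rbrakk> \<Longrightarrow> (\<lambda>x. h (g x)) \<in> linear_maps K M W"
  by (auto simp: linear_maps_def Pi_iff)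

text \<open>\<open>linear_maps\<close> constrains a function only on the carrier, so two formulas
  for one map may differ outside it. This rule passes from one formula to the other.\<close>

lemma linear_cong:
  "\<lbrakk>f \<in> linear_maps K M N; module K M; \<And>x. x \<in> carrier M \<Longrightarrow> f x = g x\<rbrakk> \<Longrightarrow> g \<in> linear_maps K M N"
  by (rule linear_mapsI)
    (metis linear_closed, metis linear_add abelian_groupE(1) module.axioms(2),
      metis linear_smult module.smult_closed)

lemma linear_smult_const:
  assumes "module K W" "c \<in> carrier K" "g \<in> linear_maps K M W"
  shows "(\<lambda>x. c \<odot>\<^bsub>W\<^esub> g x) \<in> linear_maps K M W"
proof -
  interpret W: module K W by fact
  show ?thesis
    by (rule linear_mapsI)
      (use assms(2) linear_closed[OF assms(3)] in
        \<open>auto simp: linear_add[OF assms(3)] linear_smult[OF assms(3)] W.smult_r_distr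
        W.smult_assoc1[symmetric] W.R.m_comm\<close>)
qed

lemma self_module_simps [simp]:
  "carrier (self_module K) = carrier K" "mult (self_module K) = mult K" "one (self_module K) = one K"
  "zero (self_module K) = zero K" "add (self_module K) = add K" "smult (self_module K) = mult K"
  by (auto simp: self_module_def)

lemma linear_smult_vec:
  assumes "module K W" "w \<in> carrier W" "g \<in> linear_maps K M (self_module K)"
  shows "(\<lambda>x. g x \<odot>\<^bsub>W\<^esub> w) \<in> linear_maps K M W"
proof -
  interpret W: module K W by fact
  show ?thesis
    by (rule linear_mapsI)
      (use assms linear_closed[OF assms(3)] linear_add[OF assms(3)] linear_smult[OF assms(3)]
       in \<open>auto simp: W.smult_l_distr W.smult_assoc1\<close>)
qed

lemma linear_addf:
  assumes "module K W" "f \<in> linear_maps K M W" "g \<in> linear_maps K M W"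
  shows "(\<lambda>x. f x \<oplus>\<^bsub>W\<^esub> g x) \<in> linear_maps K M W"
proof -
  interpret W: module K W by fact
  show ?thesis
    by (rule linear_mapsI)
      (use linear_closed[OF assms(2)] linear_closed[OF assms(3)] in
        \<open>auto simp: linear_add[OF assms(2)] linear_smult[OF assms(2)] linear_add[OF assms(3)]
          linear_smult[OF assms(3)] W.smult_r_distr W.a_ac\<close>)
qed

section \<open>Spans\<close>

lemma submodule_preimage:
  assumes "module K M" "module K N" "f \<in> linear_maps K M N" "submodule T K N"
  shows "submodule {x \<in> carrier M. f x \<in> T} K M"
proof -
  interpret M: module K M by fact
  interpret N: module K N by fact
  have neg: "f (\<ominus>\<^bsub>M\<^esub> a) = \<ominus>\<^bsub>N\<^esub> f a" if "a \<in> carrier M" for a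
    using linear_minus[OF assms(1-3), of "\<zero>\<^bsub>M\<^esub>" a] linear_zero[OF assms(1-3)] that
      linear_closed[OF assms(3)] by (simp add: M.minus_eq N.minus_eq)
  have "\<zero>\<^bsub>N\<^esub> \<in> T"
    using N.submoduleE[OF assms(4)] N.r_neg by (metis equals0I subset_eq)
  then show ?thesis
    by (intro M.submoduleI)
      (use N.submoduleE[OF assms(4)] linear_zero[OF assms(1-3)] in
        \<open>auto simp: neg linear_add[OF assms(3)] linear_smult[OF assms(3)]\<close>)
qed

lemma submodule_zero:
  assumes "module K N" shows "submodule {\<zero>\<^bsub>N\<^esub>} K N"
proof -
  interpret N: module K N by fact
  show ?thesis by (intro N.submoduleI) auto
qed

text \<open>Source of the extensionality principles below: an identity between linear maps holds on
  a submodule, hence spreads from a set to everything that the set generates.\<close>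

lemma submodule_equalizer:
  assumes "module K M" "module K N" "f \<in> linear_maps K M N" "g \<in> linear_maps K M N"
  shows "submodule {x \<in> carrier M. f x = g x} K M"
proof -
  interpret M: module K M by fact
  interpret N: module K N by fact
  have neg: "h (\<ominus>\<^bsub>M\<^esub> a) = \<ominus>\<^bsub>N\<^esub> h a" if "a \<in> carrier M" "h \<in> linear_maps K M N" for a h
    using linear_minus[OF assms(1,2) that(2), of "\<zero>\<^bsub>M\<^esub>" a] linear_zero[OF assms(1,2) that(2)] that
      linear_closed[OF that(2)] by (simp add: M.minus_eq N.minus_eq)
  show ?thesis
    by (intro M.submoduleI)
      (use linear_zero[OF assms(1-3)] linear_zero[OF assms(1,2,4)] assms in \<open>auto simp: neg linear_add[OF assms(3)] linear_smult[OF assms(3)]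
          linear_add[OF assms(4)] linear_smult[OF assms(4)]\<close>)
qed

lemma span_least: "submodule N K M \<Longrightarrow> S \<subseteq> N \<Longrightarrow> submodule_span K M S \<subseteq> N"
  by (auto simp: submodule_span_def)

lemma span_superset: "S \<subseteq> submodule_span K M S"
  by (auto simp: submodule_span_def)

lemma spanning_subset: "submodule_span K M S = carrier M \<Longrightarrow> S \<subseteq> carrier M"
  by (metis span_superset)

lemma submodule_span:
  assumes "module K M" "S \<subseteq> carrier M"
  shows "submodule (submodule_span K M S) K M"
proof -
  interpret M: module K M by fact
  have c: "submodule_span K M S \<subseteq> carrier M"
    using assms span_least M.carrier_is_submodule by blast
  have "\<zero>\<^bsub>M\<^esub> \<in> N" if "submodule N K M" for N
    using M.submoduleE[OF that] M.r_neg by (metis equals0I subset_eq)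
  then show ?thesis
    by (intro M.submoduleI[OF c]) (auto simp: submodule_span_def M.submoduleE)
qed

lemma span_map:
  assumes "module K M" "module K N" "f \<in> linear_maps K M N" "submodule T K N"
    and "S \<subseteq> carrier M" "\<And>x. x \<in> S \<Longrightarrow> f x \<in> T" "x \<in> submodule_span K M S"
  shows "f x \<in> T"
  using span_least[OF submodule_preimage[OF assms(1-4)], of S] assms(5-) by auto

lemma span_map_zero:
  assumes "module K M" "module K N" "f \<in> linear_maps K M N"
    and "S \<subseteq> carrier M" "\<And>x. x \<in> S \<Longrightarrow> f x = \<zero>\<^bsub>N\<^esub>" "x \<in> submodule_span K M S"
  shows "f x = \<zero>\<^bsub>N\<^esub>"
  using span_map[OF assms(1-3) submodule_zero[OF assms(2)] assms(4)] assms(5,6) by auto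

lemma linear_ext:
  assumes "module K M" "module K N" "f \<in> linear_maps K M N" "g \<in> linear_maps K M N"
    and "submodule_span K M S = carrier M" "\<And>x. x \<in> S \<Longrightarrow> f x = g x" "x \<in> carrier M"
  shows "f x = g x"
proof -
  have "S \<subseteq> {x \<in> carrier M. f x = g x}"
    using assms(6) spanning_subset[OF assms(5)] by blast
  from span_least[OF submodule_equalizer[OF assms(1-4)] this] assms(5,7)
  show ?thesis by auto
qed

text \<open>The preimage of the span of the image is a submodule containing \<open>S\<close>, hence
  everything. This produces the spanning sets of quotients: pure tensors and words.\<close>

lemma span_image:
  assumes "module K M" "module K N" "f \<in> linear_maps K M N" "f ` carrier M = carrier N"
    and "submodule_span K M S = carrier M"
  shows "submodule_span K N (f ` S) = carrier N"
proof
  have S: "S \<subseteq> carrier M" using assms(5) by (rule spanning_subset)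
  then show "submodule_span K N (f ` S) \<subseteq> carrier N"
    using span_least[OF module.carrier_is_submodule[OF assms(2)]] assms(4) by (metis image_mono)
  have "submodule (submodule_span K N (f ` S)) K N"
    using S assms(2,4) by (intro submodule_span) auto
  then have "f x \<in> submodule_span K N (f ` S)" if "x \<in> carrier M" for x
    by (rule span_map[OF assms(1-3) _ S]) (use that assms(5) span_superset[of "f ` S" K N] in auto)
  then show "carrier N \<subseteq> submodule_span K N (f ` S)"
    unfolding assms(4)[symmetric] by (rule image_subsetI)
qed

section \<open>Associative algebras\<close>

lemma assoc_algebra_module: "assoc_algebra K A \<Longrightarrow> module K A"
  by (simp add: assoc_algebra_def)

lemma assoc_algebra_ring: "assoc_algebra K A \<Longrightarrow> ring A"
  by (simp add: assoc_algebra_def)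

lemma linear_mult_left:
  assumes "assoc_algebra K A" "a \<in> carrier A" "g \<in> linear_maps K M A"
  shows "(\<lambda>x. a \<otimes>\<^bsub>A\<^esub> g x) \<in> linear_maps K M A"
proof -
  interpret A: assoc_algebra K A by fact
  show ?thesis
    by (rule linear_mapsI) (use assms(2) linear_closed[OF assms(3)] in
      \<open>auto simp: linear_add[OF assms(3)] linear_smult[OF assms(3)] A.A.r_distr A.smult_mult_right\<close>)
qed

lemma linear_mult_right:
  assumes "assoc_algebra K A" "a \<in> carrier A" "g \<in> linear_maps K M A"
  shows "(\<lambda>x. g x \<otimes>\<^bsub>A\<^esub> a) \<in> linear_maps K M A"
proof -
  interpret A: assoc_algebra K A by fact
  show ?thesis
    by (rule linear_mapsI) (use assms(2) linear_closed[OF assms(3)] in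
      \<open>auto simp: linear_add[OF assms(3)] linear_smult[OF assms(3)] A.A.l_distr A.smult_mult_left\<close>)
qed

text \<open>\<open>ring_hom\<close> does not see scalars and \<open>linear_maps\<close> does not see
  products, so morphisms of algebras combine the two.\<close>

definition algebra_hom ::
    "('k, 'r) ring_scheme \<Rightarrow> ('k, 'a, 'm) module_scheme \<Rightarrow> ('k, 'b, 'n) module_scheme \<Rightarrow> ('a \<Rightarrow> 'b) set"
  where "algebra_hom K A B = linear_maps K A B \<inter> ring_hom A B"

lemma algebra_hom_linear: "f \<in> algebra_hom K A B \<Longrightarrow> f \<in> linear_maps K A B"
  by (simp add: algebra_hom_def)

lemma algebra_hom_mult:
  "\<lbrakk>f \<in> algebra_hom K A B; x \<in> carrier A; y \<in> carrier A\<rbrakk> \<Longrightarrow> f (x \<otimes>\<^bsub>A\<^esub> y) = f x \<otimes>\<^bsub>B\<^esub> f y"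
  by (simp add: algebra_hom_def ring_hom_def)

lemma algebra_hom_one: "f \<in> algebra_hom K A B \<Longrightarrow> f \<one>\<^bsub>A\<^esub> = \<one>\<^bsub>B\<^esub>"
  by (simp add: algebra_hom_def ring_hom_def)

lemma algebra_homI:
  assumes "f \<in> linear_maps K A B" "f \<one>\<^bsub>A\<^esub> = \<one>\<^bsub>B\<^esub>"
    and "\<And>x y. \<lbrakk>x \<in> carrier A; y \<in> carrier A\<rbrakk> \<Longrightarrow> f (x \<otimes>\<^bsub>A\<^esub> y) = f x \<otimes>\<^bsub>B\<^esub> f y"
  shows "f \<in> algebra_hom K A B"
  using assms by (auto simp: algebra_hom_def ring_hom_def linear_maps_def)

lemma algebra_hom_comp:
  "\<lbrakk>g \<in> algebra_hom K B C; f \<in> algebra_hom K A B\<rbrakk> \<Longrightarrow> (\<lambda>x. g (f x)) \<in> algebra_hom K A C"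
  by (rule algebra_homI)
    (simp_all add: linear_comp[OF algebra_hom_linear algebra_hom_linear] algebra_hom_one
      algebra_hom_mult linear_closed[OF algebra_hom_linear])

text \<open>Both sides are linear in each argument. With the left factor in \<open>S\<close>, the
  right one is extended to the span; the left one follows.\<close>

lemma mult_ext:
  assumes A: "assoc_algebra K A" and B: "assoc_algebra K B" and f: "f \<in> linear_maps K A B"
    and S: "submodule_span K A S = carrier A"
    and eq: "\<And>a b. \<lbrakk>a \<in> S; b \<in> S\<rbrakk> \<Longrightarrow> f (a \<otimes>\<^bsub>A\<^esub> b) = f a \<otimes>\<^bsub>B\<^esub> f b"
    and x: "x \<in> carrier A" and y: "y \<in> carrier A"
  shows "f (x \<otimes>\<^bsub>A\<^esub> y) = f x \<otimes>\<^bsub>B\<^esub> f y"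
proof -
  note m = assoc_algebra_module[OF A] assoc_algebra_module[OF B]
  have Sc: "S \<subseteq> carrier A" using S by (rule spanning_subset)
  have 1: "f (a \<otimes>\<^bsub>A\<^esub> y) = f a \<otimes>\<^bsub>B\<^esub> f y" if "a \<in> S" for a
    by (rule linear_ext[OF m _ _ S eq[OF that] y])
      (use that Sc f in \<open>auto intro!: linear_comp[OF f] linear_mult_left A B linear_id linear_closed[OF f]\<close>)
  show ?thesis
    by (rule linear_ext[OF m _ _ S 1 x])
      (use y f in \<open>auto intro!: linear_comp[OF f] linear_mult_right A B linear_id linear_closed[OF f]\<close>)
qed

text \<open>Equational axioms pass along a surjection that preserves the operations, without
  \<open>Q\<close> being known to be a module beforehand. It is applied to coset maps, and to the
  identity when two records share their module fields.\<close>

lemma module_surj: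
  assumes "module K M" and c: "carrier Q = f ` carrier M"
    and a: "\<And>x y. \<lbrakk>x \<in> carrier M; y \<in> carrier M\<rbrakk> \<Longrightarrow> f (x \<oplus>\<^bsub>M\<^esub> y) = f x \<oplus>\<^bsub>Q\<^esub> f y"
    and s: "\<And>a x. \<lbrakk>a \<in> carrier K; x \<in> carrier M\<rbrakk> \<Longrightarrow> f (a \<odot>\<^bsub>M\<^esub> x) = a \<odot>\<^bsub>Q\<^esub> f x"
    and z: "f \<zero>\<^bsub>M\<^esub> = \<zero>\<^bsub>Q\<^esub>"
  shows "module K Q"
proof -
  interpret M: module K M by fact
  note e = a[symmetric] s[symmetric] z[symmetric]
  have "abelian_group Q"
  proof (rule abelian_groupI)
    fix x assume "x \<in> carrier Q"
    then obtain u where u: "u \<in> carrier M" "x = f u" using c by auto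
    show "\<exists>y\<in>carrier Q. y \<oplus>\<^bsub>Q\<^esub> x = \<zero>\<^bsub>Q\<^esub>"
      by (rule bexI[of _ "f (\<ominus>\<^bsub>M\<^esub> u)"]) (use u in \<open>auto simp: c e M.l_neg\<close>)
  qed (auto simp: c e M.a_ac)
  then show ?thesis
    by (rule moduleI[OF M.R.is_cring])
      (auto simp: c e(1,2) M.smult_l_distr M.smult_r_distr M.smult_assoc1)
qed

lemma assoc_algebra_surj:
  assumes "assoc_algebra K A" and c: "carrier Q = f ` carrier A"
    and a: "\<And>x y. \<lbrakk>x \<in> carrier A; y \<in> carrier A\<rbrakk> \<Longrightarrow> f (x \<oplus>\<^bsub>A\<^esub> y) = f x \<oplus>\<^bsub>Q\<^esub> f y"
    and s: "\<And>a x. \<lbrakk>a \<in> carrier K; x \<in> carrier A\<rbrakk> \<Longrightarrow> f (a \<odot>\<^bsub>A\<^esub> x) = a \<odot>\<^bsub>Q\<^esub> f x"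
    and z: "f \<zero>\<^bsub>A\<^esub> = \<zero>\<^bsub>Q\<^esub>"
    and m: "\<And>x y. \<lbrakk>x \<in> carrier A; y \<in> carrier A\<rbrakk> \<Longrightarrow> f (x \<otimes>\<^bsub>A\<^esub> y) = f x \<otimes>\<^bsub>Q\<^esub> f y"
    and o: "f \<one>\<^bsub>A\<^esub> = \<one>\<^bsub>Q\<^esub>"
  shows "assoc_algebra K Q"
proof -
  interpret A: assoc_algebra K A by fact
  note e = a[symmetric] s[symmetric] z[symmetric] m[symmetric] o[symmetric]
  have Q: "module K Q"
    by (rule module_surj[OF A.module_axioms c a s z])
  have "monoid Q"
    by (rule monoidI) (auto simp: c e A.A.m_assoc)
  with Q have "ring Q"
    by (intro ringI) (auto simp: c e A.A.l_distr A.A.r_distr module_def)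
  with Q show ?thesis
    by (intro assoc_algebra.intro assoc_algebra_axioms.intro)
      (auto simp: c e A.smult_mult_left A.smult_mult_right)
qed

lemma assoc_algebra_self: "cring K \<Longrightarrow> assoc_algebra K (self_module K)"
proof -
  assume "cring K"
  then interpret K: cring K .
  have ab: "abelian_group (self_module K)"
    by (rule abelian_groupI) (auto simp: K.a_ac intro: K.l_neg K.add.inv_closed bexI)
  have mon: "monoid (self_module K)"
    by (rule monoidI) (auto simp: K.m_assoc)
  have mod: "module K (self_module K)"
    by (rule moduleI) (use ab K.is_cring in \<open>auto simp: K.l_distr K.r_distr K.m_assoc\<close>)
  have "ring (self_module K)"
    by (rule ringI) (use ab mon in \<open>auto simp: K.l_distr K.r_distr\<close>)
  with mod show ?thesis
    by (intro assoc_algebra.intro assoc_algebra_axioms.intro) (auto simp: K.m_ac)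
qed

lemma opposite_simps [simp]:
  "carrier (opposite A) = carrier A" "one (opposite A) = one A" "zero (opposite A) = zero A"
  "add (opposite A) = add A" "smult (opposite A) = smult A"
  "mult (opposite A) = (\<lambda>x y. y \<otimes>\<^bsub>A\<^esub> x)"
  by (simp_all add: opposite_def)

lemma assoc_algebra_opposite:
  assumes "assoc_algebra K A" shows "assoc_algebra K (opposite A)"
proof -
  interpret A: assoc_algebra K A by fact
  have mod: "module K (opposite A)"
    by (rule module_surj[of _ A _ "\<lambda>x. x"]) (auto simp: A.module_axioms)
  have "monoid (opposite A)"
    by (rule monoidI) (auto simp: A.A.m_assoc)
  with mod have "ring (opposite A)"
    by (intro ringI) (auto simp: module_def A.A.l_distr A.A.r_distr)
  with mod show ?thesis
    by (intro assoc_algebra.intro assoc_algebra_axioms.intro)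
      (auto simp: A.smult_mult_left A.smult_mult_right)
qed

section \<open>Quotients\<close>

lemma submodule_abelian_subgroup:
  assumes "module K M" "submodule N K M"
  shows "abelian_subgroup N M"
  using assms by (intro abelian_subgroupI3 additive_subgroupI) (auto simp: submodule_def module_def)

lemma coset_eqI:
  assumes "module K M" "submodule N K M" "x \<in> carrier M" "y \<in> carrier M" "x \<ominus>\<^bsub>M\<^esub> y \<in> N"
  shows "N +>\<^bsub>M\<^esub> x = N +>\<^bsub>M\<^esub> y"
proof -
  interpret N: abelian_subgroup N M using submodule_abelian_subgroup assms by blast
  have "x \<in> N +>\<^bsub>M\<^esub> y"
    using assms by (intro N.a_rcos_module_rev) (auto simp: N.minus_eq)
  then show ?thesis
    using N.a_repr_independence' assms(4) by metis
qed

lemma coset_memD: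
  assumes "module K M" "submodule N K M" "x \<in> carrier M" "y \<in> N +>\<^bsub>M\<^esub> x"
  shows "y \<in> carrier M" "y \<ominus>\<^bsub>M\<^esub> x \<in> N"
proof -
  interpret N: abelian_subgroup N M using submodule_abelian_subgroup assms by blast
  show "y \<in> carrier M" using N.a_elemrcos_carrier assms by blast
  show "y \<ominus>\<^bsub>M\<^esub> x \<in> N" using N.a_rcos_module_imp assms by (simp add: N.minus_eq)
qed

lemma carrier_quotient: "carrier (quotient_module M N) = (\<lambda>x. N +>\<^bsub>M\<^esub> x) ` carrier M"
  by (auto simp: quotient_module_def A_RCOSETS_def' a_r_coset_def')

lemma quotient_add:
  assumes "module K M" "submodule N K M" "x \<in> carrier M" "y \<in> carrier M"
  shows "(N +>\<^bsub>M\<^esub> x) \<oplus>\<^bsub>quotient_module M N\<^esub> (N +>\<^bsub>M\<^esub> y) = N +>\<^bsub>M\<^esub> (x \<oplus>\<^bsub>M\<^esub> y)"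
proof -
  interpret N: abelian_subgroup N M using submodule_abelian_subgroup assms by blast
  show ?thesis using assms by (simp add: quotient_module_def N.a_rcos_sum)
qed

lemma quotient_zero:
  assumes "module K M" "submodule N K M"
  shows "N +>\<^bsub>M\<^esub> \<zero>\<^bsub>M\<^esub> = \<zero>\<^bsub>quotient_module M N\<^esub>"
proof -
  interpret N: abelian_subgroup N M using submodule_abelian_subgroup assms by blast
  show ?thesis by (simp add: quotient_module_def N.a_rcos_const)
qed

text \<open>The scalar action on cosets is defined as a union over all representatives. The terms of
  this union coincide because \<open>N\<close> absorbs scalars, and the index set is nonempty, so
  the union is any one of its terms.\<close>

lemma quotient_smult:
  assumes "module K M" "submodule N K M" "a \<in> carrier K" "x \<in> carrier M"
  shows "a \<odot>\<^bsub>quotient_module M N\<^esub> (N +>\<^bsub>M\<^esub> x) = N +>\<^bsub>M\<^esub> (a \<odot>\<^bsub>M\<^esub> x)"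
proof -
  interpret M: module K M by fact
  interpret N: abelian_subgroup N M using submodule_abelian_subgroup assms by blast
  have "N +>\<^bsub>M\<^esub> (a \<odot>\<^bsub>M\<^esub> y) = N +>\<^bsub>M\<^esub> (a \<odot>\<^bsub>M\<^esub> x)" if "y \<in> N +>\<^bsub>M\<^esub> x" for y
  proof (rule coset_eqI[OF assms(1,2)])
    note y = coset_memD[OF assms(1,2,4) that]
    show "a \<odot>\<^bsub>M\<^esub> y \<in> carrier M" "a \<odot>\<^bsub>M\<^esub> x \<in> carrier M" using y assms by auto
    have "a \<odot>\<^bsub>M\<^esub> (y \<ominus>\<^bsub>M\<^esub> x) \<in> N" using y M.submoduleE(4)[OF assms(2,3)] by auto
    then show "a \<odot>\<^bsub>M\<^esub> y \<ominus>\<^bsub>M\<^esub> a \<odot>\<^bsub>M\<^esub> x \<in> N"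
      using y assms by (simp add: M.minus_eq M.smult_r_distr M.smult_r_minus)
  qed
  then have "(\<Union>y \<in> N +>\<^bsub>M\<^esub> x. N +>\<^bsub>M\<^esub> (a \<odot>\<^bsub>M\<^esub> y)) = (\<Union>y \<in> N +>\<^bsub>M\<^esub> x. N +>\<^bsub>M\<^esub> (a \<odot>\<^bsub>M\<^esub> x))"
    by (rule SUP_cong[OF refl])
  moreover have "N +>\<^bsub>M\<^esub> x \<noteq> {}" using N.a_rcos_self[OF assms(4)] by auto
  ultimately show ?thesis by (simp add: quotient_module_def)
qed

lemma module_quotient:
  assumes "module K M" "submodule N K M"
  shows "module K (quotient_module M N)"
  by (rule module_surj[OF assms(1) carrier_quotient])
    (simp_all add: quotient_add[OF assms] quotient_smult[OF assms] quotient_zero[OF assms])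

lemma quotient_linear:
  assumes "module K M" "submodule N K M"
  shows "(\<lambda>x. N +>\<^bsub>M\<^esub> x) \<in> linear_maps K M (quotient_module M N)"
  by (rule linear_mapsI)
    (auto simp: carrier_quotient quotient_add[OF assms] quotient_smult[OF assms])

text \<open>The premise has the literal shape of the additivity relations of tensor products and
  tensor algebras, so that membership of a generator can be plugged in directly.\<close>

lemma quotient_eq_addI:
  assumes "module K M" "submodule N K M" "x \<in> carrier M" "y \<in> carrier M" "z \<in> carrier M"
    and "x \<ominus>\<^bsub>M\<^esub> (y \<oplus>\<^bsub>M\<^esub> z) \<in> N"
  shows "N +>\<^bsub>M\<^esub> x = (N +>\<^bsub>M\<^esub> y) \<oplus>\<^bsub>quotient_module M N\<^esub> (N +>\<^bsub>M\<^esub> z)"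
proof -
  interpret M: module K M by fact
  show ?thesis
    unfolding quotient_add[OF assms(1,2,4,5)] by (rule coset_eqI) (use assms in auto)
qed

lemma quotient_eq_smultI:
  assumes "module K M" "submodule N K M" "c \<in> carrier K" "x \<in> carrier M" "y \<in> carrier M"
    and "x \<ominus>\<^bsub>M\<^esub> c \<odot>\<^bsub>M\<^esub> y \<in> N"
  shows "N +>\<^bsub>M\<^esub> x = c \<odot>\<^bsub>quotient_module M N\<^esub> (N +>\<^bsub>M\<^esub> y)"
proof -
  interpret M: module K M by fact
  show ?thesis
    unfolding quotient_smult[OF assms(1,2,3,5)] by (rule coset_eqI) (use assms in auto)
qed

lemma quotient_zeroD:
  assumes "module K M" "submodule N K M" "x \<in> carrier M" "N +>\<^bsub>M\<^esub> x = \<zero>\<^bsub>quotient_module M N\<^esub>"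
  shows "x \<in> N"
proof -
  interpret N: abelian_subgroup N M by (rule submodule_abelian_subgroup[OF assms(1,2)])
  show ?thesis using N.a_rcos_self[OF assms(3)] assms(4) by (simp add: quotient_module_def)
qed

lemma quotient_mult:
  assumes "ideal N A" "x \<in> carrier A" "y \<in> carrier A"
  shows "(N +>\<^bsub>A\<^esub> x) \<otimes>\<^bsub>quotient_module A N\<^esub> (N +>\<^bsub>A\<^esub> y) = N +>\<^bsub>A\<^esub> (x \<otimes>\<^bsub>A\<^esub> y)"
  using ideal.rcoset_mult_add[OF assms] by (simp add: quotient_module_def)

lemma quotient_one: "\<one>\<^bsub>quotient_module A N\<^esub> = N +>\<^bsub>A\<^esub> \<one>\<^bsub>A\<^esub>"
  by (simp add: quotient_module_def)

lemma assoc_algebra_quotient: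
  assumes A: "assoc_algebra K A" and N: "submodule N K A" and i: "ideal N A"
  shows "assoc_algebra K (quotient_module A N)"
  by (rule assoc_algebra_surj[OF A carrier_quotient])
    (simp_all add: quotient_add[OF assoc_algebra_module[OF A] N] quotient_mult[OF i] quotient_one
      quotient_smult[OF assoc_algebra_module[OF A] N] quotient_zero[OF assoc_algebra_module[OF A] N])

lemma quotient_algebra_hom:
  assumes "assoc_algebra K A" "submodule N K A" "ideal N A"
  shows "(\<lambda>x. N +>\<^bsub>A\<^esub> x) \<in> algebra_hom K A (quotient_module A N)"
  by (rule algebra_homI)
    (use assms in \<open>simp_all add: quotient_linear assoc_algebra_module quotient_mult quotient_one\<close>)

text \<open>A map that kills \<open>N\<close> sends a coset to a singleton, since a coset is
  nonempty and its members differ by elements of \<open>N\<close>; \<open>the_elem\<close> then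
  returns the value at any representative.\<close>

lemma quotient_lift:
  assumes "module K M" "submodule N K M" "module K W" "h \<in> linear_maps K M W"
    and "\<And>x. x \<in> N \<Longrightarrow> h x = \<zero>\<^bsub>W\<^esub>" and "x \<in> carrier M"
  shows "quotient_lift h (N +>\<^bsub>M\<^esub> x) = h x"
proof -
  interpret N: abelian_subgroup N M using submodule_abelian_subgroup assms by blast
  interpret W: module K W by fact
  have "h y = h x" if "y \<in> N +>\<^bsub>M\<^esub> x" for y
  proof -
    note y = coset_memD[OF assms(1,2,6) that]
    have "h y \<ominus>\<^bsub>W\<^esub> h x = \<zero>\<^bsub>W\<^esub>"
      using linear_minus[OF assms(1,3,4) y(1) assms(6)] assms(5)[OF y(2)] by simp
    moreover have "(h y \<ominus>\<^bsub>W\<^esub> h x) \<oplus>\<^bsub>W\<^esub> h x = h y"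
      using linear_closed[OF assms(4)] y assms(6) by (simp add: W.minus_eq W.a_assoc W.l_neg)
    ultimately show ?thesis
      using linear_closed[OF assms(4)] assms(6) by simp
  qed
  then have "h ` (N +>\<^bsub>M\<^esub> x) = (\<lambda>_. h x) ` (N +>\<^bsub>M\<^esub> x)" by (rule image_cong[OF refl])
  also have "\<dots> = {h x}" using N.a_rcos_self[OF assms(6)] by auto
  finally show ?thesis by (simp add: quotient_lift_def)
qed

lemma quotient_lift_linear:
  assumes "module K M" "submodule N K M" "module K W" "h \<in> linear_maps K M W"
    and "\<And>x. x \<in> N \<Longrightarrow> h x = \<zero>\<^bsub>W\<^esub>"
  shows "quotient_lift h \<in> linear_maps K (quotient_module M N) W"
proof -
  interpret M: module K M by fact
  show ?thesis
    by (rule linear_mapsI)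
      (auto simp: carrier_quotient quotient_add[OF assms(1,2)] quotient_smult[OF assms(1,2)]
        quotient_lift[OF assms] linear_closed[OF assms(4)] linear_add[OF assms(4)]
        linear_smult[OF assms(4)])
qed

lemma quotient_lift_algebra_hom:
  assumes A: "assoc_algebra K A" and N: "submodule N K A" "ideal N A"
    and W: "assoc_algebra K W" and h: "h \<in> algebra_hom K A W"
    and z: "\<And>x. x \<in> N \<Longrightarrow> h x = \<zero>\<^bsub>W\<^esub>"
  shows "quotient_lift h \<in> algebra_hom K (quotient_module A N) W"
proof -
  interpret A: assoc_algebra K A by fact
  note m = assoc_algebra_module[OF A] N(1) assoc_algebra_module[OF W] algebra_hom_linear[OF h] z
  show ?thesis
    by (rule algebra_homI)
      (auto intro!: quotient_lift_linear[OF m] simp: carrier_quotient quotient_mult[OF N(2)]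
        quotient_one quotient_lift[OF m] algebra_hom_mult[OF h] algebra_hom_one[OF h])
qed

lemma submodule_finsum:
  assumes "module K M" "submodule N K M" "finite A" "\<And>i. i \<in> A \<Longrightarrow> g i \<in> N"
  shows "(\<Oplus>\<^bsub>M\<^esub>i\<in>A. g i) \<in> N"
proof -
  interpret M: module K M by fact
  note E = M.submoduleE[OF assms(2)]
  have z: "\<zero>\<^bsub>M\<^esub> \<in> N" using E M.r_neg by (metis equals0I subset_eq)
  show ?thesis using assms(3,4)
  proof (induction A rule: finite_induct)
    case (insert x F)
    then have "g \<in> F \<rightarrow> carrier M" "g x \<in> carrier M" using E(1) by auto
    with insert show ?case using E(5) by simp
  qed (use z in simp)
qed

section \<open>Direct sums\<close>

lemma direct_sum_simps:
  "carrier (direct_sum D) = {x. (\<forall>i. x i \<in> carrier (D i)) \<and> finite {i. x i \<noteq> \<zero>\<^bsub>D i\<^esub>}}"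
  "\<zero>\<^bsub>direct_sum D\<^esub> = (\<lambda>i. \<zero>\<^bsub>D i\<^esub>)"
  "x \<oplus>\<^bsub>direct_sum D\<^esub> y = (\<lambda>i. x i \<oplus>\<^bsub>D i\<^esub> y i)"
  "a \<odot>\<^bsub>direct_sum D\<^esub> x = (\<lambda>i. a \<odot>\<^bsub>D i\<^esub> x i)"
  by (simp_all add: direct_sum_def)

text \<open>The universal map out of a direct sum. On finitely supported functions
  \<open>linear_extension\<close> is an instance, and so are the comultiplication and counit of
  \<open>takeuchi_coalgebra\<close>, so linearity is proved once for all of them.\<close>

definition direct_sum_lift ::
    "('i \<Rightarrow> ('k, 'a, 'm) module_scheme) \<Rightarrow> ('k, 'w, 'n) module_scheme \<Rightarrow> ('i \<Rightarrow> 'a \<Rightarrow> 'w) \<Rightarrow> ('i \<Rightarrow> 'a) \<Rightarrow> 'w"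
  where "direct_sum_lift D W h x = (\<Oplus>\<^bsub>W\<^esub>i \<in> {i. x i \<noteq> \<zero>\<^bsub>D i\<^esub>}. h i (x i))"

context
  fixes K :: "('k, 'r) ring_scheme" and D :: "'i \<Rightarrow> ('k, 'a, 'm) module_scheme"
  assumes D: "\<And>i. module K (D i)"
begin

interpretation D: module K "D i" for i by (rule D)

lemma direct_sum_carrierI:
  assumes "\<And>i. x i \<in> carrier (D i)" "finite A" "\<And>i. i \<notin> A \<Longrightarrow> x i = \<zero>\<^bsub>D i\<^esub>"
  shows "x \<in> carrier (direct_sum D)"
proof -
  have "{i. x i \<noteq> \<zero>\<^bsub>D i\<^esub>} \<subseteq> A" using assms(3) by auto
  then show ?thesis using assms(1,2) finite_subset by (auto simp: direct_sum_simps(1))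
qed

lemma direct_sum_carrierD:
  assumes "x \<in> carrier (direct_sum D)"
  shows "x i \<in> carrier (D i)" "finite {i. x i \<noteq> \<zero>\<^bsub>D i\<^esub>}"
  using assms by (auto simp: direct_sum_simps(1))

lemma module_direct_sum: "module K (direct_sum D)"
proof -
  let ?V = "direct_sum D" and ?s = "\<lambda>x. {i. x i \<noteq> \<zero>\<^bsub>D i\<^esub>}"
  note d = direct_sum_carrierD
  have add: "x \<oplus>\<^bsub>?V\<^esub> y \<in> carrier ?V" if "x \<in> carrier ?V" "y \<in> carrier ?V" for x y
    by (rule direct_sum_carrierI[of _ "?s x \<union> ?s y"])
      (use d[OF that(1)] d[OF that(2)] in \<open>auto simp: direct_sum_simps(3)\<close>)
  have smult: "a \<odot>\<^bsub>?V\<^esub> x \<in> carrier ?V" if "a \<in> carrier K" "x \<in> carrier ?V" for a x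
    by (rule direct_sum_carrierI[of _ "?s x"])
      (use that(1) d[OF that(2)] in \<open>auto simp: direct_sum_simps(4)\<close>)
  have neg: "(\<lambda>i. \<ominus>\<^bsub>D i\<^esub> x i) \<in> carrier ?V" if "x \<in> carrier ?V" for x
    by (rule direct_sum_carrierI[of _ "?s x"]) (use d[OF that] in auto)
  have zero: "\<zero>\<^bsub>?V\<^esub> \<in> carrier ?V"
    by (rule direct_sum_carrierI[of _ "{}"]) (auto simp: direct_sum_simps(2))
  have "abelian_group ?V"
  proof (rule abelian_groupI)
    fix x assume x: "x \<in> carrier ?V"
    show "\<exists>y\<in>carrier ?V. y \<oplus>\<^bsub>?V\<^esub> x = \<zero>\<^bsub>?V\<^esub>"
      by (rule bexI[OF _ neg[OF x]]) (use d[OF x] in \<open>auto simp: direct_sum_simps(2,3) D.l_neg\<close>)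
  next
    fix x y z assume x: "x \<in> carrier ?V" and y: "y \<in> carrier ?V" and z: "z \<in> carrier ?V"
    show "x \<oplus>\<^bsub>?V\<^esub> y \<oplus>\<^bsub>?V\<^esub> z = x \<oplus>\<^bsub>?V\<^esub> (y \<oplus>\<^bsub>?V\<^esub> z)"
      by (simp add: direct_sum_simps(3) D.a_assoc d[OF x] d[OF y] d[OF z])
  next
    fix x y assume x: "x \<in> carrier ?V" and y: "y \<in> carrier ?V"
    show "x \<oplus>\<^bsub>?V\<^esub> y = y \<oplus>\<^bsub>?V\<^esub> x"
      by (simp add: direct_sum_simps(3) D.a_comm d[OF x] d[OF y])
  next
    fix x assume x: "x \<in> carrier ?V"
    show "\<zero>\<^bsub>?V\<^esub> \<oplus>\<^bsub>?V\<^esub> x = x"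
      by (simp add: direct_sum_simps(2,3) d[OF x])
  qed (rule add zero | assumption)+
  then show ?thesis
  proof (rule moduleI[OF D.R.is_cring])
    fix a x y assume a: "a \<in> carrier K" and x: "x \<in> carrier ?V" and y: "y \<in> carrier ?V"
    show "a \<odot>\<^bsub>?V\<^esub> (x \<oplus>\<^bsub>?V\<^esub> y) = a \<odot>\<^bsub>?V\<^esub> x \<oplus>\<^bsub>?V\<^esub> a \<odot>\<^bsub>?V\<^esub> y"
      using a by (simp add: direct_sum_simps(3,4) D.smult_r_distr d[OF x] d[OF y])
  next
    fix a b x assume ab: "a \<in> carrier K" "b \<in> carrier K" and x: "x \<in> carrier ?V"
    show "(a \<oplus>\<^bsub>K\<^esub> b) \<odot>\<^bsub>?V\<^esub> x = a \<odot>\<^bsub>?V\<^esub> x \<oplus>\<^bsub>?V\<^esub> b \<odot>\<^bsub>?V\<^esub> x"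
      using ab by (simp add: direct_sum_simps(3,4) D.smult_l_distr d[OF x])
    show "(a \<otimes>\<^bsub>K\<^esub> b) \<odot>\<^bsub>?V\<^esub> x = a \<odot>\<^bsub>?V\<^esub> (b \<odot>\<^bsub>?V\<^esub> x)"
      using ab by (simp add: direct_sum_simps(4) D.smult_assoc1 d[OF x])
  next
    fix x assume x: "x \<in> carrier ?V"
    show "\<one>\<^bsub>K\<^esub> \<odot>\<^bsub>?V\<^esub> x = x"
      by (simp add: direct_sum_simps(4) d[OF x])
  qed (rule smult, assumption+)
qed

lemma direct_sum_inc_linear: "direct_sum_inc D i \<in> linear_maps K (D i) (direct_sum D)"
proof (rule linear_mapsI)
  fix x assume "x \<in> carrier (D i)"
  then show "direct_sum_inc D i x \<in> carrier (direct_sum D)"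
    by (intro direct_sum_carrierI[of _ "{i}"]) (auto simp: direct_sum_inc_def)
qed (auto simp: direct_sum_inc_def direct_sum_simps(3,4))

lemma direct_sum_eval_linear: "(\<lambda>x. x i) \<in> linear_maps K (direct_sum D) (D i)"
  by (rule linear_mapsI) (auto simp: direct_sum_simps)

context
  fixes W :: "('k, 'w, 'n) module_scheme" and h
  assumes W: "module K W" and h: "\<And>i. h i \<in> linear_maps K (D i) W"
begin

interpretation W: module K W by (rule W)

text \<open>Additivity compares sums over three different supports. Indices outside the support
  contribute \<open>h i\<close> of zero, so all three can be taken over one common finite
  set.\<close>

lemma direct_sum_lift_superset:
  assumes x: "x \<in> carrier (direct_sum D)" and A: "finite A" "{i. x i \<noteq> \<zero>\<^bsub>D i\<^esub>} \<subseteq> A"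
  shows "direct_sum_lift D W h x = (\<Oplus>\<^bsub>W\<^esub>i \<in> A. h i (x i))"
  unfolding direct_sum_lift_def
proof (rule W.add.finprod_mono_neutral_cong_left)
  show "h i (x i) = \<zero>\<^bsub>W\<^esub>" if "i \<in> A - {i. x i \<noteq> \<zero>\<^bsub>D i\<^esub>}" for i
    using that linear_zero[OF D W h] by simp
qed (use A direct_sum_carrierD(1)[OF x] linear_closed[OF h] in auto)

lemma direct_sum_lift_linear: "direct_sum_lift D W h \<in> linear_maps K (direct_sum D) W"
proof (rule linear_mapsI)
  interpret V: module K "direct_sum D" by (rule module_direct_sum)
  let ?s = "\<lambda>x. {i. x i \<noteq> \<zero>\<^bsub>D i\<^esub>}"
  fix x assume x: "x \<in> carrier (direct_sum D)"
  note dx = direct_sum_carrierD[OF x]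
  have hx: "h i (x i) \<in> carrier W" for i using linear_closed[OF h dx(1)] .
  then show "direct_sum_lift D W h x \<in> carrier W" by (auto simp: direct_sum_lift_def)
  {
    fix y assume y: "y \<in> carrier (direct_sum D)"
    note dy = direct_sum_carrierD[OF y]
    have hy: "h i (y i) \<in> carrier W" for i using linear_closed[OF h dy(1)] .
    have A: "finite (?s x \<union> ?s y)" using dx dy by simp
    have "?s (x \<oplus>\<^bsub>direct_sum D\<^esub> y) \<subseteq> ?s x \<union> ?s y" by (auto simp: direct_sum_simps(3))
    from direct_sum_lift_superset[OF V.a_closed[OF x y] A this]
    have "direct_sum_lift D W h (x \<oplus>\<^bsub>direct_sum D\<^esub> y) = (\<Oplus>\<^bsub>W\<^esub>i \<in> ?s x \<union> ?s y. h i (x i) \<oplus>\<^bsub>W\<^esub> h i (y i))"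
      by (simp add: direct_sum_simps(3) linear_add[OF h dx(1) dy(1)])
    also have "\<dots> = direct_sum_lift D W h x \<oplus>\<^bsub>W\<^esub> direct_sum_lift D W h y"
      using direct_sum_lift_superset[OF x A] direct_sum_lift_superset[OF y A] hx hy
      by (simp add: W.finsum_addf)
    finally show "direct_sum_lift D W h (x \<oplus>\<^bsub>direct_sum D\<^esub> y) = direct_sum_lift D W h x \<oplus>\<^bsub>W\<^esub> direct_sum_lift D W h y" .
  }
  fix a assume a: "a \<in> carrier K"
  have "?s (a \<odot>\<^bsub>direct_sum D\<^esub> x) \<subseteq> ?s x" using a by (auto simp: direct_sum_simps(4))
  from direct_sum_lift_superset[OF V.smult_closed[OF a x] dx(2) this]
  have "direct_sum_lift D W h (a \<odot>\<^bsub>direct_sum D\<^esub> x) = (\<Oplus>\<^bsub>W\<^esub>i \<in> ?s x. a \<odot>\<^bsub>W\<^esub> h i (x i))"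
    by (simp add: direct_sum_simps(4) linear_smult[OF h a dx(1)])
  also have "\<dots> = a \<odot>\<^bsub>W\<^esub> direct_sum_lift D W h x"
    unfolding direct_sum_lift_def using W.finsum_smult_ldistr[OF dx(2) a, of "\<lambda>i. h i (x i)"] hx by simp
  finally show "direct_sum_lift D W h (a \<odot>\<^bsub>direct_sum D\<^esub> x) = a \<odot>\<^bsub>W\<^esub> direct_sum_lift D W h x" .
qed

lemma direct_sum_lift_inc:
  assumes x: "x \<in> carrier (D i)"
  shows "direct_sum_lift D W h (direct_sum_inc D i x) = h i x"
proof -
  have "direct_sum_lift D W h (direct_sum_inc D i x) = (\<Oplus>\<^bsub>W\<^esub>j \<in> {i}. h j (direct_sum_inc D i x j))"
    by (rule direct_sum_lift_superset[OF linear_closed[OF direct_sum_inc_linear x]])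
      (auto simp: direct_sum_inc_def split: if_splits)
  then show ?thesis using linear_closed[OF h x] by (simp add: direct_sum_inc_def)
qed

end

text \<open>Each element is the finite sum of the inclusions of its components. This is checked
  coordinatewise, because evaluation at \<open>j\<close> is linear and may be moved inside the
  sum.\<close>

lemma span_direct_sum:
  "submodule_span K (direct_sum D) (\<Union>i. direct_sum_inc D i ` carrier (D i)) = carrier (direct_sum D)"
    (is "submodule_span K ?V ?S = _")
proof
  interpret V: module K ?V by (rule module_direct_sum)
  have S: "?S \<subseteq> carrier ?V"
    using linear_closed[OF direct_sum_inc_linear] by auto
  then show "submodule_span K ?V ?S \<subseteq> carrier ?V"
    by (intro span_least V.carrier_is_submodule)
  note sm = submodule_span[OF V.module_axioms S]
  show "carrier ?V \<subseteq> submodule_span K ?V ?S"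
  proof
    fix x assume x: "x \<in> carrier ?V"
    note d = direct_sum_carrierD[OF x]
    let ?s = "{i. x i \<noteq> \<zero>\<^bsub>D i\<^esub>}"
    have ic: "(\<lambda>i. direct_sum_inc D i (x i)) \<in> ?s \<rightarrow> carrier ?V"
      using linear_closed[OF direct_sum_inc_linear d(1)] by auto
    have "(\<Oplus>\<^bsub>?V\<^esub>i \<in> ?s. direct_sum_inc D i (x i)) = x"
    proof
      fix j
      have "(\<Oplus>\<^bsub>?V\<^esub>i \<in> ?s. direct_sum_inc D i (x i)) j = (\<Oplus>\<^bsub>D j\<^esub>i \<in> ?s. direct_sum_inc D i (x i) j)"
        using linear_finsum[OF V.module_axioms D direct_sum_eval_linear d(2) ic] .
      also have "\<dots> = x j"
      proof (cases "j \<in> ?s")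
        case True
        have "(\<Oplus>\<^bsub>D j\<^esub>i \<in> ?s. direct_sum_inc D i (x i) j) = (\<Oplus>\<^bsub>D j\<^esub>i \<in> ?s. if j = i then x j else \<zero>\<^bsub>D j\<^esub>)"
          by (rule D.M.finsum_cong') (use d in \<open>auto simp: direct_sum_inc_def\<close>)
        also have "\<dots> = x j"
          by (rule D.M.finsum_singleton) (use True d in auto)
        finally show ?thesis .
      next
        case False
        have "(\<Oplus>\<^bsub>D j\<^esub>i \<in> ?s. direct_sum_inc D i (x i) j) = \<zero>\<^bsub>D j\<^esub>"
          by (rule D.M.add.finprod_one_eqI) (use False in \<open>auto simp: direct_sum_inc_def\<close>)
        then show ?thesis using False by simp
      qed
      finally show "(\<Oplus>\<^bsub>?V\<^esub>i \<in> ?s. direct_sum_inc D i (x i)) j = x j" .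
    qed
    moreover have "(\<Oplus>\<^bsub>?V\<^esub>i \<in> ?s. direct_sum_inc D i (x i)) \<in> submodule_span K ?V ?S"
      using d(1) span_superset[of ?S K ?V]
      by (intro submodule_finsum[OF V.module_axioms sm d(2)]) blast
    ultimately show "x \<in> submodule_span K ?V ?S" by simp
  qed
qed

end

section \<open>Free modules and monoid algebras\<close>

lemma monoid_algebra_simps:
  "carrier (monoid_algebra K G) =
    {f. range f \<subseteq> carrier K \<and> support K f \<subseteq> carrier G \<and> finite (support K f)}"
  "\<one>\<^bsub>monoid_algebra K G\<^esub> = basis_elt K \<one>\<^bsub>G\<^esub>"
  "\<zero>\<^bsub>monoid_algebra K G\<^esub> = (\<lambda>_. \<zero>\<^bsub>K\<^esub>)"
  "f \<oplus>\<^bsub>monoid_algebra K G\<^esub> g = (\<lambda>x. f x \<oplus>\<^bsub>K\<^esub> g x)"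
  "a \<odot>\<^bsub>monoid_algebra K G\<^esub> f = (\<lambda>x. a \<otimes>\<^bsub>K\<^esub> f x)"
  by (auto simp: monoid_algebra_def)

lemma monoid_algebra_carrierD:
  assumes "f \<in> carrier (monoid_algebra K G)"
  shows "f x \<in> carrier K" "finite (support K f)" "support K f \<subseteq> carrier G"
  using assms by (auto simp: monoid_algebra_simps)

lemma self_moduleK: "cring K \<Longrightarrow> module K (self_module K)"
  by (rule assoc_algebra_module[OF assoc_algebra_self])

text \<open>The free module on \<open>carrier G\<close> is a direct sum, indexed by the whole type of \<open>G\<close>, in which the
  indices outside \<open>carrier G\<close> contribute the zero module.\<close>

definition coefficients ::
    "('k, 'r) ring_scheme \<Rightarrow> ('g, 'n) monoid_scheme \<Rightarrow> 'g \<Rightarrow> ('k, 'k) module"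
  where "coefficients K G x =
    (if x \<in> carrier G then self_module K else (self_module K)\<lparr>carrier := {\<zero>\<^bsub>K\<^esub>}\<rparr>)"

lemma coefficients_simps:
  "carrier (coefficients K G x) = (if x \<in> carrier G then carrier K else {\<zero>\<^bsub>K\<^esub>})"
  "add (coefficients K G x) = add K" "zero (coefficients K G x) = \<zero>\<^bsub>K\<^esub>"
  "smult (coefficients K G x) = mult K"
  by (simp_all add: coefficients_def)

context
  fixes K :: "('k, 'r) ring_scheme" and G :: "('g, 'n) monoid_scheme"
  assumes K: "cring K"
begin

interpretation K: cring K by (rule K)

lemma module_coefficients: "module K (coefficients K G x)"
proof (cases "x \<in> carrier G")
  case False
  have "abelian_group (coefficients K G x)"
    by (rule abelian_groupI) (use False in \<open>auto simp: coefficients_simps\<close>)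
  then show ?thesis
    by (rule moduleI[OF K]) (use False in \<open>auto simp: coefficients_simps\<close>)
qed (simp add: coefficients_def self_moduleK[OF K])

lemma monoid_algebra_direct_sum:
  "carrier (monoid_algebra K G) = carrier (direct_sum (coefficients K G))"
  "\<zero>\<^bsub>monoid_algebra K G\<^esub> = \<zero>\<^bsub>direct_sum (coefficients K G)\<^esub>"
  "add (monoid_algebra K G) = add (direct_sum (coefficients K G))"
  "smult (monoid_algebra K G) = smult (direct_sum (coefficients K G))"
proof -
  have "f \<in> carrier (monoid_algebra K G) \<longleftrightarrow> f \<in> carrier (direct_sum (coefficients K G))" for f
  proof
    assume f: "f \<in> carrier (direct_sum (coefficients K G))"
    then have "f x \<in> carrier K" for x
      by (cases "x \<in> carrier G")
        (auto simp: direct_sum_simps coefficients_simps dest: spec[of _ x])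
    with f show "f \<in> carrier (monoid_algebra K G)"
      by (auto simp: monoid_algebra_simps direct_sum_simps coefficients_simps support_def split: if_splits)
  qed (auto simp: monoid_algebra_simps direct_sum_simps coefficients_simps support_def)
  then show "carrier (monoid_algebra K G) = carrier (direct_sum (coefficients K G))" by blast
qed (auto simp: fun_eq_iff monoid_algebra_simps direct_sum_simps coefficients_simps)

lemma module_monoid_algebra: "module K (monoid_algebra K G)"
  by (rule module_surj[OF module_direct_sum[OF module_coefficients], of _ "\<lambda>x. x"])
    (simp_all add: monoid_algebra_direct_sum)

lemma linear_maps_monoid_algebra:
  "linear_maps K (monoid_algebra K G) W = linear_maps K (direct_sum (coefficients K G)) W"
  "linear_maps K W' (monoid_algebra K G) = linear_maps K W' (direct_sum (coefficients K G))"
  by (simp_all add: linear_maps_def monoid_algebra_direct_sum)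

lemma basis_elt_inc:
  "x \<in> carrier G \<Longrightarrow> basis_elt K x = direct_sum_inc (coefficients K G) x \<one>\<^bsub>K\<^esub>"
  by (simp add: fun_eq_iff basis_elt_def direct_sum_inc_def coefficients_simps)

lemma basis_elt_carrier: "x \<in> carrier G \<Longrightarrow> basis_elt K x \<in> carrier (monoid_algebra K G)"
  using linear_closed[OF direct_sum_inc_linear[OF module_coefficients, where i = x], of "\<one>\<^bsub>K\<^esub>"]
  by (simp add: basis_elt_inc monoid_algebra_direct_sum coefficients_simps)

text \<open>Derived from the direct sum: the inclusion of a scalar is a multiple of a basis element
  for an index in \<open>carrier G\<close>, and zero for any other index.\<close>

lemma span_basis:
  "submodule_span K (monoid_algebra K G) (basis_elt K ` carrier G) = carrier (monoid_algebra K G)"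
    (is "submodule_span K ?P ?B = _")
proof -
  let ?D = "coefficients K G"
  let ?S = "\<Union>x. direct_sum_inc ?D x ` carrier (?D x)"
  interpret P: module K ?P by (rule module_monoid_algebra)
  have B: "?B \<subseteq> carrier ?P" using basis_elt_carrier by auto
  note sm = submodule_span[OF P.module_axioms B]
  have zero: "\<zero>\<^bsub>?P\<^esub> \<in> submodule_span K ?P ?B"
    using submodule_finsum[OF P.module_axioms sm, of "{}"] by simp
  have "direct_sum_inc ?D x c \<in> submodule_span K ?P ?B" if "c \<in> carrier (?D x)" for x c
  proof (cases "x \<in> carrier G")
    case True
    then have "direct_sum_inc ?D x c = c \<odot>\<^bsub>?P\<^esub> basis_elt K x" "c \<in> carrier K"
      using that by (auto simp: fun_eq_iff basis_elt_def direct_sum_inc_def coefficients_simps monoid_algebra_simps)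
    then show ?thesis
      using P.submoduleE(4)[OF sm] span_superset[of ?B K ?P] True by auto
  next
    case False
    then have "direct_sum_inc ?D x c = \<zero>\<^bsub>?P\<^esub>"
      using that by (simp add: fun_eq_iff direct_sum_inc_def coefficients_simps monoid_algebra_simps)
    then show ?thesis using zero by simp
  qed
  then have "submodule_span K ?P ?S \<subseteq> submodule_span K ?P ?B"
    by (intro span_least[OF sm]) auto
  \<comment> \<open>The span refers to the module record. The identity map carries the statement
    from the record \<open>direct_sum\<close> to the record \<open>monoid_algebra\<close>, which has
    the same module fields.\<close>
  moreover have "submodule_span K ?P ((\<lambda>x. x) ` ?S) = carrier ?P"
    by (rule span_image[OF module_direct_sum[OF module_coefficients] P.module_axioms _ _
          span_direct_sum[OF module_coefficients]])
      (use linear_id[of K "direct_sum ?D"] in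
        \<open>simp_all add: linear_maps_monoid_algebra monoid_algebra_direct_sum\<close>)
  ultimately show ?thesis
    using P.submoduleE(1)[OF sm] by simp
qed

end

context
  fixes K :: "('k, 'r) ring_scheme" and G :: "('g, 'n) monoid_scheme"
    and W :: "('k, 'w, 'o) module_scheme" and h
  assumes W: "module K W" and h: "h \<in> carrier G \<rightarrow> carrier W"
begin

interpretation W: module K W by (rule W)

text \<open>The direct sum is indexed by the whole type, while \<open>h\<close> is controlled only
  on \<open>carrier G\<close>. Elsewhere the component is the zero map on the zero module.\<close>

lemma linear_extension_component:
  "(\<lambda>c. if x \<in> carrier G then c \<odot>\<^bsub>W\<^esub> h x else \<zero>\<^bsub>W\<^esub>) \<in> linear_maps K (coefficients K G x) W"
  by (rule linear_mapsI) (use h in \<open>auto simp: coefficients_simps W.smult_l_distr W.smult_assoc1 Pi_iff\<close>)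

lemma linear_extension_direct_sum:
  assumes "f \<in> carrier (monoid_algebra K G)"
  shows "linear_extension K W h f = direct_sum_lift (coefficients K G) W
    (\<lambda>x c. if x \<in> carrier G then c \<odot>\<^bsub>W\<^esub> h x else \<zero>\<^bsub>W\<^esub>) f"
  unfolding linear_extension_def direct_sum_lift_def support_def coefficients_simps
  by (rule W.finsum_cong') (use monoid_algebra_carrierD[OF assms] h in \<open>auto simp: support_def Pi_iff\<close>)

lemma linear_extension_linear: "linear_extension K W h \<in> linear_maps K (monoid_algebra K G) W"
  by (rule linear_cong[OF _ module_monoid_algebra[OF W.R.is_cring] linear_extension_direct_sum[symmetric]])
    (simp_all add: linear_maps_monoid_algebra[OF W.R.is_cring] direct_sum_lift_linear[OF module_coefficients[OF W.R.is_cring] W linear_extension_component])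

lemma linear_extension_basis:
  assumes "x \<in> carrier G" shows "linear_extension K W h (basis_elt K x) = h x"
  unfolding linear_extension_direct_sum[OF basis_elt_carrier[OF W.R.is_cring assms]]
  unfolding basis_elt_inc[OF W.R.is_cring assms]
  by (subst direct_sum_lift_inc[OF module_coefficients[OF W.R.is_cring] W linear_extension_component])
    (use assms h in \<open>auto simp: coefficients_simps Pi_iff\<close>)

end

lemma eval_linear:
  "(\<lambda>f. f z) \<in> linear_maps K (monoid_algebra K G) (self_module K)"
  by (rule linear_mapsI) (auto simp: monoid_algebra_simps)

lemma linear_extension_eval:
  assumes "cring K" "h \<in> carrier G \<rightarrow> carrier (monoid_algebra K H)" "f \<in> carrier (monoid_algebra K G)"
  shows "linear_extension K (monoid_algebra K H) h f z = linear_extension K (self_module K) (\<lambda>x. h x z) f"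
proof -
  let ?P = "monoid_algebra K H"
  interpret P: module K ?P using module_monoid_algebra assms(1) .
  have s: "module K (self_module K)" using assoc_algebra_self[OF assms(1)] assoc_algebra_module by blast
  note D = monoid_algebra_carrierD[OF assms(3)]
  have c: "(\<lambda>x. f x \<odot>\<^bsub>?P\<^esub> h x) \<in> support K f \<rightarrow> carrier ?P"
    using D assms(2) by auto
  show ?thesis
    unfolding linear_extension_def
    using linear_finsum[OF P.module_axioms s eval_linear[of z] D(2) c]
    by (simp add: monoid_algebra_simps(5))
qed

section \<open>The convolution product of a monoid algebra\<close>

lemma finsum_cartesian:
  assumes "abelian_group M" "finite A" "finite B" "f \<in> A \<times> B \<rightarrow> carrier M"
  shows "(\<Oplus>\<^bsub>M\<^esub>p \<in> A \<times> B. f p) = (\<Oplus>\<^bsub>M\<^esub>a\<in>A. \<Oplus>\<^bsub>M\<^esub>b\<in>B. f (a, b))"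
proof -
  interpret M: abelian_group M by fact
  show ?thesis using assms(2,4)
  proof (induction A rule: finite_induct)
    case (insert x F)
    have r: "(\<Oplus>\<^bsub>M\<^esub>p \<in> {x} \<times> B. f p) = (\<Oplus>\<^bsub>M\<^esub>b\<in>B. f (x, b))"
    proof -
      have "{x} \<times> B = Pair x ` B" by auto
      moreover have "(\<Oplus>\<^bsub>M\<^esub>p \<in> Pair x ` B. f p) = (\<Oplus>\<^bsub>M\<^esub>b\<in>B. f (x, b))"
        by (rule M.finsum_reindex) (use insert in \<open>auto simp: inj_on_def\<close>)
      ultimately show ?thesis by simp
    qed
    have "insert x F \<times> B = {x} \<times> B \<union> F \<times> B" by auto
    then have "(\<Oplus>\<^bsub>M\<^esub>p \<in> insert x F \<times> B. f p) =
        (\<Oplus>\<^bsub>M\<^esub>p \<in> {x} \<times> B. f p) \<oplus>\<^bsub>M\<^esub> (\<Oplus>\<^bsub>M\<^esub>p \<in> F \<times> B. f p)"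
      using insert(1,2,4) assms(3) by (simp only:) (rule M.finsum_Un_disjoint, auto)
    also have "\<dots> = (\<Oplus>\<^bsub>M\<^esub>b\<in>B. f (x, b)) \<oplus>\<^bsub>M\<^esub> (\<Oplus>\<^bsub>M\<^esub>a\<in>F. \<Oplus>\<^bsub>M\<^esub>b\<in>B. f (a, b))"
      using insert r by (simp add: Pi_iff)
    also have "\<dots> = (\<Oplus>\<^bsub>M\<^esub>a\<in>insert x F. \<Oplus>\<^bsub>M\<^esub>b\<in>B. f (a, b))"
      using insert by (subst M.finsum_insert) (auto intro!: M.finsum_closed)
    finally show ?case .
  qed simp
qed

text \<open>Rewrites the convolution sum, whose index set depends on the supports of both factors,
  as an iterated linear extension of the product of \<open>G\<close>. Bilinearity can then be read
  off from \<open>linear_extension\<close>.\<close>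

lemma monoid_algebra_mult:
  assumes "cring K" "monoid G" "f \<in> carrier (monoid_algebra K G)" "g \<in> carrier (monoid_algebra K G)"
  shows "f \<otimes>\<^bsub>monoid_algebra K G\<^esub> g = linear_extension K (monoid_algebra K G)
    (\<lambda>x. linear_extension K (monoid_algebra K G) (\<lambda>y. basis_elt K (x \<otimes>\<^bsub>G\<^esub> y)) g) f"
proof
  fix z
  let ?P = "monoid_algebra K G"
  interpret K: cring K by fact
  interpret G: monoid G by fact
  interpret P: module K ?P using module_monoid_algebra assms(1) .
  interpret s: module K "self_module K" using assoc_algebra_self[OF assms(1)] assoc_algebra_module by blast
  note Df = monoid_algebra_carrierD[OF assms(3)] and Dg = monoid_algebra_carrierD[OF assms(4)]
  have b: "(\<lambda>y. basis_elt K (x \<otimes>\<^bsub>G\<^esub> y)) \<in> carrier G \<rightarrow> carrier ?P" if "x \<in> carrier G" for x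
    using that by (auto intro!: basis_elt_carrier assms(1))
  have l: "linear_extension K ?P (\<lambda>y. basis_elt K (x \<otimes>\<^bsub>G\<^esub> y)) g \<in> carrier ?P" if "x \<in> carrier G" for x
    using linear_closed[OF linear_extension_linear[OF P.module_axioms b[OF that]] assms(4)] .
  \<comment> \<open>\<open>finsum\<close> depends only on carrier, addition and zero, and these are
    shared by the two records.\<close>
  have fs: "finsum (self_module K) = finsum K"
    by (simp add: fun_eq_iff finsum_def finprod_def)
  let ?e = "\<lambda>x y. basis_elt K (x \<otimes>\<^bsub>G\<^esub> y) z"
  have e: "?e x y \<in> carrier K" for x y by (simp add: basis_elt_def)
  have "linear_extension K ?P (\<lambda>x. linear_extension K ?P (\<lambda>y. basis_elt K (x \<otimes>\<^bsub>G\<^esub> y)) g) f z =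
    (\<Oplus>\<^bsub>K\<^esub>x\<in>support K f. f x \<otimes>\<^bsub>K\<^esub> (linear_extension K ?P (\<lambda>y. basis_elt K (x \<otimes>\<^bsub>G\<^esub> y)) g z))"
    using l by (subst linear_extension_eval[OF assms(1) _ assms(3)]) (auto simp: linear_extension_def fs)
  also have "\<dots> = (\<Oplus>\<^bsub>K\<^esub>x\<in>support K f. f x \<otimes>\<^bsub>K\<^esub> (\<Oplus>\<^bsub>K\<^esub>y\<in>support K g. g y \<otimes>\<^bsub>K\<^esub> ?e x y))"
  proof (rule K.finsum_cong')
    fix x assume "x \<in> support K f"
    then have x: "x \<in> carrier G" using Df by auto
    show "f x \<otimes>\<^bsub>K\<^esub> (linear_extension K ?P (\<lambda>y. basis_elt K (x \<otimes>\<^bsub>G\<^esub> y)) g z) =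
       f x \<otimes>\<^bsub>K\<^esub> (\<Oplus>\<^bsub>K\<^esub>y\<in>support K g. g y \<otimes>\<^bsub>K\<^esub> ?e x y)"
      by (subst linear_extension_eval[OF assms(1) b[OF x] assms(4)]) (auto simp: linear_extension_def fs)
  qed (use Df Dg e in auto)
  also have "\<dots> = (\<Oplus>\<^bsub>K\<^esub>x\<in>support K f. \<Oplus>\<^bsub>K\<^esub>y\<in>support K g. f x \<otimes>\<^bsub>K\<^esub> (g y \<otimes>\<^bsub>K\<^esub> ?e x y))"
    by (rule K.finsum_cong') (use Df Dg e in \<open>auto simp: K.finsum_rdistr\<close>)
  also have "\<dots> = (\<Oplus>\<^bsub>K\<^esub>p\<in>support K f \<times> support K g. f (fst p) \<otimes>\<^bsub>K\<^esub> (g (snd p) \<otimes>\<^bsub>K\<^esub> ?e (fst p) (snd p)))"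
    by (subst finsum_cartesian) (use Df Dg e in \<open>auto simp: K.is_abelian_group\<close>)
  \<comment> \<open>The coefficient \<open>?e x y\<close> is one if the product of \<open>x\<close>
    and \<open>y\<close> is \<open>z\<close> and zero otherwise, so exactly the pairs of the
    convolution sum survive.\<close>
  also have "\<dots> = (f \<otimes>\<^bsub>?P\<^esub> g) z"
    unfolding monoid_algebra_def monoid.simps
    by (rule K.add.finprod_mono_neutral_cong_right)
      (use Df Dg in \<open>auto simp: basis_elt_def\<close>)
  finally show "(f \<otimes>\<^bsub>?P\<^esub> g) z = linear_extension K ?P
    (\<lambda>x. linear_extension K ?P (\<lambda>y. basis_elt K (x \<otimes>\<^bsub>G\<^esub> y)) g) f z" by simp
qed

lemma monoid_algebra_mult_linear:
  assumes "cring K" "monoid G" "f \<in> carrier (monoid_algebra K G)"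
  shows "(\<lambda>g. g \<otimes>\<^bsub>monoid_algebra K G\<^esub> f) \<in> linear_maps K (monoid_algebra K G) (monoid_algebra K G)" (is ?l)
    and "(\<lambda>g. f \<otimes>\<^bsub>monoid_algebra K G\<^esub> g) \<in> linear_maps K (monoid_algebra K G) (monoid_algebra K G)" (is ?r)
proof -
  let ?P = "monoid_algebra K G"
  interpret G: monoid G by fact
  interpret P: module K ?P using module_monoid_algebra assms(1) .
  note D = monoid_algebra_carrierD[OF assms(3)]
  have b: "(\<lambda>y. basis_elt K (x \<otimes>\<^bsub>G\<^esub> y)) \<in> carrier G \<rightarrow> carrier ?P" if "x \<in> carrier G" for x
    using that by (auto intro!: basis_elt_carrier assms(1))
  note l = linear_extension_linear[OF P.module_axioms b]
  have "(\<lambda>x. linear_extension K ?P (\<lambda>y. basis_elt K (x \<otimes>\<^bsub>G\<^esub> y)) f) \<in> carrier G \<rightarrow> carrier ?P"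
    using linear_closed[OF l assms(3)] by auto
  from linear_extension_linear[OF P.module_axioms this] show ?l
    by (rule linear_cong) (auto simp: P.module_axioms monoid_algebra_mult[OF assms(1,2) _ assms(3)])
  \<comment> \<open>For fixed \<open>f\<close> the outer sum is a finite sum of linear maps in
    \<open>g\<close>. The index set is generalised from the support of \<open>f\<close> to a finite
    subset \<open>A\<close> of \<open>carrier G\<close>, which makes induction possible.\<close>
  have "(\<lambda>g. \<Oplus>\<^bsub>?P\<^esub>x\<in>A. f x \<odot>\<^bsub>?P\<^esub> linear_extension K ?P (\<lambda>y. basis_elt K (x \<otimes>\<^bsub>G\<^esub> y)) g)
      \<in> linear_maps K ?P ?P" if "finite A" "A \<subseteq> carrier G" for A
    using that
  proof (induction A rule: finite_induct)
    case empty
    then show ?case by (auto intro!: linear_mapsI)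
  next
    case (insert x F)
    have "(\<lambda>g. f x \<odot>\<^bsub>?P\<^esub> linear_extension K ?P (\<lambda>y. basis_elt K (x \<otimes>\<^bsub>G\<^esub> y)) g \<oplus>\<^bsub>?P\<^esub>
       (\<Oplus>\<^bsub>?P\<^esub>x\<in>F. f x \<odot>\<^bsub>?P\<^esub> linear_extension K ?P (\<lambda>y. basis_elt K (x \<otimes>\<^bsub>G\<^esub> y)) g)) \<in> linear_maps K ?P ?P"
      using insert D by (intro linear_addf linear_smult_const l) (auto simp: P.module_axioms)
    then show ?case
      by (rule linear_cong) (use insert D in \<open>auto simp: P.module_axioms linear_closed[OF l] subset_iff
        intro!: P.finsum_insert[symmetric]\<close>)
  qed
  from this[OF D(2,3)] show ?r
    by (rule linear_cong)
      (auto simp: P.module_axioms monoid_algebra_mult[OF assms(1,2) assms(3)] linear_extension_def)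
qed

lemma basis_elt_mult:
  assumes "cring K" "monoid G" "x \<in> carrier G" "y \<in> carrier G"
  shows "basis_elt K x \<otimes>\<^bsub>monoid_algebra K G\<^esub> basis_elt K y = basis_elt K (x \<otimes>\<^bsub>G\<^esub> y)"
proof -
  let ?P = "monoid_algebra K G"
  interpret G: monoid G by fact
  have m: "module K ?P" using module_monoid_algebra assms(1) .
  have b: "(\<lambda>y. basis_elt K (x \<otimes>\<^bsub>G\<^esub> y)) \<in> carrier G \<rightarrow> carrier ?P" if "x \<in> carrier G" for x
    using that by (auto intro!: basis_elt_carrier assms(1))
  have c: "(\<lambda>x. linear_extension K ?P (\<lambda>y. basis_elt K (x \<otimes>\<^bsub>G\<^esub> y)) (basis_elt K y)) \<in> carrier G \<rightarrow> carrier ?P"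
    by (auto intro!: linear_closed[OF linear_extension_linear[OF m b]] basis_elt_carrier assms)
  show ?thesis
    using assms
    by (simp add: basis_elt_carrier monoid_algebra_mult linear_extension_basis[OF m c] linear_extension_basis[OF m b])
qed

text \<open>Associativity is a trilinear identity. It holds on basis elements by associativity of
  \<open>G\<close>, and the three arguments are freed one after the other, from right to
  left.\<close>

lemma assoc_algebra_monoid_algebra:
  assumes "cring K" "monoid G"
  shows "assoc_algebra K (monoid_algebra K G)"
proof -
  let ?P = "monoid_algebra K G"
  interpret G: monoid G by fact
  interpret P: module K ?P using module_monoid_algebra assms(1) .
  note l = monoid_algebra_mult_linear[OF assms]
  note m = P.module_axioms
  have c: "f \<otimes>\<^bsub>?P\<^esub> g \<in> carrier ?P" if "f \<in> carrier ?P" "g \<in> carrier ?P" for f g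
    using linear_closed[OF l(2)] that by blast
  note ext = linear_ext[OF m m _ _ span_basis[OF assms(1)]]
  note bc = basis_elt_carrier[OF assms(1)]
  note bm = basis_elt_mult[OF assms]
  have 1: "basis_elt K x \<otimes>\<^bsub>?P\<^esub> basis_elt K y \<otimes>\<^bsub>?P\<^esub> h = basis_elt K x \<otimes>\<^bsub>?P\<^esub> (basis_elt K y \<otimes>\<^bsub>?P\<^esub> h)"
    if "x \<in> carrier G" "y \<in> carrier G" "h \<in> carrier ?P" for x y h
    by (rule ext[of "\<lambda>h. basis_elt K x \<otimes>\<^bsub>?P\<^esub> basis_elt K y \<otimes>\<^bsub>?P\<^esub> h"
          "\<lambda>h. basis_elt K x \<otimes>\<^bsub>?P\<^esub> (basis_elt K y \<otimes>\<^bsub>?P\<^esub> h)", OF _ _ _ that(3)])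
      (use that in \<open>auto intro!: l(2) c bc linear_comp[OF l(2)] simp: bm G.m_assoc\<close>)
  have 2: "basis_elt K x \<otimes>\<^bsub>?P\<^esub> g \<otimes>\<^bsub>?P\<^esub> h = basis_elt K x \<otimes>\<^bsub>?P\<^esub> (g \<otimes>\<^bsub>?P\<^esub> h)"
    if "x \<in> carrier G" "g \<in> carrier ?P" "h \<in> carrier ?P" for x g h
    by (rule ext[of "\<lambda>g. basis_elt K x \<otimes>\<^bsub>?P\<^esub> g \<otimes>\<^bsub>?P\<^esub> h" "\<lambda>g. basis_elt K x \<otimes>\<^bsub>?P\<^esub> (g \<otimes>\<^bsub>?P\<^esub> h)", OF _ _ _ that(2)])
      (use that in \<open>auto intro!: 1 l c bc linear_comp[OF l(1)[OF that(3)] l(2)]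
        linear_comp[OF l(2) l(1)[OF that(3)]]\<close>)
  have 3: "f \<otimes>\<^bsub>?P\<^esub> g \<otimes>\<^bsub>?P\<^esub> h = f \<otimes>\<^bsub>?P\<^esub> (g \<otimes>\<^bsub>?P\<^esub> h)"
    if "f \<in> carrier ?P" "g \<in> carrier ?P" "h \<in> carrier ?P" for f g h
    by (rule ext[of "\<lambda>f. f \<otimes>\<^bsub>?P\<^esub> g \<otimes>\<^bsub>?P\<^esub> h" "\<lambda>f. f \<otimes>\<^bsub>?P\<^esub> (g \<otimes>\<^bsub>?P\<^esub> h)", OF _ _ _ that(1)])
      (use that in \<open>auto intro!: 2 l c bc linear_comp[OF l(1)[OF that(3)] l(1)]\<close>)
  have o: "\<one>\<^bsub>?P\<^esub> \<in> carrier ?P" "\<one>\<^bsub>?P\<^esub> = basis_elt K \<one>\<^bsub>G\<^esub>"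
    by (auto simp: monoid_algebra_simps(2) bc)
  have lid: "\<one>\<^bsub>?P\<^esub> \<otimes>\<^bsub>?P\<^esub> f = f" if "f \<in> carrier ?P" for f
    by (rule ext[of "\<lambda>f. \<one>\<^bsub>?P\<^esub> \<otimes>\<^bsub>?P\<^esub> f" "\<lambda>f. f", OF l(2)[OF o(1)] linear_id _ that]) (auto simp: o(2) bm)
  have rid: "f \<otimes>\<^bsub>?P\<^esub> \<one>\<^bsub>?P\<^esub> = f" if "f \<in> carrier ?P" for f
    by (rule ext[of "\<lambda>f. f \<otimes>\<^bsub>?P\<^esub> \<one>\<^bsub>?P\<^esub>" "\<lambda>f. f", OF l(1)[OF o(1)] linear_id _ that]) (auto simp: o(2) bm)
  have "monoid ?P"
    by (rule monoidI) (use c 3 lid rid o(1) in auto)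
  then have "ring ?P"
    by (rule ringI[OF P.M.abelian_group_axioms]) (auto simp: linear_add[OF l(1)] linear_add[OF l(2)])
  then show ?thesis
    by (intro assoc_algebra.intro assoc_algebra_axioms.intro m)
      (auto simp: linear_smult[OF l(1)] linear_smult[OF l(2)])
qed

lemma linear_extension_algebra_hom:
  assumes "assoc_algebra K A" "monoid G" "h \<in> carrier G \<rightarrow> carrier A" "h \<one>\<^bsub>G\<^esub> = \<one>\<^bsub>A\<^esub>"
    and "\<And>x y. \<lbrakk>x \<in> carrier G; y \<in> carrier G\<rbrakk> \<Longrightarrow> h (x \<otimes>\<^bsub>G\<^esub> y) = h x \<otimes>\<^bsub>A\<^esub> h y"
  shows "linear_extension K A h \<in> algebra_hom K (monoid_algebra K G) A"
proof -
  interpret A: assoc_algebra K A by fact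
  interpret G: monoid G by fact
  note K = A.R.is_cring
  note b = linear_extension_basis[OF A.module_axioms assms(3)]
  note l = linear_extension_linear[OF A.module_axioms assms(3)]
  show ?thesis
  proof (rule algebra_homI[OF l])
    show "linear_extension K A h \<one>\<^bsub>monoid_algebra K G\<^esub> = \<one>\<^bsub>A\<^esub>"
      by (simp add: monoid_algebra_simps(2) b assms(4))
    fix f g assume f: "f \<in> carrier (monoid_algebra K G)" and g: "g \<in> carrier (monoid_algebra K G)"
    show "linear_extension K A h (f \<otimes>\<^bsub>monoid_algebra K G\<^esub> g) =
      linear_extension K A h f \<otimes>\<^bsub>A\<^esub> linear_extension K A h g"
      by (rule mult_ext[OF assoc_algebra_monoid_algebra[OF K assms(2)] assms(1) l span_basis[OF K] _ f g])
        (auto simp: basis_elt_mult[OF K assms(2)] b assms(5))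
  qed
qed

text \<open>Multiplication is linear in both factors, so absorption has to be tested only for basis
  elements against generators. The products may land anywhere in the span, which is what tensor
  relations require.\<close>

lemma submodule_span_ideal:
  assumes K: "cring K" "monoid G" and R: "R \<subseteq> carrier (monoid_algebra K G)"
    and l: "\<And>x r. \<lbrakk>x \<in> carrier G; r \<in> R\<rbrakk> \<Longrightarrow>
      basis_elt K x \<otimes>\<^bsub>monoid_algebra K G\<^esub> r \<in> submodule_span K (monoid_algebra K G) R"
    and r: "\<And>x r. \<lbrakk>x \<in> carrier G; r \<in> R\<rbrakk> \<Longrightarrow>
      r \<otimes>\<^bsub>monoid_algebra K G\<^esub> basis_elt K x \<in> submodule_span K (monoid_algebra K G) R"
  shows "ideal (submodule_span K (monoid_algebra K G) R) (monoid_algebra K G)"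
proof -
  let ?P = "monoid_algebra K G" and ?N = "submodule_span K (monoid_algebra K G) R"
  interpret P: assoc_algebra K ?P using assoc_algebra_monoid_algebra[OF K] .
  note m = P.module_axioms
  note sm = submodule_span[OF m R]
  note ml = monoid_algebra_mult_linear[OF K]
  have Nc: "?N \<subseteq> carrier ?P" using P.submoduleE(1)[OF sm] .
  have B: "basis_elt K ` carrier G \<subseteq> carrier ?P" by (auto simp: basis_elt_carrier[OF K(1)])
  have 1: "basis_elt K x \<otimes>\<^bsub>?P\<^esub> s \<in> ?N" "s \<otimes>\<^bsub>?P\<^esub> basis_elt K x \<in> ?N" if "x \<in> carrier G" "s \<in> ?N" for x s
    using span_map[OF m m ml(2) sm R l[OF that(1)] that(2)] span_map[OF m m ml(1) sm R r[OF that(1)] that(2)]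
      basis_elt_carrier[OF K(1) that(1)] by auto
  show ?thesis
  proof (rule idealI)
    show "ring ?P" by (rule P.A.ring_axioms)
    show "subgroup ?N (add_monoid ?P)" using sm by (simp add: submodule_def)
    fix s p assume s: "s \<in> ?N" and p: "p \<in> carrier ?P"
    then have sc: "s \<in> carrier ?P" and ps: "p \<in> submodule_span K ?P (basis_elt K ` carrier G)"
      using Nc span_basis[OF K(1)] by auto
    show "p \<otimes>\<^bsub>?P\<^esub> s \<in> ?N"
      by (rule span_map[OF m m ml(1)[OF sc] sm B _ ps]) (use 1 s in auto)
    show "s \<otimes>\<^bsub>?P\<^esub> p \<in> ?N"
      by (rule span_map[OF m m ml(2)[OF sc] sm B _ ps]) (use 1 s in auto)
  qed
qed

section \<open>Tensor products\<close>

definition bilinear_maps ::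
    "('k, 'r) ring_scheme \<Rightarrow> ('k, 'a, 'm) module_scheme \<Rightarrow> ('k, 'b, 'n) module_scheme
      \<Rightarrow> ('k, 'w, 'o) module_scheme \<Rightarrow> ('a \<Rightarrow> 'b \<Rightarrow> 'w) set"
  where "bilinear_maps K M N W =
    {f. (\<forall>a \<in> carrier M. (\<lambda>b. f a b) \<in> linear_maps K N W) \<and>
        (\<forall>b \<in> carrier N. (\<lambda>a. f a b) \<in> linear_maps K M W)}"

lemma bilinearI:
  assumes "\<And>a. a \<in> carrier M \<Longrightarrow> (\<lambda>b. f a b) \<in> linear_maps K N W"
    and "\<And>b. b \<in> carrier N \<Longrightarrow> (\<lambda>a. f a b) \<in> linear_maps K M W"
  shows "f \<in> bilinear_maps K M N W"
  using assms by (auto simp: bilinear_maps_def)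

lemma bilinear_right: "\<lbrakk>f \<in> bilinear_maps K M N W; a \<in> carrier M\<rbrakk> \<Longrightarrow> f a \<in> linear_maps K N W"
  by (auto simp: bilinear_maps_def)

lemma bilinear_left: "\<lbrakk>f \<in> bilinear_maps K M N W; b \<in> carrier N\<rbrakk> \<Longrightarrow> (\<lambda>a. f a b) \<in> linear_maps K M W"
  by (auto simp: bilinear_maps_def)

lemma bilinear_closed:
  "\<lbrakk>f \<in> bilinear_maps K M N W; a \<in> carrier M; b \<in> carrier N\<rbrakk> \<Longrightarrow> f a b \<in> carrier W"
  using bilinear_right linear_closed by metis

lemma bilinear_cong:
  assumes "f \<in> bilinear_maps K M N W" "module K M" "module K N"
    and "\<And>a b. \<lbrakk>a \<in> carrier M; b \<in> carrier N\<rbrakk> \<Longrightarrow> f a b = g a b"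
  shows "g \<in> bilinear_maps K M N W"
proof (rule bilinearI)
  show "(\<lambda>b. g a b) \<in> linear_maps K N W" if "a \<in> carrier M" for a
    by (rule linear_cong[OF bilinear_right[OF assms(1) that] assms(3)]) (use assms(4) that in auto)
  show "(\<lambda>a. g a b) \<in> linear_maps K M W" if "b \<in> carrier N" for b
    by (rule linear_cong[OF bilinear_left[OF assms(1) that] assms(2)]) (use assms(4) that in auto)
qed

lemma bilinear_comp:
  assumes "g \<in> bilinear_maps K A B W" "f1 \<in> linear_maps K M A" "f2 \<in> linear_maps K N B"
  shows "(\<lambda>a b. g (f1 a) (f2 b)) \<in> bilinear_maps K M N W"
  by (rule bilinearI)
    (rule linear_comp[OF bilinear_right[OF assms(1) linear_closed[OF assms(2)]] assms(3)]
      linear_comp[OF bilinear_left[OF assms(1) linear_closed[OF assms(3)]] assms(2)]; assumption)+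

text \<open>The four families of generators behind \<open>tensor_relations\<close>, recast as an
  inductive set to obtain introduction rules and a case distinction.\<close>

inductive_set tensor_generators ::
    "('k, 'r) ring_scheme \<Rightarrow> ('k, 'a, 'm) module_scheme \<Rightarrow> ('k, 'b, 'n) module_scheme
      \<Rightarrow> ('a \<times> 'b \<Rightarrow> 'k) set"
  for K M N
  where
    add_left: "\<lbrakk>a \<in> carrier M; a' \<in> carrier M; b \<in> carrier N\<rbrakk> \<Longrightarrow>
      basis_elt K (a \<oplus>\<^bsub>M\<^esub> a', b) \<ominus>\<^bsub>monoid_algebra K (M \<times>\<times> N)\<^esub>
        (basis_elt K (a, b) \<oplus>\<^bsub>monoid_algebra K (M \<times>\<times> N)\<^esub> basis_elt K (a', b)) \<in> tensor_generators K M N"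
  | add_right: "\<lbrakk>a \<in> carrier M; b \<in> carrier N; b' \<in> carrier N\<rbrakk> \<Longrightarrow>
      basis_elt K (a, b \<oplus>\<^bsub>N\<^esub> b') \<ominus>\<^bsub>monoid_algebra K (M \<times>\<times> N)\<^esub>
        (basis_elt K (a, b) \<oplus>\<^bsub>monoid_algebra K (M \<times>\<times> N)\<^esub> basis_elt K (a, b')) \<in> tensor_generators K M N"
  | smult_left: "\<lbrakk>c \<in> carrier K; a \<in> carrier M; b \<in> carrier N\<rbrakk> \<Longrightarrow>
      basis_elt K (c \<odot>\<^bsub>M\<^esub> a, b) \<ominus>\<^bsub>monoid_algebra K (M \<times>\<times> N)\<^esub> c \<odot>\<^bsub>monoid_algebra K (M \<times>\<times> N)\<^esub> basis_elt K (a, b)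
        \<in> tensor_generators K M N"
  | smult_right: "\<lbrakk>c \<in> carrier K; a \<in> carrier M; b \<in> carrier N\<rbrakk> \<Longrightarrow>
      basis_elt K (a, c \<odot>\<^bsub>N\<^esub> b) \<ominus>\<^bsub>monoid_algebra K (M \<times>\<times> N)\<^esub> c \<odot>\<^bsub>monoid_algebra K (M \<times>\<times> N)\<^esub> basis_elt K (a, b)
        \<in> tensor_generators K M N"

lemma tensor_relations_span:
  "tensor_relations K M N = submodule_span K (monoid_algebra K (M \<times>\<times> N)) (tensor_generators K M N)"
  unfolding tensor_relations_def Let_def
  by (rule arg_cong[where f = "submodule_span K (monoid_algebra K (M \<times>\<times> N))"])
    (rule subset_antisym, (intro subsetI, elim UnE CollectE exE conjE, simp_all only: tensor_generators.intros)[1],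
      rule subsetI, erule tensor_generators.cases, blast+)

lemma carrier_DirProd: "carrier (M \<times>\<times> N) = carrier M \<times> carrier N"
  by (simp add: DirProd_def)

lemma basis_pair_carrier:
  "\<lbrakk>cring K; a \<in> carrier M; b \<in> carrier N\<rbrakk> \<Longrightarrow> basis_elt K (a, b) \<in> carrier (monoid_algebra K (M \<times>\<times> N))"
  by (simp add: basis_elt_carrier carrier_DirProd)

locale tensor_product =
  M: module K M + N: module K N
  for K :: "('k, 'r) ring_scheme" and M :: "('k, 'a, 'm) module_scheme"
    and N :: "('k, 'b, 'n) module_scheme"
begin

abbreviation "P \<equiv> monoid_algebra K (M \<times>\<times> N)"

sublocale P: module K P
  by (rule module_monoid_algebra) (rule M.R.is_cring)

lemmas basis_closed = basis_pair_carrier[OF M.R.is_cring]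

lemma generators_closed: "tensor_generators K M N \<subseteq> carrier P"
  by (auto elim!: tensor_generators.cases intro!: P.minus_closed P.a_closed P.smult_closed basis_closed)

lemma relations_submodule: "submodule (tensor_relations K M N) K P"
  unfolding tensor_relations_span by (rule submodule_span[OF P.module_axioms generators_closed])

lemma module_tensor: "module K (tensor K M N)"
  unfolding tensor_def by (rule module_quotient[OF P.module_axioms relations_submodule])

lemma generator_in_relations: "r \<in> tensor_generators K M N \<Longrightarrow> r \<in> tensor_relations K M N"
  unfolding tensor_relations_span using span_superset by (rule subsetD)

lemmas proj_linear = quotient_linear[OF P.module_axioms relations_submodule, folded tensor_def]
lemma pure_closed: "\<lbrakk>a \<in> carrier M; b \<in> carrier N\<rbrakk> \<Longrightarrow> pure_tensor K M N a b \<in> carrier (tensor K M N)"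
  unfolding pure_tensor_def by (rule linear_closed[OF proj_linear basis_closed])

lemmas pure_addI = quotient_eq_addI[OF P.module_axioms relations_submodule basis_closed basis_closed basis_closed
    generator_in_relations, folded tensor_def pure_tensor_def]
lemmas pure_smultI = quotient_eq_smultI[OF P.module_axioms relations_submodule _ basis_closed basis_closed
    generator_in_relations, folded tensor_def pure_tensor_def]

lemma pure_bilinear: "pure_tensor K M N \<in> bilinear_maps K M N (tensor K M N)"
  by (intro bilinearI linear_mapsI pure_closed pure_addI pure_smultI tensor_generators.intros
      M.a_closed N.a_closed M.smult_closed N.smult_closed; assumption)

lemma span_pure:
  "submodule_span K (tensor K M N) (case_prod (pure_tensor K M N) ` (carrier M \<times> carrier N)) =
    carrier (tensor K M N)"
proof -
  have "(\<lambda>x. tensor_relations K M N +>\<^bsub>P\<^esub> x) ` carrier P = carrier (tensor K M N)"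
    by (simp add: tensor_def carrier_quotient)
  from span_image[OF P.module_axioms module_tensor proj_linear this span_basis[OF M.R.is_cring]]
  show ?thesis
    by (simp add: carrier_DirProd image_image pure_tensor_def case_prod_beta)
qed

text \<open>Each generator encodes one instance of bilinearity, so the linear extension of a
  bilinear map is zero on it, and therefore on the span.\<close>

lemma extension_vanishes:
  assumes W: "module K W" and f: "f \<in> bilinear_maps K M N W" and x: "x \<in> tensor_relations K M N"
  shows "linear_extension K W (\<lambda>(a, b). f a b) x = \<zero>\<^bsub>W\<^esub>"
proof -
  interpret W: module K W by fact
  have h: "(\<lambda>(a, b). f a b) \<in> carrier (M \<times>\<times> N) \<rightarrow> carrier W"
    using f by (auto simp: carrier_DirProd bilinear_closed)
  note l = linear_extension_linear[OF W h]
  have b: "linear_extension K W (\<lambda>(a, b). f a b) (basis_elt K (a, b)) = f a b"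
    if "a \<in> carrier M" "b \<in> carrier N" for a b
    using linear_extension_basis[OF W h, of "(a, b)"] that by (simp add: carrier_DirProd)
  note r = linear_add[OF bilinear_right[OF f]] linear_smult[OF bilinear_right[OF f]]
    linear_add[OF bilinear_left[OF f]] linear_smult[OF bilinear_left[OF f]]
  have "linear_extension K W (\<lambda>(a, b). f a b) r = \<zero>\<^bsub>W\<^esub>" if "r \<in> tensor_generators K M N" for r
    using that
    by (auto elim!: tensor_generators.cases simp: linear_minus[OF P.module_axioms W l] linear_add[OF l] linear_smult[OF l] b r
        basis_closed bilinear_closed[OF f] W.minus_eq W.r_neg)
  then show ?thesis
    using span_map_zero[OF P.module_axioms W l generators_closed] x
    by (simp add: tensor_relations_span)
qed

lemma tensor_lift_linear:
  assumes W: "module K W" and f: "f \<in> bilinear_maps K M N W"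
  shows "tensor_lift K W f \<in> linear_maps K (tensor K M N) W"
proof -
  have h: "(\<lambda>(a, b). f a b) \<in> carrier (M \<times>\<times> N) \<rightarrow> carrier W"
    using f by (auto simp: carrier_DirProd bilinear_closed)
  show ?thesis
    unfolding tensor_lift_def tensor_def
    by (rule quotient_lift_linear[OF P.module_axioms relations_submodule W
          linear_extension_linear[OF W h] extension_vanishes[OF W f]])
qed

lemma tensor_lift_pure:
  assumes W: "module K W" and f: "f \<in> bilinear_maps K M N W"
    and "a \<in> carrier M" "b \<in> carrier N"
  shows "tensor_lift K W f (pure_tensor K M N a b) = f a b"
proof -
  have h: "(\<lambda>(a, b). f a b) \<in> carrier (M \<times>\<times> N) \<rightarrow> carrier W"
    using f by (auto simp: carrier_DirProd bilinear_closed)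
  have "tensor_lift K W f (pure_tensor K M N a b) =
      linear_extension K W (\<lambda>(a, b). f a b) (basis_elt K (a, b))"
    unfolding tensor_lift_def pure_tensor_def
    by (rule quotient_lift[OF P.module_axioms relations_submodule W
          linear_extension_linear[OF W h] extension_vanishes[OF W f] basis_closed[OF assms(3,4)]])
  then show ?thesis
    using linear_extension_basis[OF W h, of "(a, b)"] assms(3,4) by (simp add: carrier_DirProd)
qed

lemma tensor_ext:
  assumes "module K W" "f \<in> linear_maps K (tensor K M N) W" "g \<in> linear_maps K (tensor K M N) W"
    and "\<And>a b. \<lbrakk>a \<in> carrier M; b \<in> carrier N\<rbrakk> \<Longrightarrow> f (pure_tensor K M N a b) = g (pure_tensor K M N a b)"
    and "t \<in> carrier (tensor K M N)"
  shows "f t = g t"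
  by (rule linear_ext[OF module_tensor assms(1-3) span_pure _ assms(5)]) (use assms(4) in auto)

lemma tensor_lift_cong:
  assumes "module K W" "f \<in> bilinear_maps K M N W" "t \<in> carrier (tensor K M N)"
    and "\<And>a b. \<lbrakk>a \<in> carrier M; b \<in> carrier N\<rbrakk> \<Longrightarrow> f a b = g a b"
  shows "tensor_lift K W f t = tensor_lift K W g t"
proof -
  have g: "g \<in> bilinear_maps K M N W"
    by (rule bilinear_cong[OF assms(2) M.module_axioms N.module_axioms assms(4)])
  show ?thesis
    by (rule tensor_ext[OF assms(1) tensor_lift_linear[OF assms(1,2)] tensor_lift_linear[OF assms(1) g] _ assms(3)])
      (simp add: tensor_lift_pure assms(1,2,4) g)
qed

text \<open>In Sweedler notation: a linear map may be moved inside a sum over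
  \<open>t\<close>.\<close>

lemma tensor_lift_comp:
  assumes "module K W" "module K W'" "f \<in> bilinear_maps K M N W" "h \<in> linear_maps K W W'"
    and "t \<in> carrier (tensor K M N)"
  shows "h (tensor_lift K W f t) = tensor_lift K W' (\<lambda>a b. h (f a b)) t"
proof -
  have g: "(\<lambda>a b. h (f a b)) \<in> bilinear_maps K M N W'"
    by (intro bilinearI linear_comp[OF assms(4)] bilinear_left[OF assms(3)] bilinear_right[OF assms(3)])
  show ?thesis
    by (rule tensor_ext[OF assms(2) linear_comp[OF assms(4) tensor_lift_linear[OF assms(1,3)]]
          tensor_lift_linear[OF assms(2) g] _ assms(5)])
      (simp add: tensor_lift_pure assms g)
qed

lemma tensor_lift_closed:
  assumes "module K W" "f \<in> bilinear_maps K M N W" "t \<in> carrier (tensor K M N)"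
  shows "tensor_lift K W f t \<in> carrier W"
  by (rule linear_closed[OF tensor_lift_linear[OF assms(1,2)] assms(3)])

text \<open>Makes nested Sweedler sums bilinear: the inner sum, taken over a fixed tensor, depends
  linearly on every parameter of its summand.\<close>

lemma tensor_lift_param_linear:
  assumes D: "module K D" and W: "module K W"
    and f: "\<And>x. x \<in> carrier D \<Longrightarrow> f x \<in> bilinear_maps K M N W"
    and l: "\<And>a b. \<lbrakk>a \<in> carrier M; b \<in> carrier N\<rbrakk> \<Longrightarrow> (\<lambda>x. f x a b) \<in> linear_maps K D W"
    and t: "t \<in> carrier (tensor K M N)"
  shows "(\<lambda>x. tensor_lift K W (f x) t) \<in> linear_maps K D W"
proof (rule linear_mapsI)
  interpret D: module K D by fact
  interpret W: module K W by fact
  note L = tensor_lift_linear[OF W f]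
  fix x assume x: "x \<in> carrier D"
  show "tensor_lift K W (f x) t \<in> carrier W"
    by (rule tensor_lift_closed[OF W f[OF x] t])
  show "tensor_lift K W (f (x \<oplus>\<^bsub>D\<^esub> y)) t = tensor_lift K W (f x) t \<oplus>\<^bsub>W\<^esub> tensor_lift K W (f y) t"
    if y: "y \<in> carrier D" for y
    by (rule tensor_ext[OF W _ _ _ t, where g = "\<lambda>t. tensor_lift K W (f x) t \<oplus>\<^bsub>W\<^esub> tensor_lift K W (f y) t"])
      (use x y in \<open>simp_all add: linear_addf[OF W] L tensor_lift_pure[OF W f] linear_add[OF l]\<close>)
  show "tensor_lift K W (f (c \<odot>\<^bsub>D\<^esub> x)) t = c \<odot>\<^bsub>W\<^esub> tensor_lift K W (f x) t" if c: "c \<in> carrier K" for c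
    by (rule tensor_ext[OF W _ _ _ t, where g = "\<lambda>t. c \<odot>\<^bsub>W\<^esub> tensor_lift K W (f x) t"])
      (use x c in \<open>simp_all add: linear_smult_const[OF W] L tensor_lift_pure[OF W f] linear_smult[OF l]\<close>)
qed

end

lemma tensor_productI: "module K M \<Longrightarrow> module K N \<Longrightarrow> tensor_product K M N"
  by (rule tensor_product.intro)

text \<open>\<open>tensor\<close> reads only carrier, addition, scalars, product and unit. Hence
  records that differ in comultiplication or antipode have literally the same tensor product, as
  with \<open>Cop i\<close> and \<open>C\<close>, \<open>TV\<close> and
  \<open>direct_sum Cop\<close>, or \<open>F\<close> and \<open>Q\<close>.\<close>

lemma tensor_cong:
  assumes "carrier M = carrier M'" "add M = add M'" "smult M = smult M'" "mult M = mult M'" "one M = one M'"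
    and "carrier N = carrier N'" "add N = add N'" "smult N = smult N'" "mult N = mult N'" "one N = one N'"
  shows "tensor K M N = tensor K M' N'" "pure_tensor K M N = pure_tensor K M' N'"
proof -
  have d: "M \<times>\<times> N = M' \<times>\<times> N'" using assms by (simp add: DirProd_def)
  have r: "tensor_relations K M N = tensor_relations K M' N'"
    unfolding tensor_relations_def d using assms by simp
  show "tensor K M N = tensor K M' N'" by (simp add: tensor_def d r)
  show "pure_tensor K M N = pure_tensor K M' N'" by (simp add: fun_eq_iff pure_tensor_def d r)
qed

lemma tensor_map_cong:
  assumes "carrier M = carrier M'" "add M = add M'" "smult M = smult M'" "mult M = mult M'" "one M = one M'"
    and "carrier N = carrier N'" "add N = add N'" "smult N = smult N'" "mult N = mult N'" "one N = one N'"
  shows "tensor_map K M N = tensor_map K M' N'"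
  by (simp add: fun_eq_iff tensor_map_def tensor_cong[OF assms])

section \<open>Tensor products of algebras\<close>

locale algebra_tensor_product =
  M: assoc_algebra K M + N: assoc_algebra K N
  for K :: "('k, 'r) ring_scheme" and M :: "('k, 'a, 'm) module_scheme"
    and N :: "('k, 'b, 'n) module_scheme"
begin

sublocale tensor_product K M N ..

lemma monoid_prod: "monoid (M \<times>\<times> N)"
  by (rule DirProd_monoid) (rule M.A.monoid_axioms N.A.monoid_axioms)+

sublocale PA: assoc_algebra K P
  by (rule assoc_algebra_monoid_algebra[OF M.R.is_cring monoid_prod])

lemma basis_pair_mult:
  "\<lbrakk>a \<in> carrier M; b \<in> carrier N; c \<in> carrier M; d \<in> carrier N\<rbrakk> \<Longrightarrow>
    basis_elt K (a, b) \<otimes>\<^bsub>P\<^esub> basis_elt K (c, d) = basis_elt K (a \<otimes>\<^bsub>M\<^esub> c, b \<otimes>\<^bsub>N\<^esub> d)"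
  by (subst basis_elt_mult[OF M.R.is_cring monoid_prod]) (auto simp: carrier_DirProd)

text \<open>Here \<open>h\<close> is the multiplication by a basis element. It preserves the relations because it induces the
  bilinear map \<open>(a, b) \<mapsto> f a \<otimes> g b\<close>, whose linear extension kills them.\<close>

lemma multiplication_in_relations:
  assumes h: "h \<in> linear_maps K P P" and fg: "f \<in> linear_maps K M M" "g \<in> linear_maps K N N"
    and hb: "\<And>a b. \<lbrakk>a \<in> carrier M; b \<in> carrier N\<rbrakk> \<Longrightarrow> h (basis_elt K (a, b)) = basis_elt K (f a, g b)"
    and r: "r \<in> tensor_relations K M N"
  shows "h r \<in> tensor_relations K M N"
proof -
  have rc: "r \<in> carrier P" using r P.submoduleE(1)[OF relations_submodule] by auto
  note b = bilinear_comp[OF pure_bilinear fg]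
  have e: "(\<lambda>(a, b). pure_tensor K M N (f a) (g b)) \<in> carrier (M \<times>\<times> N) \<rightarrow> carrier (tensor K M N)"
    by (auto simp: carrier_DirProd bilinear_closed[OF b])
  have "tensor_relations K M N +>\<^bsub>P\<^esub> h r = linear_extension K (tensor K M N) (\<lambda>(a, b). pure_tensor K M N (f a) (g b)) r"
  proof (rule linear_ext[OF P.module_axioms module_tensor linear_comp[OF proj_linear h]
        linear_extension_linear[OF module_tensor e] span_basis[OF M.R.is_cring] _ rc])
    fix z assume "z \<in> basis_elt K ` carrier (M \<times>\<times> N)"
    then show "tensor_relations K M N +>\<^bsub>P\<^esub> h z =
        linear_extension K (tensor K M N) (\<lambda>(a, b). pure_tensor K M N (f a) (g b)) z"
      using linear_extension_basis[OF module_tensor e] by (auto simp: carrier_DirProd hb pure_tensor_def)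
  qed
  then show ?thesis
    using quotient_zeroD[OF P.module_axioms relations_submodule linear_closed[OF h rc]]
      extension_vanishes[OF module_tensor b r] by (simp add: tensor_def)
qed

lemma relations_ideal: "ideal (tensor_relations K M N) P"
  unfolding tensor_relations_span
proof (rule submodule_span_ideal[OF M.R.is_cring monoid_prod generators_closed])
  fix z r assume "z \<in> carrier (M \<times>\<times> N)" and "r \<in> tensor_generators K M N"
  then obtain x y where z: "z = (x, y)" "x \<in> carrier M" "y \<in> carrier N" and r: "r \<in> tensor_relations K M N"
    by (auto simp: carrier_DirProd generator_in_relations)
  note ml = monoid_algebra_mult_linear[OF M.R.is_cring monoid_prod basis_closed[OF z(2,3)]]
  note lin = linear_mult_left[OF M.assoc_algebra_axioms z(2) linear_id] linear_mult_left[OF N.assoc_algebra_axioms z(3) linear_id]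
    linear_mult_right[OF M.assoc_algebra_axioms z(2) linear_id] linear_mult_right[OF N.assoc_algebra_axioms z(3) linear_id]
  show "basis_elt K z \<otimes>\<^bsub>P\<^esub> r \<in> submodule_span K P (tensor_generators K M N)"
    unfolding tensor_relations_span[symmetric] z(1)
    by (rule multiplication_in_relations[OF ml(2) lin(1,2) _ r]) (simp add: basis_pair_mult z)
  show "r \<otimes>\<^bsub>P\<^esub> basis_elt K z \<in> submodule_span K P (tensor_generators K M N)"
    unfolding tensor_relations_span[symmetric] z(1)
    by (rule multiplication_in_relations[OF ml(1) lin(3,4) _ r]) (simp add: basis_pair_mult z)
qed

lemma assoc_algebra_tensor: "assoc_algebra K (tensor K M N)"
  unfolding tensor_def
  by (rule assoc_algebra_quotient[OF PA.assoc_algebra_axioms relations_submodule relations_ideal])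

lemma pure_mult:
  assumes "a \<in> carrier M" "b \<in> carrier N" "c \<in> carrier M" "d \<in> carrier N"
  shows "pure_tensor K M N a b \<otimes>\<^bsub>tensor K M N\<^esub> pure_tensor K M N c d =
    pure_tensor K M N (a \<otimes>\<^bsub>M\<^esub> c) (b \<otimes>\<^bsub>N\<^esub> d)"
  unfolding pure_tensor_def tensor_def
  using quotient_mult[OF relations_ideal basis_closed[OF assms(1,2)] basis_closed[OF assms(3,4)]]
  by (simp add: basis_pair_mult assms)

lemma tensor_one: "\<one>\<^bsub>tensor K M N\<^esub> = pure_tensor K M N \<one>\<^bsub>M\<^esub> \<one>\<^bsub>N\<^esub>"
  by (simp add: pure_tensor_def tensor_def quotient_one monoid_algebra_simps(2) DirProd_def)

lemma tensor_lift_algebra_hom: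
  assumes W: "assoc_algebra K W" and f: "f \<in> bilinear_maps K M N W"
    and o: "f \<one>\<^bsub>M\<^esub> \<one>\<^bsub>N\<^esub> = \<one>\<^bsub>W\<^esub>"
    and m: "\<And>a b c d. \<lbrakk>a \<in> carrier M; b \<in> carrier N; c \<in> carrier M; d \<in> carrier N\<rbrakk> \<Longrightarrow>
      f (a \<otimes>\<^bsub>M\<^esub> c) (b \<otimes>\<^bsub>N\<^esub> d) = f a b \<otimes>\<^bsub>W\<^esub> f c d"
  shows "tensor_lift K W f \<in> algebra_hom K (tensor K M N) W"
proof -
  note Wm = assoc_algebra_module[OF W]
  note p = tensor_lift_pure[OF Wm f]
  show ?thesis
  proof (rule algebra_homI[OF tensor_lift_linear[OF Wm f]])
    show "tensor_lift K W f \<one>\<^bsub>tensor K M N\<^esub> = \<one>\<^bsub>W\<^esub>"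
      by (simp add: tensor_one p o)
  next
    fix x y assume x: "x \<in> carrier (tensor K M N)" and y: "y \<in> carrier (tensor K M N)"
    show "tensor_lift K W f (x \<otimes>\<^bsub>tensor K M N\<^esub> y) = tensor_lift K W f x \<otimes>\<^bsub>W\<^esub> tensor_lift K W f y"
      by (rule mult_ext[OF assoc_algebra_tensor W tensor_lift_linear[OF Wm f] span_pure _ x y])
        (auto simp: pure_mult p m)
  qed
qed

end

section \<open>The tensor algebra\<close>

text \<open>As for tensor products, the inductive form supplies the case distinction over the two
  kinds of generators of \<open>multilinear_relations\<close>.\<close>

inductive_set multilinear_generators ::
    "('k, 'r) ring_scheme \<Rightarrow> ('k, 'a, 'm) module_scheme \<Rightarrow> ('a list \<Rightarrow> 'k) set"
  for K V
  where
    add: "\<lbrakk>u \<in> lists (carrier V); w \<in> lists (carrier V); x \<in> carrier V; y \<in> carrier V\<rbrakk> \<Longrightarrow>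
      basis_elt K (u @ [x \<oplus>\<^bsub>V\<^esub> y] @ w) \<ominus>\<^bsub>monoid_algebra K (word_monoid (carrier V))\<^esub>
        (basis_elt K (u @ [x] @ w) \<oplus>\<^bsub>monoid_algebra K (word_monoid (carrier V))\<^esub> basis_elt K (u @ [y] @ w)) \<in> multilinear_generators K V"
  | smult: "\<lbrakk>u \<in> lists (carrier V); w \<in> lists (carrier V); c \<in> carrier K; x \<in> carrier V\<rbrakk> \<Longrightarrow>
      basis_elt K (u @ [c \<odot>\<^bsub>V\<^esub> x] @ w) \<ominus>\<^bsub>monoid_algebra K (word_monoid (carrier V))\<^esub>
        c \<odot>\<^bsub>monoid_algebra K (word_monoid (carrier V))\<^esub> basis_elt K (u @ [x] @ w) \<in> multilinear_generators K V"

lemma multilinear_relations_span: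
  "multilinear_relations K V =
    submodule_span K (monoid_algebra K (word_monoid (carrier V))) (multilinear_generators K V)"
  unfolding multilinear_relations_def Let_def
  by (rule arg_cong[where f = "submodule_span K (monoid_algebra K (word_monoid (carrier V)))"])
    (rule subset_antisym, (intro subsetI, elim UnE CollectE exE conjE, simp_all only: multilinear_generators.intros)[1],
      rule subsetI, erule multilinear_generators.cases, blast+)

lemma word_monoid_simps [simp]:
  "carrier (word_monoid X) = lists X" "mult (word_monoid X) = append" "\<one>\<^bsub>word_monoid X\<^esub> = []"
  by (simp_all add: word_monoid_def)

lemma append_in_listsI: "u \<in> lists X \<Longrightarrow> w \<in> lists X \<Longrightarrow> u @ w \<in> lists X"
  by simp

lemma monoid_word_monoid: "monoid (word_monoid X)"
  by (rule monoidI) auto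

context module
begin

abbreviation "Words \<equiv> word_monoid (carrier M)"
abbreviation "WordAlg \<equiv> monoid_algebra R Words"

lemma module_words: "module R WordAlg"
  by (rule module_monoid_algebra) (rule R.is_cring)

lemma word_closed: "w \<in> lists (carrier M) \<Longrightarrow> basis_elt R w \<in> carrier WordAlg"
  by (rule basis_elt_carrier) (auto intro: R.is_cring)

lemma word_mult:
  "\<lbrakk>u \<in> lists (carrier M); w \<in> lists (carrier M)\<rbrakk> \<Longrightarrow>
    basis_elt R u \<otimes>\<^bsub>WordAlg\<^esub> basis_elt R w = basis_elt R (u @ w)"
  using basis_elt_mult[OF R.is_cring monoid_word_monoid, of u "carrier M" w] by simp

lemma word_generators_closed: "multilinear_generators R M \<subseteq> carrier WordAlg"
proof
  interpret WordAlg: module R WordAlg by (rule module_words)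
  fix r assume "r \<in> multilinear_generators R M"
  then show "r \<in> carrier WordAlg"
    by (rule multilinear_generators.cases)
      (simp_all only:, (intro WordAlg.minus_closed WordAlg.a_closed WordAlg.smult_closed word_closed; simp)+)
qed

lemma word_relations_submodule: "submodule (multilinear_relations R M) R WordAlg"
  unfolding multilinear_relations_span by (rule submodule_span[OF module_words word_generators_closed])

lemma word_generator_in_relations:
  "r \<in> multilinear_generators R M \<Longrightarrow> r \<in> multilinear_relations R M"
  unfolding multilinear_relations_span using span_superset by (rule subsetD)

lemma assoc_algebra_words: "assoc_algebra R WordAlg"
  by (rule assoc_algebra_monoid_algebra[OF R.is_cring monoid_word_monoid])

text \<open>Multiplication by a word turns a generator into a generator: on the left it lengthens
  the prefix \<open>u\<close>, on the right the suffix \<open>w\<close>.\<close>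

lemma word_relations_ideal: "ideal (multilinear_relations R M) WordAlg"
  unfolding multilinear_relations_span
proof (rule submodule_span_ideal[OF R.is_cring monoid_word_monoid word_generators_closed])
  fix z r assume "z \<in> carrier Words" and r: "r \<in> multilinear_generators R M"
  then have z: "z \<in> lists (carrier M)" by simp
  interpret WordAlg: module R WordAlg by (rule module_words)
  have zc: "basis_elt R z \<in> carrier WordAlg" using z word_closed by simp
  note ml = monoid_algebra_mult_linear[OF R.is_cring monoid_word_monoid zc]
  note m = WordAlg.module_axioms
  note s = linear_minus[OF m m ml(1)] linear_add[OF ml(1)] linear_smult[OF ml(1)]
    linear_minus[OF m m ml(2)] linear_add[OF ml(2)] linear_smult[OF ml(2)]
  have "basis_elt R z \<otimes>\<^bsub>WordAlg\<^esub> r \<in> multilinear_generators R M \<and>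
      r \<otimes>\<^bsub>WordAlg\<^esub> basis_elt R z \<in> multilinear_generators R M"
    using r
  proof (rule multilinear_generators.cases)
    fix u w x y
    assume *: "r = basis_elt R (u @ [x \<oplus>\<^bsub>M\<^esub> y] @ w) \<ominus>\<^bsub>WordAlg\<^esub>
        (basis_elt R (u @ [x] @ w) \<oplus>\<^bsub>WordAlg\<^esub> basis_elt R (u @ [y] @ w))"
      "u \<in> lists (carrier M)" "w \<in> lists (carrier M)" "x \<in> carrier M" "y \<in> carrier M"
    have "basis_elt R z \<otimes>\<^bsub>WordAlg\<^esub> r = basis_elt R ((z @ u) @ [x \<oplus>\<^bsub>M\<^esub> y] @ w) \<ominus>\<^bsub>WordAlg\<^esub>
        (basis_elt R ((z @ u) @ [x] @ w) \<oplus>\<^bsub>WordAlg\<^esub> basis_elt R ((z @ u) @ [y] @ w))"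
      "r \<otimes>\<^bsub>WordAlg\<^esub> basis_elt R z = basis_elt R (u @ [x \<oplus>\<^bsub>M\<^esub> y] @ (w @ z)) \<ominus>\<^bsub>WordAlg\<^esub>
        (basis_elt R (u @ [x] @ (w @ z)) \<oplus>\<^bsub>WordAlg\<^esub> basis_elt R (u @ [y] @ (w @ z)))"
      using * z by (simp_all add: s word_mult word_closed)
    with *(2-) z show ?thesis
      by (simp only:) (intro conjI multilinear_generators.intros append_in_listsI; assumption)
  next
    fix u w c x
    assume *: "r = basis_elt R (u @ [c \<odot>\<^bsub>M\<^esub> x] @ w) \<ominus>\<^bsub>WordAlg\<^esub> c \<odot>\<^bsub>WordAlg\<^esub> basis_elt R (u @ [x] @ w)"
      "u \<in> lists (carrier M)" "w \<in> lists (carrier M)" "c \<in> carrier R" "x \<in> carrier M"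
    have "basis_elt R z \<otimes>\<^bsub>WordAlg\<^esub> r =
        basis_elt R ((z @ u) @ [c \<odot>\<^bsub>M\<^esub> x] @ w) \<ominus>\<^bsub>WordAlg\<^esub> c \<odot>\<^bsub>WordAlg\<^esub> basis_elt R ((z @ u) @ [x] @ w)"
      "r \<otimes>\<^bsub>WordAlg\<^esub> basis_elt R z =
        basis_elt R (u @ [c \<odot>\<^bsub>M\<^esub> x] @ (w @ z)) \<ominus>\<^bsub>WordAlg\<^esub> c \<odot>\<^bsub>WordAlg\<^esub> basis_elt R (u @ [x] @ (w @ z))"
      using * z by (simp_all add: s word_mult word_closed)
    with *(2-) z show ?thesis
      by (simp only:) (intro conjI multilinear_generators.intros append_in_listsI; assumption)
  qed
  then show "basis_elt R z \<otimes>\<^bsub>WordAlg\<^esub> r \<in> submodule_span R WordAlg (multilinear_generators R M)"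
    "r \<otimes>\<^bsub>WordAlg\<^esub> basis_elt R z \<in> submodule_span R WordAlg (multilinear_generators R M)"
    using word_generator_in_relations by (simp_all add: multilinear_relations_span)
qed

lemma assoc_algebra_tensor_algebra: "assoc_algebra R (tensor_algebra R M)"
  unfolding tensor_algebra_def
  by (rule assoc_algebra_quotient[OF assoc_algebra_words word_relations_submodule word_relations_ideal])

lemmas word_proj_hom =
  quotient_algebra_hom[OF assoc_algebra_words word_relations_submodule word_relations_ideal,
    folded tensor_algebra_def]

lemma letter_closed: "x \<in> carrier M \<Longrightarrow> basis_elt R [x] \<in> carrier WordAlg"
  by (rule word_closed) simp

lemmas inc_addI = quotient_eq_addI[OF module_words word_relations_submodule letter_closed letter_closed letter_closed
    word_generator_in_relations, folded tensor_algebra_def tensor_algebra_inc_def]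
lemmas inc_smultI = quotient_eq_smultI[OF module_words word_relations_submodule _ letter_closed letter_closed
    word_generator_in_relations, folded tensor_algebra_def tensor_algebra_inc_def]

text \<open>These are the multilinearity relations with empty prefix and empty suffix.\<close>

lemma tensor_algebra_inc_linear: "tensor_algebra_inc R M \<in> linear_maps R M (tensor_algebra R M)"
proof (rule linear_mapsI)
  show "tensor_algebra_inc R M x \<in> carrier (tensor_algebra R M)" if "x \<in> carrier M" for x
    unfolding tensor_algebra_inc_def
    by (rule linear_closed[OF algebra_hom_linear[OF word_proj_hom] letter_closed[OF that]])
qed (rule inc_addI inc_smultI;
    use multilinear_generators.intros[where u = "[]" and w = "[]" and V = M and K = R] in simp)+

text \<open>Words span the tensor algebra, and each word arises from the unit by successive left
  multiplications with letters. Only linearity and these multiplications are asked of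
  \<open>N\<close>, which need not be a subalgebra.\<close>

lemma tensor_algebra_induct:
  assumes N: "submodule N R (tensor_algebra R M)" and o: "\<one>\<^bsub>tensor_algebra R M\<^esub> \<in> N"
    and m: "\<And>x t. \<lbrakk>x \<in> carrier M; t \<in> N\<rbrakk> \<Longrightarrow> tensor_algebra_inc R M x \<otimes>\<^bsub>tensor_algebra R M\<^esub> t \<in> N"
  shows "carrier (tensor_algebra R M) \<subseteq> N"
proof -
  let ?T = "tensor_algebra R M" and ?pi = "\<lambda>x. multilinear_relations R M +>\<^bsub>WordAlg\<^esub> x"
  note h = word_proj_hom
  have w: "?pi (basis_elt R w) \<in> N" if "w \<in> lists (carrier M)" for w
    using that
  proof (induction w)
    case Nil
    then show ?case using o algebra_hom_one[OF h] by (simp add: monoid_algebra_simps(2))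
  next
    case (Cons x w)
    have "?pi (basis_elt R (x # w)) = tensor_algebra_inc R M x \<otimes>\<^bsub>?T\<^esub> ?pi (basis_elt R w)"
      using algebra_hom_mult[OF h, of "basis_elt R [x]" "basis_elt R w"] Cons word_mult[of "[x]" w]
      by (simp add: word_closed tensor_algebra_inc_def)
    then show ?case using Cons m by auto
  qed
  have "?pi ` carrier WordAlg = carrier ?T" by (simp add: tensor_algebra_def carrier_quotient)
  from span_image[OF module_words assoc_algebra_module[OF assoc_algebra_tensor_algebra]
      algebra_hom_linear[OF h] this span_basis[OF R.is_cring]]
  have "submodule_span R ?T (?pi ` basis_elt R ` carrier Words) = carrier ?T" .
  moreover have "submodule_span R ?T (?pi ` basis_elt R ` carrier Words) \<subseteq> N"
    by (rule span_least[OF N]) (use w in auto)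
  ultimately show ?thesis by simp
qed

section \<open>The algebra map on the tensor algebra induced by a linear map\<close>

context
  fixes A :: "('a, 'w, 'o) module_scheme" and f
  assumes A: "assoc_algebra R A" and f: "f \<in> linear_maps R M A"
begin

interpretation A: assoc_algebra R A by (rule A)

abbreviation "word_prod \<equiv> (\<lambda>w. foldr (\<lambda>x y. f x \<otimes>\<^bsub>A\<^esub> y) w \<one>\<^bsub>A\<^esub>)"

lemma word_prod_closed: "w \<in> lists (carrier M) \<Longrightarrow> word_prod w \<in> carrier A"
  by (induction w) (auto simp: linear_closed[OF f])

lemma word_prod_append:
  "\<lbrakk>u \<in> lists (carrier M); w \<in> lists (carrier M)\<rbrakk> \<Longrightarrow> word_prod (u @ w) = word_prod u \<otimes>\<^bsub>A\<^esub> word_prod w"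
proof (induction u)
  case (Cons x u)
  then show ?case
    using word_prod_closed[of u] word_prod_closed[of w] linear_closed[OF f, of x]
    by (simp add: A.A.m_assoc del: foldr_append)
qed (simp add: word_prod_closed)

lemma word_prod_funcset: "word_prod \<in> carrier Words \<rightarrow> carrier A"
  using word_prod_closed by auto

lemma word_prod_hom: "linear_extension R A word_prod \<in> algebra_hom R WordAlg A"
  by (rule linear_extension_algebra_hom[OF A monoid_word_monoid word_prod_funcset])
    (auto simp: word_prod_append simp del: foldr_append)

lemma word_prod_vanishes:
  assumes "x \<in> multilinear_relations R M"
  shows "linear_extension R A word_prod x = \<zero>\<^bsub>A\<^esub>"
proof -
  note l = algebra_hom_linear[OF word_prod_hom]
  note b = linear_extension_basis[OF A.module_axioms word_prod_funcset, simplified]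
  \<comment> \<open>Isolates the varying letter between two fixed factors, so that linearity of
    \<open>f\<close> and distributivity dispose of both kinds of generators.\<close>
  have eq: "word_prod (u @ [z] @ w) = word_prod u \<otimes>\<^bsub>A\<^esub> (f z \<otimes>\<^bsub>A\<^esub> word_prod w)"
    if "u \<in> lists (carrier M)" "w \<in> lists (carrier M)" "z \<in> carrier M" for u z w
    using word_prod_append[of u "[z] @ w"] that by simp
  have "linear_extension R A word_prod r = \<zero>\<^bsub>A\<^esub>" if "r \<in> multilinear_generators R M" for r
    using that
  proof (rule multilinear_generators.cases)
    interpret WordAlg: module R WordAlg by (rule module_words)
    fix u w y z
    assume *: "r = basis_elt R (u @ [y \<oplus>\<^bsub>M\<^esub> z] @ w) \<ominus>\<^bsub>WordAlg\<^esub>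
        (basis_elt R (u @ [y] @ w) \<oplus>\<^bsub>WordAlg\<^esub> basis_elt R (u @ [z] @ w))"
      "u \<in> lists (carrier M)" "w \<in> lists (carrier M)" "y \<in> carrier M" "z \<in> carrier M"
    have c: "basis_elt R (u @ [v] @ w) \<in> carrier WordAlg" "u @ [v] @ w \<in> lists (carrier M)" if "v \<in> carrier M" for v
      using that *(2,3) by (auto intro!: word_closed)
    have yz: "y \<oplus>\<^bsub>M\<^esub> z \<in> carrier M" using *(4,5) by simp
    have "linear_extension R A word_prod r = word_prod (u @ [y \<oplus>\<^bsub>M\<^esub> z] @ w) \<ominus>\<^bsub>A\<^esub>
      (word_prod (u @ [y] @ w) \<oplus>\<^bsub>A\<^esub> word_prod (u @ [z] @ w))"
      unfolding *(1)
      by (simp only: linear_minus[OF module_words A.module_axioms l c(1)[OF yz] WordAlg.a_closed[OF c(1)[OF *(4)] c(1)[OF *(5)]]]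
          linear_add[OF l c(1)[OF *(4)] c(1)[OF *(5)]] b c(2)[OF yz] c(2)[OF *(4)] c(2)[OF *(5)])
    also have "\<dots> = \<zero>\<^bsub>A\<^esub>"
      unfolding eq[OF *(2,3) yz] eq[OF *(2,3,4)] eq[OF *(2,3,5)] linear_add[OF f *(4,5)]
      using word_prod_closed[OF *(2)] word_prod_closed[OF *(3)] linear_closed[OF f *(4)] linear_closed[OF f *(5)]
      by (simp add: A.A.l_distr A.A.r_distr A.M.minus_eq A.M.r_neg)
    finally show ?thesis .
  next
    interpret WordAlg: module R WordAlg by (rule module_words)
    fix u w k z
    assume *: "r = basis_elt R (u @ [k \<odot>\<^bsub>M\<^esub> z] @ w) \<ominus>\<^bsub>WordAlg\<^esub> k \<odot>\<^bsub>WordAlg\<^esub> basis_elt R (u @ [z] @ w)"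
      "u \<in> lists (carrier M)" "w \<in> lists (carrier M)" "k \<in> carrier R" "z \<in> carrier M"
    have c: "basis_elt R (u @ [v] @ w) \<in> carrier WordAlg" "u @ [v] @ w \<in> lists (carrier M)" if "v \<in> carrier M" for v
      using that *(2,3) by (auto intro!: word_closed)
    have kz: "k \<odot>\<^bsub>M\<^esub> z \<in> carrier M" using *(4,5) by simp
    have "linear_extension R A word_prod r = word_prod (u @ [k \<odot>\<^bsub>M\<^esub> z] @ w) \<ominus>\<^bsub>A\<^esub>
      k \<odot>\<^bsub>A\<^esub> word_prod (u @ [z] @ w)"
      unfolding *(1)
      by (simp only: linear_minus[OF module_words A.module_axioms l c(1)[OF kz] WordAlg.smult_closed[OF *(4) c(1)[OF *(5)]]]
          linear_smult[OF l *(4) c(1)[OF *(5)]] b c(2)[OF kz] c(2)[OF *(5)])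
    also have "\<dots> = \<zero>\<^bsub>A\<^esub>"
      unfolding eq[OF *(2,3) kz] eq[OF *(2,3,5)] linear_smult[OF f *(4,5)]
      using word_prod_closed[OF *(2)] word_prod_closed[OF *(3)] linear_closed[OF f *(5)] *(4)
      by (simp add: A.smult_mult_left A.smult_mult_right A.M.minus_eq A.M.r_neg)
    finally show ?thesis .
  qed
  then show ?thesis
    using span_map_zero[OF module_words A.module_axioms l word_generators_closed] assms
    by (simp add: multilinear_relations_span)
qed

lemma tensor_algebra_lift_hom: "tensor_algebra_lift R A f \<in> algebra_hom R (tensor_algebra R M) A"
  unfolding tensor_algebra_lift_def tensor_algebra_def
  by (rule quotient_lift_algebra_hom[OF assoc_algebra_words word_relations_submodule
        word_relations_ideal A word_prod_hom word_prod_vanishes])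

lemma tensor_algebra_lift_inc:
  assumes "x \<in> carrier M" shows "tensor_algebra_lift R A f (tensor_algebra_inc R M x) = f x"
proof -
  have c: "basis_elt R [x] \<in> carrier WordAlg" using assms by (intro word_closed) simp
  have "tensor_algebra_lift R A f (tensor_algebra_inc R M x) =
      linear_extension R A word_prod (basis_elt R [x])"
    unfolding tensor_algebra_lift_def tensor_algebra_inc_def
    by (rule quotient_lift[OF module_words word_relations_submodule A.module_axioms
          algebra_hom_linear[OF word_prod_hom] word_prod_vanishes c])
  also have "\<dots> = f x"
    using linear_extension_basis[OF A.module_axioms word_prod_funcset, of "[x]"] assms
    by (simp add: linear_closed[OF f])
  finally show ?thesis .
qed

end

end

section \<open>Maps between tensor products\<close>

lemma linear_pure_left:
  assumes "module K A" "module K B" "g \<in> linear_maps K M A" "b \<in> carrier B"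
  shows "(\<lambda>x. pure_tensor K A B (g x) b) \<in> linear_maps K M (tensor K A B)"
  by (rule linear_comp[OF bilinear_left[OF tensor_product.pure_bilinear[OF tensor_productI[OF assms(1,2)]] assms(4)] assms(3)])

lemma linear_pure_right:
  assumes "module K A" "module K B" "g \<in> linear_maps K M B" "a \<in> carrier A"
  shows "(\<lambda>x. pure_tensor K A B a (g x)) \<in> linear_maps K M (tensor K A B)"
  by (rule linear_comp[OF bilinear_right[OF tensor_product.pure_bilinear[OF tensor_productI[OF assms(1,2)]] assms(4)] assms(3)])

lemmas pure_closed = tensor_product.pure_closed[OF tensor_productI]

lemma bilinear_comp_linear:
  assumes "g \<in> bilinear_maps K M N W" "h \<in> linear_maps K W W'"
  shows "(\<lambda>a b. h (g a b)) \<in> bilinear_maps K M N W'"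
  by (rule bilinearI; rule linear_comp[OF assms(2)])
    (simp_all add: bilinear_left[OF assms(1)] bilinear_right[OF assms(1)])

lemma bilinear_flip: "f \<in> bilinear_maps K M N W \<Longrightarrow> (\<lambda>b a. f a b) \<in> bilinear_maps K N M W"
  by (rule bilinearI) (simp_all add: bilinear_left bilinear_right)

lemma bilinear_mult: "assoc_algebra K A \<Longrightarrow> mult A \<in> bilinear_maps K A A A"
  by (rule bilinearI) (rule linear_mult_left linear_mult_right; simp add: linear_id)+

lemma tensor_map_eq_lift:
  "tensor_map K M N f g = tensor_lift K (tensor K M N) (\<lambda>a b. pure_tensor K M N (f a) (g b))"
  by (simp add: tensor_map_def)

context
  fixes K :: "('k, 'r) ring_scheme" and M :: "('k, 'a, 'm) module_scheme"
    and N :: "('k, 'b, 'n) module_scheme" and A :: "('k, 'c, 'o) module_scheme"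
    and B :: "('k, 'd, 'p) module_scheme" and f g
  assumes M: "module K M" and N: "module K N" and A: "module K A" and B: "module K B"
    and f: "f \<in> linear_maps K M A" and g: "g \<in> linear_maps K N B"
begin

interpretation MN: tensor_product K M N by (rule tensor_productI[OF M N])
interpretation AB: tensor_product K A B by (rule tensor_productI[OF A B])

lemma tensor_map_bilinear:
  "(\<lambda>a b. pure_tensor K A B (f a) (g b)) \<in> bilinear_maps K M N (tensor K A B)"
  by (rule bilinear_comp[OF AB.pure_bilinear f g])

lemma tensor_map_linear: "tensor_map K A B f g \<in> linear_maps K (tensor K M N) (tensor K A B)"
  unfolding tensor_map_eq_lift by (rule MN.tensor_lift_linear[OF AB.module_tensor tensor_map_bilinear])

lemma tensor_map_pure:
  "\<lbrakk>a \<in> carrier M; b \<in> carrier N\<rbrakk> \<Longrightarrow>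
    tensor_map K A B f g (pure_tensor K M N a b) = pure_tensor K A B (f a) (g b)"
  unfolding tensor_map_eq_lift by (rule MN.tensor_lift_pure[OF AB.module_tensor tensor_map_bilinear])

text \<open>The change of variables for Sweedler sums. It applies whenever a comultiplication is
  known to be of the form (f \<otimes> g) \<Delta>.\<close>

lemma tensor_lift_tensor_map:
  assumes W: "module K W" and h: "h \<in> bilinear_maps K A B W" and t: "t \<in> carrier (tensor K M N)"
  shows "tensor_lift K W h (tensor_map K A B f g t) = tensor_lift K W (\<lambda>a b. h (f a) (g b)) t"
proof -
  note hb = bilinear_comp[OF h f g]
  show ?thesis
    by (rule MN.tensor_ext[OF W linear_comp[OF AB.tensor_lift_linear[OF W h] tensor_map_linear]
          MN.tensor_lift_linear[OF W hb] _ t])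
      (simp add: tensor_map_pure AB.tensor_lift_pure[OF W h] MN.tensor_lift_pure[OF W hb]
        linear_closed[OF f] linear_closed[OF g])
qed

end

lemma tensor_map_algebra_hom:
  assumes "assoc_algebra K M" "assoc_algebra K N" "assoc_algebra K A" "assoc_algebra K B"
    and f: "f \<in> algebra_hom K M A" and g: "g \<in> algebra_hom K N B"
  shows "tensor_map K A B f g \<in> algebra_hom K (tensor K M N) (tensor K A B)"
proof -
  interpret MN: algebra_tensor_product K M N by (rule algebra_tensor_product.intro[OF assms(1,2)])
  interpret AB: algebra_tensor_product K A B by (rule algebra_tensor_product.intro[OF assms(3,4)])
  note fl = algebra_hom_linear[OF f] and gl = algebra_hom_linear[OF g]
  show ?thesis
    unfolding tensor_map_eq_lift
  proof (rule MN.tensor_lift_algebra_hom[OF AB.assoc_algebra_tensor])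
    show "(\<lambda>a b. pure_tensor K A B (f a) (g b)) \<in> bilinear_maps K M N (tensor K A B)"
      by (rule bilinear_comp[OF AB.pure_bilinear fl gl])
    show "pure_tensor K A B (f \<one>\<^bsub>M\<^esub>) (g \<one>\<^bsub>N\<^esub>) = \<one>\<^bsub>tensor K A B\<^esub>"
      by (simp add: algebra_hom_one[OF f] algebra_hom_one[OF g] AB.tensor_one)
  next
    fix a b c d assume *: "a \<in> carrier M" "b \<in> carrier N" "c \<in> carrier M" "d \<in> carrier N"
    show "pure_tensor K A B (f (a \<otimes>\<^bsub>M\<^esub> c)) (g (b \<otimes>\<^bsub>N\<^esub> d)) =
      pure_tensor K A B (f a) (g b) \<otimes>\<^bsub>tensor K A B\<^esub> pure_tensor K A B (f c) (g d)"
      using * by (simp add: algebra_hom_mult[OF f] algebra_hom_mult[OF g] AB.pure_mult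
          linear_closed[OF fl] linear_closed[OF gl])
  qed
qed

text \<open>Turns a Sweedler sum over a product of tensors into a double sum, with the left factor
  \<open>t\<close> outside and \<open>s\<close> inside. With \<Delta>(x t) = \<Delta>(x) \<Delta>(t)
  it opens the antipode laws for products.\<close>

lemma (in algebra_tensor_product) tensor_lift_mult:
  assumes W: "module K W" and f: "f \<in> bilinear_maps K M N W"
    and t: "t \<in> carrier (tensor K M N)" and s: "s \<in> carrier (tensor K M N)"
  shows "tensor_lift K W f (t \<otimes>\<^bsub>tensor K M N\<^esub> s) =
    tensor_lift K W (\<lambda>a b. tensor_lift K W (\<lambda>c d. f (a \<otimes>\<^bsub>M\<^esub> c) (b \<otimes>\<^bsub>N\<^esub> d)) s) t"
proof -
  interpret T: assoc_algebra K "tensor K M N" by (rule assoc_algebra_tensor)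
  note Ta = T.assoc_algebra_axioms
  note L = tensor_lift_linear[OF W f]
  have b1: "(\<lambda>c d. f (a \<otimes>\<^bsub>M\<^esub> c) (b \<otimes>\<^bsub>N\<^esub> d)) \<in> bilinear_maps K M N W"
    if "a \<in> carrier M" "b \<in> carrier N" for a b
    by (rule bilinear_comp[OF f linear_mult_left linear_mult_left])
      (use that in \<open>auto intro: linear_id M.assoc_algebra_axioms N.assoc_algebra_axioms\<close>)
  have b2: "(\<lambda>a b. tensor_lift K W (\<lambda>c d. f (a \<otimes>\<^bsub>M\<^esub> c) (b \<otimes>\<^bsub>N\<^esub> d)) s) \<in> bilinear_maps K M N W"
  proof (rule bilinearI; rule tensor_lift_param_linear[OF _ W _ _ s])
    fix a c d assume *: "a \<in> carrier M" "c \<in> carrier M" "d \<in> carrier N"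
    show "(\<lambda>b. f (a \<otimes>\<^bsub>M\<^esub> c) (b \<otimes>\<^bsub>N\<^esub> d)) \<in> linear_maps K N W"
      by (rule linear_comp[OF bilinear_right[OF f] linear_mult_right[OF N.assoc_algebra_axioms _ linear_id]])
        (use * in auto)
  next
    fix b c d assume *: "b \<in> carrier N" "c \<in> carrier M" "d \<in> carrier N"
    show "(\<lambda>a. f (a \<otimes>\<^bsub>M\<^esub> c) (b \<otimes>\<^bsub>N\<^esub> d)) \<in> linear_maps K M W"
      by (rule linear_comp[OF bilinear_left[OF f] linear_mult_right[OF M.assoc_algebra_axioms _ linear_id]])
        (use * in auto)
  qed (use b1 M.module_axioms N.module_axioms in auto)
  show ?thesis
  proof (rule tensor_ext[OF W _ tensor_lift_linear[OF W b2] _ t])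
    show "(\<lambda>t. tensor_lift K W f (t \<otimes>\<^bsub>tensor K M N\<^esub> s)) \<in> linear_maps K (tensor K M N) W"
      by (rule linear_comp[OF L linear_mult_right[OF Ta s linear_id]])
    fix a b assume ab: "a \<in> carrier M" "b \<in> carrier N"
    have p: "pure_tensor K M N a b \<in> carrier (tensor K M N)"
      by (rule bilinear_closed[OF pure_bilinear ab])
    have "tensor_lift K W f (pure_tensor K M N a b \<otimes>\<^bsub>tensor K M N\<^esub> s) =
      tensor_lift K W (\<lambda>c d. f (a \<otimes>\<^bsub>M\<^esub> c) (b \<otimes>\<^bsub>N\<^esub> d)) s"
    proof (rule tensor_ext[OF W _ tensor_lift_linear[OF W b1[OF ab]] _ s])
      show "(\<lambda>s. tensor_lift K W f (pure_tensor K M N a b \<otimes>\<^bsub>tensor K M N\<^esub> s)) \<in> linear_maps K (tensor K M N) W"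
        by (rule linear_comp[OF L linear_mult_left[OF Ta p linear_id]])
      fix c d assume cd: "c \<in> carrier M" "d \<in> carrier N"
      then show "tensor_lift K W f (pure_tensor K M N a b \<otimes>\<^bsub>tensor K M N\<^esub> pure_tensor K M N c d) =
        tensor_lift K W (\<lambda>c d. f (a \<otimes>\<^bsub>M\<^esub> c) (b \<otimes>\<^bsub>N\<^esub> d)) (pure_tensor K M N c d)"
        using ab by (simp add: pure_mult tensor_lift_pure[OF W f] tensor_lift_pure[OF W b1[OF ab]])
    qed
    then show "tensor_lift K W f (pure_tensor K M N a b \<otimes>\<^bsub>tensor K M N\<^esub> s) =
      tensor_lift K W (\<lambda>a b. tensor_lift K W (\<lambda>c d. f (a \<otimes>\<^bsub>M\<^esub> c) (b \<otimes>\<^bsub>N\<^esub> d)) s) (pure_tensor K M N a b)"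
      by (simp add: tensor_lift_pure[OF W b2 ab])
  qed
qed

section \<open>Sweedler calculus\<close>

abbreviation sweedler ::
    "('k, 'r) ring_scheme \<Rightarrow> ('k, 'a, 'm) coalg_scheme \<Rightarrow> ('k, 'w, 'n) module_scheme
      \<Rightarrow> ('a \<Rightarrow> 'a \<Rightarrow> 'w) \<Rightarrow> 'a \<Rightarrow> 'w"
  where "sweedler K C W f x \<equiv> tensor_lift K W f (comult C x)"

definition trilinear_maps ::
    "('k, 'r) ring_scheme \<Rightarrow> ('k, 'a, 'm) module_scheme \<Rightarrow> ('k, 'w, 'n) module_scheme
      \<Rightarrow> ('a \<Rightarrow> 'a \<Rightarrow> 'a \<Rightarrow> 'w) set"
  where "trilinear_maps K C W = {f. (\<forall>a \<in> carrier C. f a \<in> bilinear_maps K C C W) \<and>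
    (\<forall>b \<in> carrier C. \<forall>c \<in> carrier C. (\<lambda>a. f a b c) \<in> linear_maps K C W)}"

lemma trilinearI:
  assumes "\<And>a b. \<lbrakk>a \<in> carrier C; b \<in> carrier C\<rbrakk> \<Longrightarrow> (\<lambda>c. f a b c) \<in> linear_maps K C W"
    and "\<And>a c. \<lbrakk>a \<in> carrier C; c \<in> carrier C\<rbrakk> \<Longrightarrow> (\<lambda>b. f a b c) \<in> linear_maps K C W"
    and "\<And>b c. \<lbrakk>b \<in> carrier C; c \<in> carrier C\<rbrakk> \<Longrightarrow> (\<lambda>a. f a b c) \<in> linear_maps K C W"
  shows "f \<in> trilinear_maps K C W"
  using assms by (auto simp: trilinear_maps_def bilinear_maps_def)

lemma trilinearD:
  assumes "f \<in> trilinear_maps K C W"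
  shows "\<And>a b. \<lbrakk>a \<in> carrier C; b \<in> carrier C\<rbrakk> \<Longrightarrow> (\<lambda>c. f a b c) \<in> linear_maps K C W"
    and "\<And>a c. \<lbrakk>a \<in> carrier C; c \<in> carrier C\<rbrakk> \<Longrightarrow> (\<lambda>b. f a b c) \<in> linear_maps K C W"
    and "\<And>b c. \<lbrakk>b \<in> carrier C; c \<in> carrier C\<rbrakk> \<Longrightarrow> (\<lambda>a. f a b c) \<in> linear_maps K C W"
  using assms by (auto simp: trilinear_maps_def bilinear_maps_def)

lemma trilinear_bilinear:
  assumes "f \<in> trilinear_maps K C W" "a \<in> carrier C"
  shows "f a \<in> bilinear_maps K C C W" "(\<lambda>b c. f b a c) \<in> bilinear_maps K C C W"
    "(\<lambda>b c. f b c a) \<in> bilinear_maps K C C W"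
  using assms by (auto simp: trilinear_maps_def bilinear_maps_def)

text \<open>Sweedler sums make sense for any linear comultiplication. The coalgebra laws are left
  out because the calculus is used to establish those laws for V and F(C).\<close>

locale comultiplication = module K C
  for K :: "('k, 'r) ring_scheme" and C :: "('k, 'a, 'm) coalg_scheme" +
  assumes comult_linear: "comult C \<in> linear_maps K C (tensor K C C)"
begin

sublocale CC: tensor_product K C C
  by (rule tensor_productI) (rule module_axioms)+

lemma comult_closed: "x \<in> carrier C \<Longrightarrow> comult C x \<in> carrier (tensor K C C)"
  by (rule linear_closed[OF comult_linear])

lemma sweedler_linear:
  "\<lbrakk>module K W; f \<in> bilinear_maps K C C W\<rbrakk> \<Longrightarrow> sweedler K C W f \<in> linear_maps K C W"
  by (rule linear_comp[OF CC.tensor_lift_linear comult_linear])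

lemma sweedler_closed:
  "\<lbrakk>module K W; f \<in> bilinear_maps K C C W; x \<in> carrier C\<rbrakk> \<Longrightarrow> sweedler K C W f x \<in> carrier W"
  by (rule linear_closed[OF sweedler_linear])

lemma sweedler_cong:
  assumes "module K W" "f \<in> bilinear_maps K C C W" "x \<in> carrier C"
    and "\<And>a b. \<lbrakk>a \<in> carrier C; b \<in> carrier C\<rbrakk> \<Longrightarrow> f a b = g a b"
  shows "sweedler K C W f x = sweedler K C W g x"
  by (rule CC.tensor_lift_cong[OF assms(1,2) comult_closed[OF assms(3)] assms(4)])

lemma sweedler_comp:
  assumes "module K W" "module K W'" "f \<in> bilinear_maps K C C W" "h \<in> linear_maps K W W'" "x \<in> carrier C"
  shows "h (sweedler K C W f x) = sweedler K C W' (\<lambda>a b. h (f a b)) x"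
  by (rule CC.tensor_lift_comp[OF assms(1-4) comult_closed[OF assms(5)]])

lemma sweedler_param_linear:
  assumes "module K D" "module K W" "\<And>x. x \<in> carrier D \<Longrightarrow> f x \<in> bilinear_maps K C C W"
    and "\<And>a b. \<lbrakk>a \<in> carrier C; b \<in> carrier C\<rbrakk> \<Longrightarrow> (\<lambda>x. f x a b) \<in> linear_maps K D W"
    and "y \<in> carrier C"
  shows "(\<lambda>x. sweedler K C W (f x) y) \<in> linear_maps K D W"
  by (rule CC.tensor_lift_param_linear[OF assms(1-4) comult_closed[OF assms(5)]])

text \<open>Lifting \<open>f\<close> after \<open>tensor_swap\<close> is lifting the flipped
  \<open>f\<close>, and cocommutativity says that the swap fixes the coproduct.\<close>

lemma sweedler_commute:
  assumes co: "cocommutative K C" and W: "module K W" and f: "f \<in> bilinear_maps K C C W" and x: "x \<in> carrier C"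
  shows "sweedler K C W (\<lambda>a b. f b a) x = sweedler K C W f x"
proof -
  note T = CC.module_tensor
  note s = bilinear_flip[OF CC.pure_bilinear]
  have "tensor_lift K W f (tensor_swap K C C (comult C x)) = tensor_lift K W (\<lambda>a b. f b a) (comult C x)"
    unfolding tensor_swap_def
    by (rule CC.tensor_ext[OF W linear_comp[OF CC.tensor_lift_linear[OF W f] CC.tensor_lift_linear[OF T s]]
          CC.tensor_lift_linear[OF W bilinear_flip[OF f]] _ comult_closed[OF x]])
      (simp add: CC.tensor_lift_pure[OF T s] CC.tensor_lift_pure[OF W f]
        CC.tensor_lift_pure[OF W bilinear_flip[OF f]])
  then show ?thesis
    using co x by (simp add: cocommutative_def)
qed

lemma sweedler_nested_right_bilinear:
  assumes W: "module K W" and f: "f \<in> trilinear_maps K C W"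
  shows "(\<lambda>a b. sweedler K C W (\<lambda>c d. f a c d) b) \<in> bilinear_maps K C C W"
  by (intro bilinearI sweedler_linear[OF W] sweedler_param_linear[OF module_axioms W]
      trilinear_bilinear(1)[OF f] trilinearD(3)[OF f])

lemma sweedler_nested_left_bilinear:
  assumes W: "module K W" and f: "f \<in> trilinear_maps K C W"
  shows "(\<lambda>a b. sweedler K C W (\<lambda>c d. f c d b) a) \<in> bilinear_maps K C C W"
  by (intro bilinearI sweedler_linear[OF W] sweedler_param_linear[OF module_axioms W]
      trilinear_bilinear(3)[OF f] trilinearD(1)[OF f])

lemma module_CC: "module K (tensor K C C)"
  by (rule CC.module_tensor)

lemma pure_trilinear:
  "(\<lambda>a b c. pure_tensor K C (tensor K C C) a (pure_tensor K C C b c)) \<in>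
    trilinear_maps K C (tensor K C (tensor K C C))"
  by (intro trilinearI linear_pure_left linear_pure_right pure_closed module_axioms module_CC linear_id; assumption)

text \<open>This lemma and the next express both sides of the coassociativity axiom as nested
  Sweedler sums of the universal trilinear map. The axiom and its Sweedler form can then be
  exchanged in either direction.\<close>

lemma assoc_comult_left:
  assumes x: "x \<in> carrier C"
  shows "tensor_assoc K C C C (tensor_map K (tensor K C C) C (comult C) id (comult C x)) =
    sweedler K C (tensor K C (tensor K C C)) (\<lambda>a b. sweedler K C (tensor K C (tensor K C C))
      (\<lambda>c d. pure_tensor K C (tensor K C C) c (pure_tensor K C C d b)) a) x"
proof -
  let ?T = "tensor K C (tensor K C C)"
  interpret L: tensor_product K "tensor K C C" C by (rule tensor_productI[OF module_CC module_axioms])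
  interpret R: tensor_product K C "tensor K C C" by (rule tensor_productI[OF module_axioms module_CC])
  note T = R.module_tensor
  note tri = pure_trilinear
  have b: "(\<lambda>t b. tensor_lift K ?T (\<lambda>c d. pure_tensor K C (tensor K C C) c (pure_tensor K C C d b)) t)
      \<in> bilinear_maps K (tensor K C C) C ?T"
    by (intro bilinearI CC.tensor_lift_linear[OF T] CC.tensor_lift_param_linear[OF module_axioms T]
        trilinear_bilinear(3)[OF tri] trilinearD(1)[OF tri])
  have id: "id \<in> linear_maps K C C" using linear_id by (simp add: id_def)
  show ?thesis
    unfolding tensor_assoc_def Let_def
    by (subst tensor_lift_tensor_map[OF module_axioms module_axioms module_CC module_axioms
          comult_linear id T b comult_closed[OF x]]) simp
qed

lemma assoc_comult_right:
  assumes x: "x \<in> carrier C"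
  shows "tensor_map K C (tensor K C C) id (comult C) (comult C x) =
    sweedler K C (tensor K C (tensor K C C)) (\<lambda>a b. sweedler K C (tensor K C (tensor K C C))
      (\<lambda>c d. pure_tensor K C (tensor K C C) a (pure_tensor K C C c d)) b) x"
proof -
  let ?T = "tensor K C (tensor K C C)"
  interpret R: tensor_product K C "tensor K C C" by (rule tensor_productI[OF module_axioms module_CC])
  note T = R.module_tensor
  have id: "id \<in> linear_maps K C C" using linear_id by (simp add: id_def)
  \<comment> \<open>Lifting the universal bilinear map gives the identity, so a coproduct is itself
    a Sweedler sum of pure tensors.\<close>
  have pid: "tensor_lift K (tensor K C C) (pure_tensor K C C) t = t" if "t \<in> carrier (tensor K C C)" for t
    by (rule CC.tensor_ext[OF module_CC CC.tensor_lift_linear[OF module_CC CC.pure_bilinear] linear_id _ that])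
      (simp add: CC.tensor_lift_pure[OF module_CC CC.pure_bilinear])
  have "pure_tensor K C (tensor K C C) a (comult C b) =
     sweedler K C ?T (\<lambda>c d. pure_tensor K C (tensor K C C) a (pure_tensor K C C c d)) b"
    if "a \<in> carrier C" "b \<in> carrier C" for a b
    using CC.tensor_lift_comp[OF module_CC T CC.pure_bilinear bilinear_right[OF R.pure_bilinear that(1)]
        comult_closed[OF that(2)]] pid[OF comult_closed[OF that(2)]] by simp
  then show ?thesis
    unfolding tensor_map_eq_lift
    by (intro sweedler_cong T x tensor_map_bilinear module_axioms module_CC id comult_linear) simp
qed

end

sublocale coalgebra \<subseteq> comultiplication
  by unfold_locales (rule comult_linear)

context coalgebra
begin

text \<open>A trilinear \<open>f\<close> factors through a linear map \<open>?F\<close> on the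
  triple tensor product, and applying \<open>?F\<close> to the coassociativity axiom gives the
  identity for \<open>f\<close>.\<close>

lemma sweedler_coassoc:
  assumes W: "module K W" and f: "f \<in> trilinear_maps K C W" and x: "x \<in> carrier C"
  shows "sweedler K C W (\<lambda>a b. sweedler K C W (\<lambda>c d. f c d b) a) x =
    sweedler K C W (\<lambda>a b. sweedler K C W (\<lambda>c d. f a c d) b) x"
proof -
  let ?T = "tensor K C (tensor K C C)"
  let ?p = "\<lambda>a b c. pure_tensor K C (tensor K C C) a (pure_tensor K C C b c)"
  interpret R: tensor_product K C "tensor K C C" by (rule tensor_productI[OF module_axioms module_CC])
  note T = R.module_tensor
  have g: "(\<lambda>a t. tensor_lift K W (\<lambda>b c. f a b c) t) \<in> bilinear_maps K C (tensor K C C) W"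
    by (intro bilinearI CC.tensor_lift_linear[OF W] CC.tensor_lift_param_linear[OF module_axioms W]
        trilinear_bilinear(1)[OF f] trilinearD(3)[OF f])
  let ?F = "tensor_lift K W (\<lambda>a t. tensor_lift K W (\<lambda>b c. f a b c) t)"
  have F: "?F \<in> linear_maps K ?T W" by (rule R.tensor_lift_linear[OF W g])
  have Fp: "?F (?p a b c) = f a b c" if "a \<in> carrier C" "b \<in> carrier C" "c \<in> carrier C" for a b c
    using that by (simp add: R.tensor_lift_pure[OF W g] pure_closed module_axioms
        CC.tensor_lift_pure[OF W trilinear_bilinear(1)[OF f]])
  have Fp_lift: "?F (tensor_lift K ?T p t) = tensor_lift K W q t"
    if "p \<in> bilinear_maps K C C ?T" "t \<in> carrier (tensor K C C)"
      "\<And>a b. \<lbrakk>a \<in> carrier C; b \<in> carrier C\<rbrakk> \<Longrightarrow> ?F (p a b) = q a b" for p q t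
    unfolding CC.tensor_lift_comp[OF T W that(1) F that(2)]
    by (rule CC.tensor_lift_cong[OF W bilinear_comp_linear[OF that(1) F] that(2,3)])
  note tri = pure_trilinear
  have "?F (sweedler K C ?T (\<lambda>a b. sweedler K C ?T (\<lambda>c d. ?p c d b) a) x) =
      sweedler K C W (\<lambda>a b. sweedler K C W (\<lambda>c d. f c d b) a) x"
    by (intro Fp_lift sweedler_nested_left_bilinear T tri trilinear_bilinear(3)[OF tri] comult_closed x Fp)
  moreover have "?F (sweedler K C ?T (\<lambda>a b. sweedler K C ?T (\<lambda>c d. ?p a c d) b) x) =
      sweedler K C W (\<lambda>a b. sweedler K C W (\<lambda>c d. f a c d) b) x"
    by (intro Fp_lift sweedler_nested_right_bilinear T tri trilinear_bilinear(1)[OF tri] comult_closed x Fp)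
  ultimately show ?thesis
    using coassoc[OF x] unfolding assoc_comult_left[OF x] assoc_comult_right[OF x] by simp
qed

lemma counit_closed: "x \<in> carrier C \<Longrightarrow> counit C x \<in> carrier K"
  using linear_closed[OF counit_linear] by simp

lemma sweedler_counit_left:
  assumes W: "module K W" and h: "h \<in> linear_maps K C W" and x: "x \<in> carrier C"
  shows "sweedler K C W (\<lambda>a b. counit C a \<odot>\<^bsub>W\<^esub> h b) x = h x"
proof -
  have b: "(\<lambda>a b. counit C a \<odot>\<^bsub>C\<^esub> b) \<in> bilinear_maps K C C C"
    by (intro bilinearI linear_smult_const linear_smult_vec linear_id counit_linear counit_closed module_axioms; assumption)
  have "h x = sweedler K C W (\<lambda>a b. h (counit C a \<odot>\<^bsub>C\<^esub> b)) x"
    using sweedler_comp[OF module_axioms W b h x] counit_left[OF x] by simp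
  also have "\<dots> = sweedler K C W (\<lambda>a b. counit C a \<odot>\<^bsub>W\<^esub> h b) x"
    by (intro sweedler_cong W x bilinear_comp_linear[OF b h] linear_smult[OF h] counit_closed)
  finally show ?thesis by simp
qed

lemma sweedler_counit_right:
  assumes W: "module K W" and h: "h \<in> linear_maps K C W" and x: "x \<in> carrier C"
  shows "sweedler K C W (\<lambda>a b. counit C b \<odot>\<^bsub>W\<^esub> h a) x = h x"
proof -
  have b: "(\<lambda>a b. counit C b \<odot>\<^bsub>C\<^esub> a) \<in> bilinear_maps K C C C"
    by (intro bilinearI linear_smult_const linear_smult_vec linear_id counit_linear counit_closed module_axioms; assumption)
  have "h x = sweedler K C W (\<lambda>a b. h (counit C b \<odot>\<^bsub>C\<^esub> a)) x"
    using sweedler_comp[OF module_axioms W b h x] counit_right[OF x] by simp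
  also have "\<dots> = sweedler K C W (\<lambda>a b. counit C b \<odot>\<^bsub>W\<^esub> h a) x"
    by (intro sweedler_cong W x bilinear_comp_linear[OF b h] linear_smult[OF h] counit_closed)
  finally show ?thesis by simp
qed

text \<open>In the convolution algebra, f = f * (g * h) = (f * g) * h = h: a left inverse and a
  right inverse of \<open>g\<close> coincide. Coassociativity does the rebracketing; the counit laws
  make the counit the unit.\<close>

lemma convolution_inverse_unique:
  assumes A: "assoc_algebra K A"
    and f: "f \<in> linear_maps K C A" and g: "g \<in> linear_maps K C A" and h: "h \<in> linear_maps K C A"
    and fg: "\<And>x. x \<in> carrier C \<Longrightarrow> sweedler K C A (\<lambda>a b. f a \<otimes>\<^bsub>A\<^esub> g b) x = counit C x \<odot>\<^bsub>A\<^esub> \<one>\<^bsub>A\<^esub>"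
    and gh: "\<And>x. x \<in> carrier C \<Longrightarrow> sweedler K C A (\<lambda>a b. g a \<otimes>\<^bsub>A\<^esub> h b) x = counit C x \<odot>\<^bsub>A\<^esub> \<one>\<^bsub>A\<^esub>"
    and x: "x \<in> carrier C"
  shows "f x = h x"
proof -
  interpret A: assoc_algebra K A by (rule A)
  note Am = A.module_axioms
  note cl = linear_closed[OF f] linear_closed[OF g] linear_closed[OF h] counit_closed
  have tri: "(\<lambda>a b c. f a \<otimes>\<^bsub>A\<^esub> (g b \<otimes>\<^bsub>A\<^esub> h c)) \<in> trilinear_maps K C A"
    by (intro trilinearI linear_mult_left[OF A] linear_mult_right[OF A] f g h cl A.A.m_closed; assumption)
  have gh_b: "(\<lambda>a b. g a \<otimes>\<^bsub>A\<^esub> h b) \<in> bilinear_maps K C C A"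
    and fg_b: "(\<lambda>a b. f a \<otimes>\<^bsub>A\<^esub> g b) \<in> bilinear_maps K C C A"
    by (rule bilinear_comp[OF bilinear_mult[OF A]]; rule f g h)+
  have sm: "(\<lambda>a b. counit C b \<odot>\<^bsub>A\<^esub> f a) \<in> bilinear_maps K C C A"
    by (intro bilinearI linear_smult_const linear_smult_vec f counit_linear cl Am; assumption)
  have "f x = sweedler K C A (\<lambda>a b. counit C b \<odot>\<^bsub>A\<^esub> f a) x"
    by (rule sweedler_counit_right[OF Am f x, symmetric])
  also have "\<dots> = sweedler K C A (\<lambda>a b. sweedler K C A (\<lambda>c d. f a \<otimes>\<^bsub>A\<^esub> (g c \<otimes>\<^bsub>A\<^esub> h d)) b) x"
  proof (rule sweedler_cong[OF Am sm x])
    fix a b assume ab: "a \<in> carrier C" "b \<in> carrier C"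
    have "counit C b \<odot>\<^bsub>A\<^esub> f a = f a \<otimes>\<^bsub>A\<^esub> (counit C b \<odot>\<^bsub>A\<^esub> \<one>\<^bsub>A\<^esub>)"
      using ab cl by (simp add: A.smult_mult_right)
    also have "\<dots> = sweedler K C A (\<lambda>c d. f a \<otimes>\<^bsub>A\<^esub> (g c \<otimes>\<^bsub>A\<^esub> h d)) b"
      unfolding gh[OF ab(2), symmetric]
      by (rule sweedler_comp[OF Am Am gh_b linear_mult_left[OF A cl(1)[OF ab(1)] linear_id] ab(2)])
    finally show "counit C b \<odot>\<^bsub>A\<^esub> f a = sweedler K C A (\<lambda>c d. f a \<otimes>\<^bsub>A\<^esub> (g c \<otimes>\<^bsub>A\<^esub> h d)) b" .
  qed
  also have "\<dots> = sweedler K C A (\<lambda>a b. sweedler K C A (\<lambda>c d. f c \<otimes>\<^bsub>A\<^esub> (g d \<otimes>\<^bsub>A\<^esub> h b)) a) x"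
    by (rule sweedler_coassoc[OF Am tri x, symmetric])
  also have "\<dots> = sweedler K C A (\<lambda>a b. counit C a \<odot>\<^bsub>A\<^esub> h b) x"
  proof (rule sweedler_cong[OF Am sweedler_nested_left_bilinear[OF Am tri] x])
    fix a b assume ab: "a \<in> carrier C" "b \<in> carrier C"
    have "sweedler K C A (\<lambda>c d. f c \<otimes>\<^bsub>A\<^esub> (g d \<otimes>\<^bsub>A\<^esub> h b)) a =
        sweedler K C A (\<lambda>c d. (f c \<otimes>\<^bsub>A\<^esub> g d) \<otimes>\<^bsub>A\<^esub> h b) a"
      by (rule sweedler_cong[OF Am trilinear_bilinear(3)[OF tri ab(2)] ab(1)])
        (use cl ab in \<open>simp add: A.A.m_assoc\<close>)
    also have "\<dots> = sweedler K C A (\<lambda>c d. f c \<otimes>\<^bsub>A\<^esub> g d) a \<otimes>\<^bsub>A\<^esub> h b"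
      by (rule sweedler_comp[OF Am Am fg_b linear_mult_right[OF A cl(3)[OF ab(2)] linear_id] ab(1), symmetric])
    also have "\<dots> = counit C a \<odot>\<^bsub>A\<^esub> h b"
      using ab cl by (simp add: fg A.smult_mult_left)
    finally show "sweedler K C A (\<lambda>c d. f c \<otimes>\<^bsub>A\<^esub> (g d \<otimes>\<^bsub>A\<^esub> h b)) a = counit C a \<odot>\<^bsub>A\<^esub> h b" .
  qed
  also have "\<dots> = h x"
    by (rule sweedler_counit_left[OF Am h x])
  finally show ?thesis .
qed

end

context cocommutative_coalgebra
begin

text \<open>Of the four factors \<open>x\<^sub>1\<close>, \<open>x\<^sub>2\<close>,
  \<open>x\<^sub>3\<close>, \<open>x\<^sub>4\<close>, the middle two come from different coproducts.
  Rebracketing makes them the coproduct of a single element, where cocommutativity can exchange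
  them; the same rebracketing is then undone.\<close>

lemma sweedler_middle_swap:
  assumes W: "module K W" and x: "x \<in> carrier C"
    and f1: "\<And>a b c. \<lbrakk>a \<in> carrier C; b \<in> carrier C; c \<in> carrier C\<rbrakk> \<Longrightarrow> (\<lambda>y. f y a b c) \<in> linear_maps K C W"
    and f2: "\<And>a b c. \<lbrakk>a \<in> carrier C; b \<in> carrier C; c \<in> carrier C\<rbrakk> \<Longrightarrow> (\<lambda>y. f a y b c) \<in> linear_maps K C W"
    and f3: "\<And>a b c. \<lbrakk>a \<in> carrier C; b \<in> carrier C; c \<in> carrier C\<rbrakk> \<Longrightarrow> (\<lambda>y. f a b y c) \<in> linear_maps K C W"
    and f4: "\<And>a b c. \<lbrakk>a \<in> carrier C; b \<in> carrier C; c \<in> carrier C\<rbrakk> \<Longrightarrow> (\<lambda>y. f a b c y) \<in> linear_maps K C W"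
  shows "sweedler K C W (\<lambda>a b. sweedler K C W (\<lambda>c d. sweedler K C W (\<lambda>e g. f c e d g) b) a) x =
    sweedler K C W (\<lambda>a b. sweedler K C W (\<lambda>c d. sweedler K C W (\<lambda>e g. f c d e g) b) a) x"
proof -
  note C = module_axioms
  have rebracket: "sweedler K C W (\<lambda>a b. sweedler K C W (\<lambda>c d. sweedler K C W (\<lambda>e g. h c d e g) b) a) x =
      sweedler K C W (\<lambda>c b. sweedler K C W (\<lambda>u g. sweedler K C W (\<lambda>d e. h c d e g) u) b) x"
    if h1: "\<And>a b c. \<lbrakk>a \<in> carrier C; b \<in> carrier C; c \<in> carrier C\<rbrakk> \<Longrightarrow> (\<lambda>y. h y a b c) \<in> linear_maps K C W"
      and h2: "\<And>a b c. \<lbrakk>a \<in> carrier C; b \<in> carrier C; c \<in> carrier C\<rbrakk> \<Longrightarrow> (\<lambda>y. h a y b c) \<in> linear_maps K C W"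
      and h3: "\<And>a b c. \<lbrakk>a \<in> carrier C; b \<in> carrier C; c \<in> carrier C\<rbrakk> \<Longrightarrow> (\<lambda>y. h a b y c) \<in> linear_maps K C W"
      and h4: "\<And>a b c. \<lbrakk>a \<in> carrier C; b \<in> carrier C; c \<in> carrier C\<rbrakk> \<Longrightarrow> (\<lambda>y. h a b c y) \<in> linear_maps K C W"
    for h
  proof -
    have t1: "(\<lambda>c d b. sweedler K C W (\<lambda>e g. h c d e g) b) \<in> trilinear_maps K C W"
      by (intro trilinearI sweedler_linear[OF W] sweedler_param_linear[OF C W] bilinearI h1 h2 h3 h4; assumption)
    have t2: "(\<lambda>d e g. h c d e g) \<in> trilinear_maps K C W" if "c \<in> carrier C" for c
      by (intro trilinearI h1 h2 h3 h4 that; assumption)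
    show ?thesis
      unfolding sweedler_coassoc[OF W t1 x]
      by (rule sweedler_cong[OF W sweedler_nested_right_bilinear[OF W t1] x])
        (rule sweedler_coassoc[OF W t2, symmetric])
  qed
  \<comment> \<open>After rebracketing, \<open>d\<close> and \<open>e\<close> are the two factors of
    the coproduct of \<open>u\<close>.\<close>
  have 2: "sweedler K C W (\<lambda>c b. sweedler K C W (\<lambda>u g. sweedler K C W (\<lambda>d e. f c e d g) u) b) x =
      sweedler K C W (\<lambda>c b. sweedler K C W (\<lambda>u g. sweedler K C W (\<lambda>d e. f c d e g) u) b) x"
    by (intro sweedler_cong[OF W] sweedler_commute[OF cocommutative W] bilinearI sweedler_linear[OF W]
        sweedler_param_linear[OF C W] x f1 f2 f3 f4; assumption)
  show ?thesis
    by (subst rebracket, (intro f1 f2 f3 f4; assumption)+, subst rebracket, (intro f1 f2 f3 f4; assumption)+)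
      (rule 2)
qed

text \<open>If \<open>u\<close> has convolution inverse \<open>v\<close>, then so does \<open>\<Delta> u\<close>: cocommutativity reorders
  \<open>u x\<^sub>1 v x\<^sub>3 \<otimes> u x\<^sub>2 v x\<^sub>4\<close> to \<open>u x\<^sub>1 v x\<^sub>2 \<otimes> u x\<^sub>3 v x\<^sub>4\<close>.\<close>

lemma convolution_inverse_tensor:
  assumes A: "assoc_algebra K A" and u: "u \<in> linear_maps K C A" and v: "v \<in> linear_maps K C A"
    and uv: "\<And>x. x \<in> carrier C \<Longrightarrow> sweedler K C A (\<lambda>a b. u a \<otimes>\<^bsub>A\<^esub> v b) x = counit C x \<odot>\<^bsub>A\<^esub> \<one>\<^bsub>A\<^esub>"
    and x: "x \<in> carrier C"
  shows "sweedler K C (tensor K A A) (\<lambda>a b. tensor_map K A A u u (comult C a) \<otimes>\<^bsub>tensor K A A\<^esub>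
      tensor_map K A A v v (comult C b)) x = counit C x \<odot>\<^bsub>tensor K A A\<^esub> \<one>\<^bsub>tensor K A A\<^esub>"
proof -
  interpret A: assoc_algebra K A by (rule A)
  interpret AA: algebra_tensor_product K A A by (rule algebra_tensor_product.intro[OF A A])
  let ?T = "tensor K A A" and ?p = "pure_tensor K A A"
  note C = module_axioms
  note Am = A.module_axioms
  note Ta = AA.assoc_algebra_tensor
  note T = assoc_algebra_module[OF Ta]
  interpret T: assoc_algebra K ?T by (rule Ta)
  note cl = linear_closed[OF u] linear_closed[OF v] counit_closed
  let ?U = "\<lambda>a. tensor_map K A A u u (comult C a)" and ?V = "\<lambda>a. tensor_map K A A v v (comult C a)"
  have UV: "?U \<in> linear_maps K C ?T" "?V \<in> linear_maps K C ?T"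
    by (intro linear_comp[OF tensor_map_linear[OF C C Am Am u u] comult_linear]
        linear_comp[OF tensor_map_linear[OF C C Am Am v v] comult_linear])+
  have pU: "(\<lambda>c d. ?p (u c) (u d)) \<in> bilinear_maps K C C ?T" and pV: "(\<lambda>c d. ?p (v c) (v d)) \<in> bilinear_maps K C C ?T"
    by (intro bilinear_comp[OF AA.pure_bilinear] u v)+
  have pc: "\<And>a b. \<lbrakk>a \<in> carrier A; b \<in> carrier A\<rbrakk> \<Longrightarrow> ?p a b \<in> carrier ?T"
    by (rule pure_closed[OF Am Am])
  note lin = linear_pure_left[OF Am Am] linear_pure_right[OF Am Am] linear_mult_left[OF A] linear_mult_right[OF A] u v
  let ?f = "\<lambda>c d e g. ?p (u c \<otimes>\<^bsub>A\<^esub> v d) (u e \<otimes>\<^bsub>A\<^esub> v g)"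
  have uvb: "(\<lambda>a b. u a \<otimes>\<^bsub>A\<^esub> v b) \<in> bilinear_maps K C C A"
    by (rule bilinear_comp[OF bilinear_mult[OF A] u v])
  have "sweedler K C ?T (\<lambda>a b. ?U a \<otimes>\<^bsub>?T\<^esub> ?V b) x =
    sweedler K C ?T (\<lambda>a b. sweedler K C ?T (\<lambda>c d. sweedler K C ?T (\<lambda>e g. ?f c e d g) b) a) x"
  proof (rule sweedler_cong[OF T bilinear_comp[OF bilinear_mult[OF Ta] UV] x])
    fix a b assume ab: "a \<in> carrier C" "b \<in> carrier C"
    have "?U a \<otimes>\<^bsub>?T\<^esub> ?V b = sweedler K C ?T (\<lambda>c d. ?p (u c) (u d) \<otimes>\<^bsub>?T\<^esub> ?V b) a"
      unfolding tensor_map_eq_lift[of K A A u]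
      by (rule sweedler_comp[OF T T pU linear_mult_right[OF Ta linear_closed[OF UV(2) ab(2)] linear_id] ab(1)])
    also have "\<dots> = sweedler K C ?T (\<lambda>c d. sweedler K C ?T (\<lambda>e g. ?f c e d g) b) a"
    proof (rule sweedler_cong[OF T _ ab(1)])
      show "(\<lambda>c d. ?p (u c) (u d) \<otimes>\<^bsub>?T\<^esub> ?V b) \<in> bilinear_maps K C C ?T"
        by (rule bilinear_comp_linear[OF pU linear_mult_right[OF Ta linear_closed[OF UV(2) ab(2)] linear_id]])
      fix c d assume cd: "c \<in> carrier C" "d \<in> carrier C"
      note ucd = pc[OF cl(1)[OF cd(1)] cl(1)[OF cd(2)]]
      have "?p (u c) (u d) \<otimes>\<^bsub>?T\<^esub> ?V b = sweedler K C ?T (\<lambda>e g. ?p (u c) (u d) \<otimes>\<^bsub>?T\<^esub> ?p (v e) (v g)) b"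
        unfolding tensor_map_eq_lift[of K A A v]
        by (rule sweedler_comp[OF T T pV linear_mult_left[OF Ta ucd linear_id] ab(2)])
      also have "\<dots> = sweedler K C ?T (\<lambda>e g. ?f c e d g) b"
        by (rule sweedler_cong[OF T bilinear_comp_linear[OF pV linear_mult_left[OF Ta ucd linear_id]] ab(2)])
          (use cd cl in \<open>simp add: AA.pure_mult\<close>)
      finally show "?p (u c) (u d) \<otimes>\<^bsub>?T\<^esub> ?V b = sweedler K C ?T (\<lambda>e g. ?f c e d g) b" .
    qed
    finally show "?U a \<otimes>\<^bsub>?T\<^esub> ?V b = sweedler K C ?T (\<lambda>c d. sweedler K C ?T (\<lambda>e g. ?f c e d g) b) a" .
  qed
  also have "\<dots> = sweedler K C ?T (\<lambda>a b. sweedler K C ?T (\<lambda>c d. sweedler K C ?T (\<lambda>e g. ?f c d e g) b) a) x"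
    by (rule sweedler_middle_swap[OF T x]; intro lin cl A.A.m_closed; assumption)
  \<comment> \<open>In the reordered sum the left tensor factor involves only the coproduct of
    \<open>a\<close> and the right one only that of \<open>b\<close>. The sum splits accordingly,
    and \<open>uv\<close> evaluates each factor.\<close>
  also have "\<dots> = sweedler K C ?T (\<lambda>a b. counit C a \<odot>\<^bsub>?T\<^esub> (counit C b \<odot>\<^bsub>?T\<^esub> \<one>\<^bsub>?T\<^esub>)) x"
  proof (rule sweedler_cong[OF T _ x])
    show "(\<lambda>a b. sweedler K C ?T (\<lambda>c d. sweedler K C ?T (\<lambda>e g. ?f c d e g) b) a) \<in> bilinear_maps K C C ?T"
      by (intro bilinearI sweedler_linear[OF T] sweedler_param_linear[OF C T] lin cl A.A.m_closed; assumption)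
    fix a b assume ab: "a \<in> carrier C" "b \<in> carrier C"
    have uvc: "sweedler K C A (\<lambda>e g. u e \<otimes>\<^bsub>A\<^esub> v g) b \<in> carrier A"
      by (rule sweedler_closed[OF Am uvb ab(2)])
    have "sweedler K C ?T (\<lambda>c d. sweedler K C ?T (\<lambda>e g. ?f c d e g) b) a =
      sweedler K C ?T (\<lambda>c d. ?p (u c \<otimes>\<^bsub>A\<^esub> v d) (sweedler K C A (\<lambda>e g. u e \<otimes>\<^bsub>A\<^esub> v g) b)) a"
    proof (rule sweedler_cong[OF T _ ab(1), symmetric])
      show "(\<lambda>c d. ?p (u c \<otimes>\<^bsub>A\<^esub> v d) (sweedler K C A (\<lambda>e g. u e \<otimes>\<^bsub>A\<^esub> v g) b)) \<in> bilinear_maps K C C ?T"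
        by (intro bilinearI lin cl uvc; assumption)
      fix c d assume cd: "c \<in> carrier C" "d \<in> carrier C"
      show "?p (u c \<otimes>\<^bsub>A\<^esub> v d) (sweedler K C A (\<lambda>e g. u e \<otimes>\<^bsub>A\<^esub> v g) b) = sweedler K C ?T (\<lambda>e g. ?f c d e g) b"
        by (rule sweedler_comp[OF Am T uvb bilinear_right[OF AA.pure_bilinear] ab(2)])
          (use cl cd in simp)
    qed
    also have "\<dots> = ?p (sweedler K C A (\<lambda>c d. u c \<otimes>\<^bsub>A\<^esub> v d) a) (sweedler K C A (\<lambda>e g. u e \<otimes>\<^bsub>A\<^esub> v g) b)"
      by (rule sweedler_comp[OF Am T uvb bilinear_left[OF AA.pure_bilinear uvc] ab(1), symmetric])
    also have "\<dots> = counit C a \<odot>\<^bsub>?T\<^esub> (counit C b \<odot>\<^bsub>?T\<^esub> \<one>\<^bsub>?T\<^esub>)"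
      using ab cl by (simp add: uv linear_smult[OF bilinear_right[OF AA.pure_bilinear]]
          linear_smult[OF bilinear_left[OF AA.pure_bilinear]] AA.tensor_one pc
          T.smult_assoc1[symmetric] R.m_comm)
    finally show "sweedler K C ?T (\<lambda>c d. sweedler K C ?T (\<lambda>e g. ?f c d e g) b) a =
      counit C a \<odot>\<^bsub>?T\<^esub> (counit C b \<odot>\<^bsub>?T\<^esub> \<one>\<^bsub>?T\<^esub>)" .
  qed
  also have "\<dots> = counit C x \<odot>\<^bsub>?T\<^esub> \<one>\<^bsub>?T\<^esub>"
    by (rule sweedler_counit_left[OF T linear_smult_vec[OF T _ counit_linear] x]) simp
  finally show ?thesis .
qed

end

section \<open>Coalgebras spanned by images of a coalgebra\<close>

text \<open>A family of maps covers two uses: the inclusions of C into V, indexed by natural numbers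
  and jointly spanning, and the single map from V to F(C), whose image only generates. The target
  has a linear comultiplication; its coalgebra laws are derived on the images.\<close>

locale intertwining_family =
  C: cocommutative_coalgebra K C + V: comultiplication K V
  for K :: "('k, 'r) ring_scheme" and C :: "('k, 'a, 'm) coalg_scheme"
    and V :: "('k, 'b, 'n) coalg_scheme" +
  fixes inc :: "'i \<Rightarrow> 'a \<Rightarrow> 'b"
  assumes inc_linear: "inc i \<in> linear_maps K C V"
    and counit_V_linear: "counit V \<in> linear_maps K V (self_module K)"
    and comult_inc: "x \<in> carrier C \<Longrightarrow> comult V (inc i x) = tensor_map K V V (inc i) (inc i) (comult C x)"
    and counit_inc: "x \<in> carrier C \<Longrightarrow> counit V (inc i x) = counit C x"
begin

lemma inc_closed: "x \<in> carrier C \<Longrightarrow> inc i x \<in> carrier V"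
  by (rule linear_closed[OF inc_linear])

lemma sweedler_inc:
  assumes "module K W" "f \<in> bilinear_maps K V V W" "x \<in> carrier C"
  shows "sweedler K V W f (inc i x) = sweedler K C W (\<lambda>a b. f (inc i a) (inc i b)) x"
  unfolding comult_inc[OF assms(3)]
  by (rule tensor_lift_tensor_map[OF C.module_axioms C.module_axioms V.module_axioms V.module_axioms
        inc_linear inc_linear assms(1,2) C.comult_closed[OF assms(3)]])

lemma bilinear_inc: "f \<in> bilinear_maps K V V W \<Longrightarrow> (\<lambda>a b. f (inc i a) (inc i b)) \<in> bilinear_maps K C C W"
  by (rule bilinear_comp[OF _ inc_linear inc_linear])

lemma trilinear_inc:
  assumes "f \<in> trilinear_maps K V W"
  shows "(\<lambda>a b c. f (inc i a) (inc i b) (inc i c)) \<in> trilinear_maps K C W"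
  by (rule trilinearI)
    (rule linear_comp[OF trilinearD(1)[OF assms] inc_linear] linear_comp[OF trilinearD(2)[OF assms] inc_linear]
      linear_comp[OF trilinearD(3)[OF assms] inc_linear]; simp add: inc_closed)+

text \<open>Both nested sums are pulled back along \<open>inc i\<close> to C, the outer sum before
  the inner one, and coassociativity of C is applied there.\<close>

lemma coassoc_inc:
  assumes T: "module K W" and tri: "p \<in> trilinear_maps K V W" and x: "x \<in> carrier C"
  shows "sweedler K V W (\<lambda>a b. sweedler K V W (\<lambda>c d. p c d b) a) (inc i x) =
      sweedler K V W (\<lambda>a b. sweedler K V W (\<lambda>c d. p a c d) b) (inc i x)"
proof -
  have "sweedler K V W (\<lambda>a b. sweedler K V W (\<lambda>c d. p c d b) a) (inc i x) =
      sweedler K C W (\<lambda>a b. sweedler K V W (\<lambda>c d. p c d (inc i b)) (inc i a)) x"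
    by (rule sweedler_inc[OF T V.sweedler_nested_left_bilinear[OF T tri] x])
  also have "\<dots> = sweedler K C W (\<lambda>a b. sweedler K C W (\<lambda>c d. p (inc i c) (inc i d) (inc i b)) a) x"
    by (rule C.sweedler_cong[OF T bilinear_inc[OF V.sweedler_nested_left_bilinear[OF T tri]] x])
      (rule sweedler_inc[OF T trilinear_bilinear(3)[OF tri inc_closed]])
  also have "\<dots> = sweedler K C W (\<lambda>a b. sweedler K C W (\<lambda>c d. p (inc i a) (inc i c) (inc i d)) b) x"
    by (rule C.sweedler_coassoc[OF T trilinear_inc[OF tri] x])
  also have "\<dots> = sweedler K C W (\<lambda>a b. sweedler K V W (\<lambda>c d. p (inc i a) c d) (inc i b)) x"
    by (rule C.sweedler_cong[OF T bilinear_inc[OF V.sweedler_nested_right_bilinear[OF T tri]] x, symmetric])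
      (rule sweedler_inc[OF T trilinear_bilinear(1)[OF tri inc_closed]])
  also have "\<dots> = sweedler K V W (\<lambda>a b. sweedler K V W (\<lambda>c d. p a c d) b) (inc i x)"
    by (rule sweedler_inc[OF T V.sweedler_nested_right_bilinear[OF T tri] x, symmetric])
  finally show ?thesis .
qed

lemma counit_V_closed: "x \<in> carrier V \<Longrightarrow> counit V x \<in> carrier K"
  using linear_closed[OF counit_V_linear] by simp

lemma counit_V_bilinear:
  "(\<lambda>a b. counit V a \<odot>\<^bsub>V\<^esub> b) \<in> bilinear_maps K V V V"
  by (intro bilinearI linear_smult_const linear_smult_vec linear_id counit_V_linear V.module_axioms
      counit_V_closed; assumption)

lemma counit_left_inc:
  assumes x: "x \<in> carrier C"
  shows "sweedler K V V (\<lambda>a b. counit V a \<odot>\<^bsub>V\<^esub> b) (inc i x) = inc i x"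
proof -
  note l = counit_V_bilinear
  have "sweedler K V V (\<lambda>a b. counit V a \<odot>\<^bsub>V\<^esub> b) (inc i x) =
      sweedler K C V (\<lambda>a b. counit V (inc i a) \<odot>\<^bsub>V\<^esub> inc i b) x"
    by (rule sweedler_inc[OF V.module_axioms l x])
  also have "\<dots> = sweedler K C V (\<lambda>a b. counit C a \<odot>\<^bsub>V\<^esub> inc i b) x"
    by (rule C.sweedler_cong[OF V.module_axioms bilinear_inc[OF l] x]) (simp add: counit_inc)
  also have "\<dots> = inc i x" by (rule C.sweedler_counit_left[OF V.module_axioms inc_linear x])
  finally show ?thesis .
qed

lemma counit_right_from_left:
  assumes "cocommutative K V" "x \<in> carrier V" "sweedler K V V (\<lambda>a b. counit V a \<odot>\<^bsub>V\<^esub> b) x = x"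
  shows "sweedler K V V (\<lambda>a b. counit V b \<odot>\<^bsub>V\<^esub> a) x = x"
  using V.sweedler_commute[OF assms(1) V.module_axioms counit_V_bilinear assms(2)] assms(3) by simp

lemma swap_inc:
  assumes x: "x \<in> carrier C"
  shows "tensor_swap K V V (comult V (inc i x)) = comult V (inc i x)"
proof -
  note T = V.module_CC and p = V.CC.pure_bilinear
  have "sweedler K V (tensor K V V) (\<lambda>a b. pure_tensor K V V b a) (inc i x) =
      sweedler K C (tensor K V V) (\<lambda>a b. pure_tensor K V V (inc i b) (inc i a)) x"
    by (rule sweedler_inc[OF T bilinear_flip[OF p] x])
  also have "\<dots> = sweedler K C (tensor K V V) (\<lambda>a b. pure_tensor K V V (inc i a) (inc i b)) x"
    by (rule C.sweedler_commute[OF C.cocommutative T bilinear_inc[OF p] x])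
  also have "\<dots> = comult V (inc i x)"
    by (simp add: comult_inc[OF x] tensor_map_eq_lift)
  finally show ?thesis by (simp add: tensor_swap_def)
qed

end

text \<open>Every coalgebra law is an equation between linear maps on \<open>V\<close>, so it
  follows from its validity on a spanning set.\<close>

locale spanning_family = intertwining_family +
  assumes span_inc: "submodule_span K V (\<Union>i. inc i ` carrier C) = carrier V"
begin

lemma inc_ext:
  assumes "module K W" "f \<in> linear_maps K V W" "g \<in> linear_maps K V W"
    and "\<And>i x. x \<in> carrier C \<Longrightarrow> f (inc i x) = g (inc i x)" and "x \<in> carrier V"
  shows "f x = g x"
  by (rule linear_ext[OF V.module_axioms assms(1-3) span_inc _ assms(5)]) (use assms(4) in auto)

sublocale V: cocommutative_coalgebra K V
proof unfold_locales
  let ?T = "tensor K V (tensor K V V)"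
  interpret R: tensor_product K V "tensor K V V" by (rule tensor_productI[OF V.module_axioms V.module_CC])
  note T = R.module_tensor and tri = V.pure_trilinear
  note TT = V.module_CC and p = V.CC.pure_bilinear
  note Vm = V.module_axioms
  show "comult V \<in> linear_maps K V (tensor K V V)" by (rule V.comult_linear)
  show "counit V \<in> linear_maps K V (self_module K)" by (rule counit_V_linear)
  show co: "cocommutative K V"
    unfolding cocommutative_def tensor_swap_def
    by (rule ballI) (rule inc_ext[OF TT V.sweedler_linear[OF TT bilinear_flip[OF p]] V.comult_linear
          swap_inc[unfolded tensor_swap_def]])
  fix x assume x: "x \<in> carrier V"
  show "tensor_assoc K V V V (tensor_map K (tensor K V V) V (comult V) id (comult V x)) =
      tensor_map K V (tensor K V V) id (comult V) (comult V x)"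
    unfolding V.assoc_comult_left[OF x] V.assoc_comult_right[OF x]
    by (rule inc_ext[OF T V.sweedler_linear[OF T V.sweedler_nested_left_bilinear[OF T tri]]
          V.sweedler_linear[OF T V.sweedler_nested_right_bilinear[OF T tri]] coassoc_inc[OF T tri] x])
  show l: "tensor_lift K V (\<lambda>a b. counit V a \<odot>\<^bsub>V\<^esub> b) (comult V x) = x"
    by (rule inc_ext[OF Vm V.sweedler_linear[OF Vm counit_V_bilinear] linear_id counit_left_inc x])
  show "tensor_lift K V (\<lambda>a b. counit V b \<odot>\<^bsub>V\<^esub> a) (comult V x) = x"
    by (rule counit_right_from_left[OF co x l])
qed

end

section \<open>The coalgebra V of Takeuchi's construction and its shift\<close>

lemma comult_co_opposite: "comult (co_opposite K C) x = tensor_swap K C C (comult C x)"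
  by (simp add: co_opposite_def)

locale takeuchi = cocommutative_coalgebra
begin

abbreviation "Cop i \<equiv> (co_opposite K ^^ i) C"
abbreviation "TV \<equiv> takeuchi_coalgebra K C"

lemma Cop_simps:
  "carrier (Cop i) = carrier C" "add (Cop i) = add C" "zero (Cop i) = zero C" "smult (Cop i) = smult C"
  "mult (Cop i) = mult C" "one (Cop i) = one C" "counit (Cop i) = counit C"
  by (induction i) (simp_all add: co_opposite_def)

lemma module_Cop: "module K (Cop i)"
  by (rule module_surj[OF module_axioms, of _ "\<lambda>x. x"]) (simp_all add: Cop_simps)

text \<open>Cocommutativity makes \<open>co_opposite\<close> invisible, so all summands of V carry
  the comultiplication of C itself.\<close>

lemma comult_Cop: "x \<in> carrier C \<Longrightarrow> comult (Cop i) x = comult C x"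
proof (induction i)
  case (Suc i)
  have "tensor_swap K (Cop i) (Cop i) = tensor_swap K C C"
    by (simp add: tensor_swap_def fun_eq_iff tensor_cong[of "Cop i" C "Cop i" C] Cop_simps)
  with Suc show ?case using cocommutative by (simp add: comult_co_opposite cocommutative_def)
qed simp

lemma finsum_self_module: "finsum (self_module K) = finsum K"
  by (simp add: fun_eq_iff finsum_def finprod_def)

lemma takeuchi_coalgebra_simps:
  "carrier TV = carrier (direct_sum Cop)" "add TV = add (direct_sum Cop)" "zero TV = zero (direct_sum Cop)"
  "smult TV = smult (direct_sum Cop)" "mult TV = mult (direct_sum Cop)" "one TV = one (direct_sum Cop)"
  "counit TV x = direct_sum_lift Cop (self_module K) (\<lambda>_. counit C) x"
  by (simp_all add: takeuchi_coalgebra_def direct_sum_coalgebra_def Let_def module.defs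
      coalg.defs direct_sum_lift_def Cop_simps finsum_self_module)

abbreviation "Vinc \<equiv> direct_sum_inc Cop"

text \<open>The definition forms tensors over the bare module \<open>direct_sum Cop\<close>, before
  the coalgebra fields are attached. \<open>tensor_cong\<close> replaces it by \<open>TV\<close> and
  exposes the comultiplication as a lift.\<close>

lemma comult_takeuchi:
  "comult TV x = direct_sum_lift Cop (tensor K TV TV) (\<lambda>i c. tensor_map K TV TV (Vinc i) (Vinc i) (comult (Cop i) c)) x"
proof -
  note s = takeuchi_coalgebra_simps
  have t: "tensor K TV TV = tensor K (direct_sum Cop) (direct_sum Cop)"
    by (rule tensor_cong; simp add: s)
  have m: "tensor_map K TV TV f g = tensor_map K (direct_sum Cop) (direct_sum Cop) f g"
    for f g :: "'c \<Rightarrow> nat \<Rightarrow> 'c"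
    by (rule fun_cong[OF fun_cong[OF tensor_map_cong]]; simp add: s)
  show ?thesis
    unfolding t m
    by (simp add: takeuchi_coalgebra_def direct_sum_coalgebra_def Let_def module.defs
      coalg.defs direct_sum_lift_def)
qed

lemma linear_maps_takeuchi:
  "linear_maps K TV W = linear_maps K (direct_sum Cop) W"
  "linear_maps K W' TV = linear_maps K W' (direct_sum Cop)"
  "linear_maps K (Cop i) W = linear_maps K C W"
  by (simp_all add: linear_maps_def takeuchi_coalgebra_simps Cop_simps)

lemma module_takeuchi: "module K TV"
  by (rule module_surj[OF module_direct_sum[of K Cop, OF module_Cop], of _ "\<lambda>x. x"])
    (simp_all add: takeuchi_coalgebra_simps)

lemma Vinc_linear: "Vinc i \<in> linear_maps K C TV"
  using direct_sum_inc_linear[of K Cop i, OF module_Cop] by (simp add: linear_maps_takeuchi)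

lemma Vlift_linear:
  assumes "module K W" "\<And>i. h i \<in> linear_maps K C W"
  shows "direct_sum_lift Cop W h \<in> linear_maps K TV W"
  using direct_sum_lift_linear[of K Cop W h, OF module_Cop] assms by (simp add: linear_maps_takeuchi)

lemma Vlift_inc:
  assumes "module K W" "\<And>i. h i \<in> linear_maps K C W" "x \<in> carrier C"
  shows "direct_sum_lift Cop W h (Vinc i x) = h i x"
  using direct_sum_lift_inc[of K Cop W h x i, OF module_Cop] assms
  by (simp add: linear_maps_takeuchi Cop_simps)

text \<open>Everything known about V is now inherited from C through the inclusions; in particular V
  is a cocommutative coalgebra.\<close>

sublocale V: spanning_family K C TV Vinc
proof -
  interpret VV: tensor_product K TV TV by (rule tensor_productI[OF module_takeuchi module_takeuchi])
  have h: "(\<lambda>c. tensor_map K TV TV (Vinc i) (Vinc i) (comult (Cop i) c)) \<in> linear_maps K C (tensor K TV TV)" for i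
    by (rule linear_cong[OF linear_comp[OF tensor_map_linear[OF module_axioms module_axioms module_takeuchi
            module_takeuchi Vinc_linear Vinc_linear] comult_linear] module_axioms]) (simp add: comult_Cop)
  have "comult TV \<in> linear_maps K TV (tensor K TV TV)"
    unfolding comult_takeuchi[abs_def] using Vlift_linear[OF VV.module_tensor h] by (simp add: eta_contract_eq)
  moreover have "counit TV \<in> linear_maps K TV (self_module K)"
    using Vlift_linear[of "self_module K" "\<lambda>_. counit C"] counit_linear
      assoc_algebra_module[OF assoc_algebra_self[OF R.is_cring]]
    by (simp add: takeuchi_coalgebra_simps(7)[abs_def])
  moreover have "submodule_span K TV (\<Union>i. Vinc i ` carrier C) = carrier TV"
    using span_image[OF module_direct_sum[of K Cop, OF module_Cop] module_takeuchi _ _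
        span_direct_sum[of K Cop, OF module_Cop], of "\<lambda>x. x"] linear_id[of K "direct_sum Cop"]
    by (simp add: linear_maps_takeuchi takeuchi_coalgebra_simps(1) Cop_simps)
  ultimately show "spanning_family K C TV Vinc"
    using module_takeuchi Vinc_linear Vlift_inc[OF VV.module_tensor h] counit_linear
      Vlift_inc[of "self_module K" "\<lambda>_. counit C"]
      assoc_algebra_module[OF assoc_algebra_self[OF R.is_cring]]
    by unfold_locales (auto simp: comult_takeuchi comult_Cop takeuchi_coalgebra_simps(7))
qed

abbreviation "shift \<equiv> takeuchi_shift C"

lemma shift_inc: "shift (Vinc i x) = Vinc (Suc i) x"
  by (auto simp: takeuchi_shift_def direct_sum_inc_def fun_eq_iff Cop_simps split: nat.splits)

lemma shift_linear: "shift \<in> linear_maps K TV TV"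
  unfolding linear_maps_takeuchi
proof (rule linear_mapsI)
  fix x assume x: "x \<in> carrier (direct_sum Cop)"
  note d = direct_sum_carrierD[of K Cop, OF module_Cop x]
  show "shift x \<in> carrier (direct_sum Cop)"
    by (rule direct_sum_carrierI[of K Cop, OF module_Cop, of _ "Suc ` {i. x i \<noteq> \<zero>\<^bsub>Cop i\<^esub>}"])
      (use d in \<open>auto simp: takeuchi_shift_def Cop_simps image_iff split: nat.splits\<close>)
qed (auto simp: takeuchi_shift_def direct_sum_simps Cop_simps fun_eq_iff split: nat.splits)

text \<open>The shift carries one copy of C to the next, and both copies have the same
  comultiplication. A map that would in general reverse coproducts is therefore a coalgebra map
  here.\<close>

lemma sweedler_shift:
  assumes W: "module K W" and f: "f \<in> bilinear_maps K TV TV W" and x: "x \<in> carrier TV"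
  shows "sweedler K TV W f (shift x) = sweedler K TV W (\<lambda>a b. f (shift a) (shift b)) x"
proof (rule V.inc_ext[OF W linear_comp[OF V.V.sweedler_linear[OF W f] shift_linear] _ _ x])
  note fs = bilinear_comp[OF f shift_linear shift_linear]
  show "sweedler K TV W (\<lambda>a b. f (shift a) (shift b)) \<in> linear_maps K TV W"
    by (rule V.V.sweedler_linear[OF W fs])
  fix i x assume x: "x \<in> carrier C"
  show "sweedler K TV W f (shift (Vinc i x)) = sweedler K TV W (\<lambda>a b. f (shift a) (shift b)) (Vinc i x)"
    by (simp add: shift_inc V.sweedler_inc[OF W f x] V.sweedler_inc[OF W fs x])
qed

lemma counit_shift:
  assumes x: "x \<in> carrier TV"
  shows "counit TV (shift x) = counit TV x"
  by (rule V.inc_ext[OF _ linear_comp[OF V.counit_V_linear shift_linear] V.counit_V_linear _ x])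
    (simp_all add: shift_inc V.counit_inc assoc_algebra_module[OF assoc_algebra_self[OF R.is_cring]])

end

section \<open>Hopf algebras generated by a coalgebra\<close>

text \<open>Two independent Sweedler sums may be interchanged. Both sides are linear in
  \<open>t\<close>, and for a pure tensor \<open>t\<close> one of the sums disappears.\<close>

lemma tensor_lift_commute:
  assumes MN: "module K M" "module K N" and MN': "module K M'" "module K N'" and W: "module K W"
    and t: "t \<in> carrier (tensor K M N)" and s: "s \<in> carrier (tensor K M' N')"
    and f1: "\<And>c d. \<lbrakk>c \<in> carrier M'; d \<in> carrier N'\<rbrakk> \<Longrightarrow> (\<lambda>a b. f a b c d) \<in> bilinear_maps K M N W"
    and f2: "\<And>a b. \<lbrakk>a \<in> carrier M; b \<in> carrier N\<rbrakk> \<Longrightarrow> (\<lambda>c d. f a b c d) \<in> bilinear_maps K M' N' W"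
  shows "tensor_lift K W (\<lambda>a b. tensor_lift K W (\<lambda>c d. f a b c d) s) t =
    tensor_lift K W (\<lambda>c d. tensor_lift K W (\<lambda>a b. f a b c d) t) s"
proof -
  interpret X: tensor_product K M N by (rule tensor_productI[OF MN])
  interpret Y: tensor_product K M' N' by (rule tensor_productI[OF MN'])
  have b1: "(\<lambda>a b. tensor_lift K W (\<lambda>c d. f a b c d) s) \<in> bilinear_maps K M N W"
  proof (rule bilinearI)
    show "(\<lambda>b. tensor_lift K W (\<lambda>c d. f a b c d) s) \<in> linear_maps K N W" if "a \<in> carrier M" for a
      by (rule Y.tensor_lift_param_linear[OF MN(2) W f2[OF that] bilinear_right[OF f1 that] s])
    show "(\<lambda>a. tensor_lift K W (\<lambda>c d. f a b c d) s) \<in> linear_maps K M W" if "b \<in> carrier N" for b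
      by (rule Y.tensor_lift_param_linear[OF MN(1) W f2[OF _ that] bilinear_left[OF f1 that] s])
  qed
  have b2: "(\<lambda>c d. tensor_lift K W (\<lambda>a b. f a b c d) t) \<in> bilinear_maps K M' N' W"
    if t: "t \<in> carrier (tensor K M N)" for t
  proof (rule bilinearI)
    show "(\<lambda>d. tensor_lift K W (\<lambda>a b. f a b c d) t) \<in> linear_maps K N' W" if "c \<in> carrier M'" for c
      by (rule X.tensor_lift_param_linear[OF MN'(2) W f1[OF that] bilinear_right[OF f2 that] t])
    show "(\<lambda>c. tensor_lift K W (\<lambda>a b. f a b c d) t) \<in> linear_maps K M' W" if "d \<in> carrier N'" for d
      by (rule X.tensor_lift_param_linear[OF MN'(1) W f1[OF _ that] bilinear_left[OF f2 that] t])
  qed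
  have l2: "(\<lambda>t. tensor_lift K W (\<lambda>c d. tensor_lift K W (\<lambda>a b. f a b c d) t) s) \<in> linear_maps K (tensor K M N) W"
    by (rule Y.tensor_lift_param_linear[OF X.module_tensor W b2 X.tensor_lift_linear[OF W f1] s])
  show ?thesis
  proof (rule X.tensor_ext[OF W X.tensor_lift_linear[OF W b1] l2 _ t])
    fix a b assume ab: "a \<in> carrier M" "b \<in> carrier N"
    have p: "pure_tensor K M N a b \<in> carrier (tensor K M N)" by (rule pure_closed[OF MN ab])
    have "tensor_lift K W (\<lambda>c d. tensor_lift K W (\<lambda>a b. f a b c d) (pure_tensor K M N a b)) s =
        tensor_lift K W (\<lambda>c d. f a b c d) s"
      by (rule Y.tensor_lift_cong[OF W b2[OF p] s]) (rule X.tensor_lift_pure[OF W f1 ab])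
    then show "tensor_lift K W (\<lambda>a b. tensor_lift K W (\<lambda>c d. f a b c d) s) (pure_tensor K M N a b) =
        tensor_lift K W (\<lambda>c d. tensor_lift K W (\<lambda>a b. f a b c d) (pure_tensor K M N a b)) s"
      by (simp add: X.tensor_lift_pure[OF W b1 ab])
  qed
qed

lemma tensor_swap_algebra_hom:
  assumes A: "assoc_algebra K A" and B: "assoc_algebra K B"
  shows "tensor_swap K A B \<in> algebra_hom K (tensor K A B) (tensor K B A)"
proof -
  interpret AB: algebra_tensor_product K A B by (rule algebra_tensor_product.intro[OF A B])
  interpret BA: algebra_tensor_product K B A by (rule algebra_tensor_product.intro[OF B A])
  show ?thesis
    unfolding tensor_swap_def
    by (rule AB.tensor_lift_algebra_hom[OF BA.assoc_algebra_tensor bilinear_flip[OF BA.pure_bilinear]])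
      (simp_all add: BA.pure_mult BA.tensor_one)
qed

text \<open>Needed to turn coassociativity into an equation between algebra maps, which can be
  tested on generators. The reassociation is a lift inside a lift, so its multiplicativity comes
  from \<open>tensor_lift_mult\<close>.\<close>

lemma tensor_assoc_algebra_hom:
  assumes A: "assoc_algebra K A" and B: "assoc_algebra K B" and C: "assoc_algebra K C"
  shows "tensor_assoc K A B C \<in> algebra_hom K (tensor K (tensor K A B) C) (tensor K A (tensor K B C))"
proof -
  interpret AB: algebra_tensor_product K A B by (rule algebra_tensor_product.intro[OF A B])
  interpret BC: algebra_tensor_product K B C by (rule algebra_tensor_product.intro[OF B C])
  interpret L: algebra_tensor_product K "tensor K A B" C
    by (rule algebra_tensor_product.intro[OF AB.assoc_algebra_tensor C])
  interpret R: algebra_tensor_product K A "tensor K B C"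
    by (rule algebra_tensor_product.intro[OF A BC.assoc_algebra_tensor])
  let ?T = "tensor K A (tensor K B C)"
  let ?p = "\<lambda>a b c. pure_tensor K A (tensor K B C) a (pure_tensor K B C b c)"
  note Ta = R.assoc_algebra_tensor
  note T = R.module_tensor
  interpret T: assoc_algebra K ?T by (rule Ta)
  have pc: "?p a b c \<in> carrier ?T" if "a \<in> carrier A" "b \<in> carrier B" "c \<in> carrier C" for a b c
    using that by (intro pure_closed AB.M.module_axioms AB.N.module_axioms BC.N.module_axioms BC.module_tensor)
  have bi: "(\<lambda>a b. ?p a b c) \<in> bilinear_maps K A B ?T" if "c \<in> carrier C" for c
    using that by (intro bilinearI linear_pure_left linear_pure_right linear_id pure_closed
        AB.M.module_axioms AB.N.module_axioms BC.N.module_axioms BC.module_tensor)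
  have lc: "(\<lambda>c. ?p a b c) \<in> linear_maps K C ?T" if "a \<in> carrier A" "b \<in> carrier B" for a b
    using that by (intro linear_pure_right linear_id
        AB.M.module_axioms AB.N.module_axioms BC.N.module_axioms BC.module_tensor)
  let ?f = "\<lambda>t c. tensor_lift K ?T (\<lambda>a b. ?p a b c) t"
  have f: "?f \<in> bilinear_maps K (tensor K A B) C ?T"
    by (rule bilinearI)
      (rule AB.tensor_lift_param_linear[OF BC.N.module_axioms T bi lc] AB.tensor_lift_linear[OF T bi]; assumption)+
  show ?thesis
    unfolding tensor_assoc_def Let_def
  proof (rule L.tensor_lift_algebra_hom[OF Ta f])
    show "?f \<one>\<^bsub>tensor K A B\<^esub> \<one>\<^bsub>C\<^esub> = \<one>\<^bsub>?T\<^esub>"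
      by (simp add: AB.tensor_one AB.tensor_lift_pure[OF T bi] R.tensor_one BC.tensor_one)
    fix t c s d assume *: "t \<in> carrier (tensor K A B)" "c \<in> carrier C" "s \<in> carrier (tensor K A B)" "d \<in> carrier C"
    have cd: "c \<otimes>\<^bsub>C\<^esub> d \<in> carrier C" using * by simp
    have fc: "?f s d \<in> carrier ?T" "?f t c \<in> carrier ?T" using bilinear_closed[OF f] * by auto
    \<comment> \<open>For fixed \<open>a\<close> and \<open>b\<close> the product of pure tensors
      splits off a factor that does not depend on the summation over \<open>s\<close>.\<close>
    have inner: "tensor_lift K ?T (\<lambda>a' b'. ?p (a \<otimes>\<^bsub>A\<^esub> a') (b \<otimes>\<^bsub>B\<^esub> b') (c \<otimes>\<^bsub>C\<^esub> d)) s = ?p a b c \<otimes>\<^bsub>?T\<^esub> ?f s d"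
      if ab: "a \<in> carrier A" "b \<in> carrier B" for a b
    proof -
      note lm = linear_mult_left[OF Ta pc[OF ab *(2)] linear_id]
      have "?p a b c \<otimes>\<^bsub>?T\<^esub> ?f s d = tensor_lift K ?T (\<lambda>a' b'. ?p a b c \<otimes>\<^bsub>?T\<^esub> ?p a' b' d) s"
        by (rule AB.tensor_lift_comp[OF T T bi[OF *(4)] lm *(3)])
      also have "\<dots> = tensor_lift K ?T (\<lambda>a' b'. ?p (a \<otimes>\<^bsub>A\<^esub> a') (b \<otimes>\<^bsub>B\<^esub> b') (c \<otimes>\<^bsub>C\<^esub> d)) s"
        by (rule AB.tensor_lift_cong[OF T bilinear_comp_linear[OF bi[OF *(4)] lm] *(3)])
          (use ab * in \<open>simp add: R.pure_mult BC.pure_mult pure_closed BC.module_tensor AB.N.module_axioms BC.N.module_axioms\<close>)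
      finally show ?thesis by simp
    qed
    note rm = linear_mult_right[OF Ta fc(1) linear_id]
    have "?f (t \<otimes>\<^bsub>tensor K A B\<^esub> s) (c \<otimes>\<^bsub>C\<^esub> d) =
      tensor_lift K ?T (\<lambda>a b. tensor_lift K ?T (\<lambda>a' b'. ?p (a \<otimes>\<^bsub>A\<^esub> a') (b \<otimes>\<^bsub>B\<^esub> b') (c \<otimes>\<^bsub>C\<^esub> d)) s) t"
      by (rule AB.tensor_lift_mult[OF T bi[OF cd] *(1,3)])
    also have "\<dots> = tensor_lift K ?T (\<lambda>a b. ?p a b c \<otimes>\<^bsub>?T\<^esub> ?f s d) t"
      by (rule AB.tensor_lift_cong[OF T bilinear_comp_linear[OF bi[OF *(2)] rm] *(1), symmetric])
        (rule inner[symmetric])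
    also have "\<dots> = ?f t c \<otimes>\<^bsub>?T\<^esub> ?f s d"
      by (rule AB.tensor_lift_comp[OF T T bi[OF *(2)] rm *(1), symmetric])
    finally show "?f (t \<otimes>\<^bsub>tensor K A B\<^esub> s) (c \<otimes>\<^bsub>C\<^esub> d) = ?f t c \<otimes>\<^bsub>?T\<^esub> ?f s d" .
  qed
qed

lemma id_algebra_hom: "id \<in> algebra_hom K A A"
  by (rule algebra_homI) (use linear_id in \<open>simp_all add: id_def\<close>)

text \<open>Records what the construction of F(C) delivers: structure maps that are multiplicative,
  or antimultiplicative for the antipode, with prescribed values on a generating coalgebra
  \<open>V\<close>. The map \<open>\<sigma>\<close> lifts the antipode to \<open>V\<close>; the
  inverse conditions are Takeuchi's relations, valid in \<open>H\<close>.\<close>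

locale generated_hopf =
  V: cocommutative_coalgebra K V + H: assoc_algebra K H
  for K :: "('k, 'r) ring_scheme" and V :: "('k, 'v, 'm) coalg_scheme"
    and H :: "('k, 'h, 'n) hopf_scheme" +
  fixes \<sigma> :: "'v \<Rightarrow> 'v" and j :: "'v \<Rightarrow> 'h"
  assumes j_linear: "j \<in> linear_maps K V H"
    and comult_hom: "comult H \<in> algebra_hom K H (tensor K H H)"
    and comult_j: "x \<in> carrier V \<Longrightarrow> comult H (j x) = tensor_map K H H j j (comult V x)"
    and counit_hom: "counit H \<in> algebra_hom K H (self_module K)"
    and counit_j: "x \<in> carrier V \<Longrightarrow> counit H (j x) = counit V x"
    and antipode_hom: "antipode H \<in> algebra_hom K H (opposite H)"
    and antipode_j: "x \<in> carrier V \<Longrightarrow> antipode H (j x) = j (\<sigma> x)"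
    and inverse_right: "x \<in> carrier V \<Longrightarrow>
      sweedler K V H (\<lambda>a b. j a \<otimes>\<^bsub>H\<^esub> j (\<sigma> b)) x = counit V x \<odot>\<^bsub>H\<^esub> \<one>\<^bsub>H\<^esub>"
    and inverse_left: "x \<in> carrier V \<Longrightarrow>
      sweedler K V H (\<lambda>a b. j (\<sigma> a) \<otimes>\<^bsub>H\<^esub> j b) x = counit V x \<odot>\<^bsub>H\<^esub> \<one>\<^bsub>H\<^esub>"
    and generated: "\<lbrakk>submodule N K H; \<one>\<^bsub>H\<^esub> \<in> N; \<And>x t. \<lbrakk>x \<in> carrier V; t \<in> N\<rbrakk> \<Longrightarrow> j x \<otimes>\<^bsub>H\<^esub> t \<in> N\<rbrakk>
      \<Longrightarrow> carrier H \<subseteq> N"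
begin

sublocale j: intertwining_family K V H "\<lambda>_::unit. j"
  by unfold_locales
    (simp_all add: j_linear algebra_hom_linear[OF comult_hom] algebra_hom_linear[OF counit_hom] comult_j counit_j)

lemma j_closed: "x \<in> carrier V \<Longrightarrow> j x \<in> carrier H"
  by (rule linear_closed[OF j_linear])

text \<open>The equaliser is a submodule containing the unit and closed under left multiplication by
  \<open>j x\<close>, so \<open>generated\<close> applies.\<close>

lemma algebra_hom_ext:
  assumes A: "assoc_algebra K A" and f: "f \<in> algebra_hom K H A" and g: "g \<in> algebra_hom K H A"
    and eq: "\<And>x. x \<in> carrier V \<Longrightarrow> f (j x) = g (j x)" and h: "h \<in> carrier H"
  shows "f h = g h"
proof -
  have "carrier H \<subseteq> {h \<in> carrier H. f h = g h}"
    by (rule generated[OF submodule_equalizer[OF H.module_axioms assoc_algebra_module[OF A]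
            algebra_hom_linear[OF f] algebra_hom_linear[OF g]]])
      (auto simp: algebra_hom_one[OF f] algebra_hom_one[OF g] algebra_hom_mult[OF f] algebra_hom_mult[OF g]
        eq j_closed)
  then show ?thesis using h by auto
qed

sublocale HH: algebra_tensor_product K H H
  by (rule algebra_tensor_product.intro) (rule H.assoc_algebra_axioms)+

lemma coassoc_H:
  assumes x: "x \<in> carrier H"
  shows "tensor_assoc K H H H (tensor_map K (tensor K H H) H (comult H) id (comult H x)) =
      tensor_map K H (tensor K H H) id (comult H) (comult H x)"
proof -
  let ?T = "tensor K H (tensor K H H)"
  note Ha = H.assoc_algebra_axioms and HHa = HH.assoc_algebra_tensor
  interpret L: algebra_tensor_product K "tensor K H H" H by (rule algebra_tensor_product.intro[OF HHa Ha])
  interpret R: algebra_tensor_product K H "tensor K H H" by (rule algebra_tensor_product.intro[OF Ha HHa])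
  note T = R.module_tensor and tri = j.V.pure_trilinear
  show ?thesis
  proof (rule algebra_hom_ext[OF R.assoc_algebra_tensor _ _ _ x])
    show "(\<lambda>x. tensor_assoc K H H H (tensor_map K (tensor K H H) H (comult H) id (comult H x))) \<in> algebra_hom K H ?T"
      by (rule algebra_hom_comp[OF tensor_assoc_algebra_hom[OF Ha Ha Ha]
            algebra_hom_comp[OF tensor_map_algebra_hom[OF Ha Ha HHa Ha comult_hom id_algebra_hom] comult_hom]])
    show "(\<lambda>x. tensor_map K H (tensor K H H) id (comult H) (comult H x)) \<in> algebra_hom K H ?T"
      by (rule algebra_hom_comp[OF tensor_map_algebra_hom[OF Ha Ha Ha HHa id_algebra_hom comult_hom] comult_hom])
    fix x assume x: "x \<in> carrier V"
    show "tensor_assoc K H H H (tensor_map K (tensor K H H) H (comult H) id (comult H (j x))) =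
      tensor_map K H (tensor K H H) id (comult H) (comult H (j x))"
      unfolding j.V.assoc_comult_left[OF j_closed[OF x]] j.V.assoc_comult_right[OF j_closed[OF x]]
      by (rule j.coassoc_inc[OF T tri x])
  qed
qed

lemma cocommutative_H: "cocommutative K H"
  unfolding cocommutative_def
  by (rule ballI) (rule algebra_hom_ext[OF HH.assoc_algebra_tensor
        algebra_hom_comp[OF tensor_swap_algebra_hom[OF H.assoc_algebra_axioms H.assoc_algebra_axioms] comult_hom]
        comult_hom j.swap_inc])

text \<open>As the counit is multiplicative and scalars are central, (a, b) \<mapsto> \<epsilon>(a)
  b induces an algebra map, which makes the left law testable on V. The right law then comes from
  cocommutativity.\<close>

lemma counit_H:
  assumes x: "x \<in> carrier H"
  shows "tensor_lift K H (\<lambda>a b. counit H a \<odot>\<^bsub>H\<^esub> b) (comult H x) = x"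
    and "tensor_lift K H (\<lambda>a b. counit H b \<odot>\<^bsub>H\<^esub> a) (comult H x) = x"
proof -
  note Ha = H.assoc_algebra_axioms
  have id: "(\<lambda>x. x) \<in> algebra_hom K H H" using id_algebra_hom[of K H] by (simp add: id_def)
  have em: "counit H (a \<otimes>\<^bsub>H\<^esub> c) = counit H a \<otimes>\<^bsub>K\<^esub> counit H c" if "a \<in> carrier H" "c \<in> carrier H" for a c
    using algebra_hom_mult[OF counit_hom that] by simp
  have e1: "counit H \<one>\<^bsub>H\<^esub> = \<one>\<^bsub>K\<^esub>" using algebra_hom_one[OF counit_hom] by simp
  note s = em e1 j.counit_V_closed H.smult_mult_left H.smult_mult_right H.smult_assoc1[symmetric] V.R.m_comm
  have "tensor_lift K H (\<lambda>a b. counit H a \<odot>\<^bsub>H\<^esub> b) \<in> algebra_hom K (tensor K H H) H"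
    by (rule HH.tensor_lift_algebra_hom[OF Ha j.counit_V_bilinear]) (simp_all add: s)
  then show l: "tensor_lift K H (\<lambda>a b. counit H a \<odot>\<^bsub>H\<^esub> b) (comult H x) = x"
    by (rule algebra_hom_ext[OF Ha algebra_hom_comp[OF _ comult_hom] id j.counit_left_inc x])
  show "tensor_lift K H (\<lambda>a b. counit H b \<odot>\<^bsub>H\<^esub> a) (comult H x) = x"
    by (rule j.counit_right_from_left[OF cocommutative_H x l])
qed

lemma antipode_linear_H: "antipode H \<in> linear_maps K H H"
  using algebra_hom_linear[OF antipode_hom] by (simp add: linear_maps_def)

lemma antipode_closed: "x \<in> carrier H \<Longrightarrow> antipode H x \<in> carrier H"
  by (rule linear_closed[OF antipode_linear_H])

lemma antipode_mult:
  "\<lbrakk>x \<in> carrier H; y \<in> carrier H\<rbrakk> \<Longrightarrow> antipode H (x \<otimes>\<^bsub>H\<^esub> y) = antipode H y \<otimes>\<^bsub>H\<^esub> antipode H x"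
  using algebra_hom_mult[OF antipode_hom] by simp

lemma antipode_one: "antipode H \<one>\<^bsub>H\<^esub> = \<one>\<^bsub>H\<^esub>"
  using algebra_hom_one[OF antipode_hom] by simp

lemma right_bilinear: "(\<lambda>a b. a \<otimes>\<^bsub>H\<^esub> antipode H b) \<in> bilinear_maps K H H H"
  and left_bilinear: "(\<lambda>a b. antipode H a \<otimes>\<^bsub>H\<^esub> b) \<in> bilinear_maps K H H H"
  by (rule bilinear_comp[OF bilinear_mult[OF H.assoc_algebra_axioms] linear_id antipode_linear_H]
      bilinear_comp[OF bilinear_mult[OF H.assoc_algebra_axioms] antipode_linear_H linear_id])+

lemma counit_mult_smult:
  assumes "x \<in> carrier H" "t \<in> carrier H"
  shows "counit H (x \<otimes>\<^bsub>H\<^esub> t) \<odot>\<^bsub>H\<^esub> \<one>\<^bsub>H\<^esub> = counit H t \<odot>\<^bsub>H\<^esub> (counit H x \<odot>\<^bsub>H\<^esub> \<one>\<^bsub>H\<^esub>)"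
  using assms algebra_hom_mult[OF counit_hom assms]
  by (simp add: j.counit_V_closed H.smult_assoc1[symmetric] V.R.m_comm)

text \<open>\<Sum> \<open>x\<^sub>1\<close> \<open>t\<^sub>1\<close> S(\<open>t\<^sub>2\<close>)
  S(\<open>x\<^sub>2\<close>) collapses from the inside: the law for \<open>t\<close> produces the
  scalar \<epsilon>(t), and the law for \<open>x\<close> finishes.\<close>

lemma antipode_right_mult:
  assumes x: "x \<in> carrier H" and t: "t \<in> carrier H"
    and Rx: "sweedler K H H (\<lambda>a b. a \<otimes>\<^bsub>H\<^esub> antipode H b) x = counit H x \<odot>\<^bsub>H\<^esub> \<one>\<^bsub>H\<^esub>"
    and Rt: "sweedler K H H (\<lambda>a b. a \<otimes>\<^bsub>H\<^esub> antipode H b) t = counit H t \<odot>\<^bsub>H\<^esub> \<one>\<^bsub>H\<^esub>"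
  shows "sweedler K H H (\<lambda>a b. a \<otimes>\<^bsub>H\<^esub> antipode H b) (x \<otimes>\<^bsub>H\<^esub> t) = counit H (x \<otimes>\<^bsub>H\<^esub> t) \<odot>\<^bsub>H\<^esub> \<one>\<^bsub>H\<^esub>"
proof -
  note Hm = H.module_axioms and Ha = H.assoc_algebra_axioms
  note cl = antipode_closed j.counit_V_closed
  have "sweedler K H H (\<lambda>a b. a \<otimes>\<^bsub>H\<^esub> antipode H b) (x \<otimes>\<^bsub>H\<^esub> t) =
    sweedler K H H (\<lambda>a b. sweedler K H H (\<lambda>c d. (a \<otimes>\<^bsub>H\<^esub> c) \<otimes>\<^bsub>H\<^esub> antipode H (b \<otimes>\<^bsub>H\<^esub> d)) t) x"
    unfolding algebra_hom_mult[OF comult_hom x t]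
    by (rule HH.tensor_lift_mult[OF Hm right_bilinear j.V.comult_closed[OF x] j.V.comult_closed[OF t]])
  also have "\<dots> = sweedler K H H (\<lambda>a b. counit H t \<odot>\<^bsub>H\<^esub> (a \<otimes>\<^bsub>H\<^esub> antipode H b)) x"
  proof (rule j.V.sweedler_cong[OF Hm _ x, symmetric])
    show "(\<lambda>a b. counit H t \<odot>\<^bsub>H\<^esub> (a \<otimes>\<^bsub>H\<^esub> antipode H b)) \<in> bilinear_maps K H H H"
      by (rule bilinear_comp_linear[OF right_bilinear linear_smult_const[OF Hm cl(2)[OF t] linear_id]])
    fix a b assume ab: "a \<in> carrier H" "b \<in> carrier H"
    have l: "(\<lambda>z. a \<otimes>\<^bsub>H\<^esub> z \<otimes>\<^bsub>H\<^esub> antipode H b) \<in> linear_maps K H H"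
      by (rule linear_mult_right[OF Ha cl(1)[OF ab(2)] linear_mult_left[OF Ha ab(1) linear_id]])
    have "counit H t \<odot>\<^bsub>H\<^esub> (a \<otimes>\<^bsub>H\<^esub> antipode H b) = a \<otimes>\<^bsub>H\<^esub> (counit H t \<odot>\<^bsub>H\<^esub> \<one>\<^bsub>H\<^esub>) \<otimes>\<^bsub>H\<^esub> antipode H b"
      using ab t cl by (simp add: H.smult_mult_left H.smult_mult_right)
    also have "\<dots> = sweedler K H H (\<lambda>c d. a \<otimes>\<^bsub>H\<^esub> (c \<otimes>\<^bsub>H\<^esub> antipode H d) \<otimes>\<^bsub>H\<^esub> antipode H b) t"
      unfolding Rt[symmetric] by (rule j.V.sweedler_comp[OF Hm Hm right_bilinear l t])
    also have "\<dots> = sweedler K H H (\<lambda>c d. (a \<otimes>\<^bsub>H\<^esub> c) \<otimes>\<^bsub>H\<^esub> antipode H (b \<otimes>\<^bsub>H\<^esub> d)) t"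
      by (rule j.V.sweedler_cong[OF Hm bilinear_comp_linear[OF right_bilinear l] t])
        (use ab cl in \<open>simp add: antipode_mult H.A.m_assoc\<close>)
    finally show "counit H t \<odot>\<^bsub>H\<^esub> (a \<otimes>\<^bsub>H\<^esub> antipode H b) =
      sweedler K H H (\<lambda>c d. (a \<otimes>\<^bsub>H\<^esub> c) \<otimes>\<^bsub>H\<^esub> antipode H (b \<otimes>\<^bsub>H\<^esub> d)) t" .
  qed
  also have "\<dots> = counit H t \<odot>\<^bsub>H\<^esub> sweedler K H H (\<lambda>a b. a \<otimes>\<^bsub>H\<^esub> antipode H b) x"
    by (rule j.V.sweedler_comp[OF Hm Hm right_bilinear linear_smult_const[OF Hm cl(2)[OF t] linear_id] x, symmetric])
  also have "\<dots> = counit H (x \<otimes>\<^bsub>H\<^esub> t) \<odot>\<^bsub>H\<^esub> \<one>\<^bsub>H\<^esub>"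
    unfolding Rx counit_mult_smult[OF x t] ..
  finally show ?thesis .
qed

text \<open>Here the inner part of \<Sum> S(\<open>t\<^sub>1\<close>) S(\<open>x\<^sub>1\<close>)
  \<open>x\<^sub>2\<close> \<open>t\<^sub>2\<close> belongs to \<open>x\<close>, whereas
  \<open>tensor_lift_mult\<close> puts the sum over \<open>x\<close> outside. Hence the interchange
  of sums before the collapse.\<close>

lemma antipode_left_mult:
  assumes x: "x \<in> carrier H" and t: "t \<in> carrier H"
    and Rx: "sweedler K H H (\<lambda>a b. antipode H a \<otimes>\<^bsub>H\<^esub> b) x = counit H x \<odot>\<^bsub>H\<^esub> \<one>\<^bsub>H\<^esub>"
    and Rt: "sweedler K H H (\<lambda>a b. antipode H a \<otimes>\<^bsub>H\<^esub> b) t = counit H t \<odot>\<^bsub>H\<^esub> \<one>\<^bsub>H\<^esub>"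
  shows "sweedler K H H (\<lambda>a b. antipode H a \<otimes>\<^bsub>H\<^esub> b) (x \<otimes>\<^bsub>H\<^esub> t) = counit H (x \<otimes>\<^bsub>H\<^esub> t) \<odot>\<^bsub>H\<^esub> \<one>\<^bsub>H\<^esub>"
proof -
  note Hm = H.module_axioms and Ha = H.assoc_algebra_axioms
  note cl = antipode_closed j.counit_V_closed
  have b1: "(\<lambda>a b. antipode H (a \<otimes>\<^bsub>H\<^esub> c) \<otimes>\<^bsub>H\<^esub> (b \<otimes>\<^bsub>H\<^esub> d)) \<in> bilinear_maps K H H H"
    if "c \<in> carrier H" "d \<in> carrier H" for c d
    by (rule bilinear_comp[OF left_bilinear linear_mult_right[OF Ha that(1) linear_id]
          linear_mult_right[OF Ha that(2) linear_id]])
  have b2: "(\<lambda>c d. antipode H (a \<otimes>\<^bsub>H\<^esub> c) \<otimes>\<^bsub>H\<^esub> (b \<otimes>\<^bsub>H\<^esub> d)) \<in> bilinear_maps K H H H"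
    if "a \<in> carrier H" "b \<in> carrier H" for a b
    by (rule bilinear_comp[OF left_bilinear linear_mult_left[OF Ha that(1) linear_id]
          linear_mult_left[OF Ha that(2) linear_id]])
  have "sweedler K H H (\<lambda>a b. antipode H a \<otimes>\<^bsub>H\<^esub> b) (x \<otimes>\<^bsub>H\<^esub> t) =
    sweedler K H H (\<lambda>a b. sweedler K H H (\<lambda>c d. antipode H (a \<otimes>\<^bsub>H\<^esub> c) \<otimes>\<^bsub>H\<^esub> (b \<otimes>\<^bsub>H\<^esub> d)) t) x"
    unfolding algebra_hom_mult[OF comult_hom x t]
    by (rule HH.tensor_lift_mult[OF Hm left_bilinear j.V.comult_closed[OF x] j.V.comult_closed[OF t]])
  also have "\<dots> = sweedler K H H (\<lambda>c d. sweedler K H H (\<lambda>a b. antipode H (a \<otimes>\<^bsub>H\<^esub> c) \<otimes>\<^bsub>H\<^esub> (b \<otimes>\<^bsub>H\<^esub> d)) x) t"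
    by (rule tensor_lift_commute[OF Hm Hm Hm Hm Hm j.V.comult_closed[OF x] j.V.comult_closed[OF t] b1 b2])
  also have "\<dots> = sweedler K H H (\<lambda>c d. counit H x \<odot>\<^bsub>H\<^esub> (antipode H c \<otimes>\<^bsub>H\<^esub> d)) t"
  proof (rule j.V.sweedler_cong[OF Hm _ t, symmetric])
    show "(\<lambda>a b. counit H x \<odot>\<^bsub>H\<^esub> (antipode H a \<otimes>\<^bsub>H\<^esub> b)) \<in> bilinear_maps K H H H"
      by (rule bilinear_comp_linear[OF left_bilinear linear_smult_const[OF Hm cl(2)[OF x] linear_id]])
    fix c d assume cd: "c \<in> carrier H" "d \<in> carrier H"
    have l: "(\<lambda>z. antipode H c \<otimes>\<^bsub>H\<^esub> z \<otimes>\<^bsub>H\<^esub> d) \<in> linear_maps K H H"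
      by (rule linear_mult_right[OF Ha cd(2) linear_mult_left[OF Ha cl(1)[OF cd(1)] linear_id]])
    have "counit H x \<odot>\<^bsub>H\<^esub> (antipode H c \<otimes>\<^bsub>H\<^esub> d) = antipode H c \<otimes>\<^bsub>H\<^esub> (counit H x \<odot>\<^bsub>H\<^esub> \<one>\<^bsub>H\<^esub>) \<otimes>\<^bsub>H\<^esub> d"
      using cd x cl by (simp add: H.smult_mult_left H.smult_mult_right)
    also have "\<dots> = sweedler K H H (\<lambda>a b. antipode H c \<otimes>\<^bsub>H\<^esub> (antipode H a \<otimes>\<^bsub>H\<^esub> b) \<otimes>\<^bsub>H\<^esub> d) x"
      unfolding Rx[symmetric] by (rule j.V.sweedler_comp[OF Hm Hm left_bilinear l x])
    also have "\<dots> = sweedler K H H (\<lambda>a b. antipode H (a \<otimes>\<^bsub>H\<^esub> c) \<otimes>\<^bsub>H\<^esub> (b \<otimes>\<^bsub>H\<^esub> d)) x"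
      by (rule j.V.sweedler_cong[OF Hm bilinear_comp_linear[OF left_bilinear l] x])
        (use cd cl in \<open>simp add: antipode_mult H.A.m_assoc\<close>)
    finally show "counit H x \<odot>\<^bsub>H\<^esub> (antipode H c \<otimes>\<^bsub>H\<^esub> d) =
      sweedler K H H (\<lambda>a b. antipode H (a \<otimes>\<^bsub>H\<^esub> c) \<otimes>\<^bsub>H\<^esub> (b \<otimes>\<^bsub>H\<^esub> d)) x" .
  qed
  also have "\<dots> = counit H x \<odot>\<^bsub>H\<^esub> sweedler K H H (\<lambda>a b. antipode H a \<otimes>\<^bsub>H\<^esub> b) t"
    by (rule j.V.sweedler_comp[OF Hm Hm left_bilinear linear_smult_const[OF Hm cl(2)[OF x] linear_id] t, symmetric])
  also have "\<dots> = counit H (x \<otimes>\<^bsub>H\<^esub> t) \<odot>\<^bsub>H\<^esub> \<one>\<^bsub>H\<^esub>"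
    unfolding Rt using algebra_hom_mult[OF counit_hom x t] x t by (simp add: cl H.smult_assoc1)
  finally show ?thesis .
qed

text \<open>The two sides are linear, but the left sides are not visibly multiplicative, so
  \<open>algebra_hom_ext\<close> is out of reach. The elements satisfying a law form a submodule
  containing the unit, and the product lemmas show closure under left multiplication by
  generators.\<close>

lemma antipode_H:
  assumes x: "x \<in> carrier H"
  shows "sweedler K H H (\<lambda>a b. antipode H a \<otimes>\<^bsub>H\<^esub> b) x = counit H x \<odot>\<^bsub>H\<^esub> \<one>\<^bsub>H\<^esub>" (is "?l x = _")
    and "sweedler K H H (\<lambda>a b. a \<otimes>\<^bsub>H\<^esub> antipode H b) x = counit H x \<odot>\<^bsub>H\<^esub> \<one>\<^bsub>H\<^esub>" (is "?r x = _")
proof -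
  note Hm = H.module_axioms
  have e: "(\<lambda>x. counit H x \<odot>\<^bsub>H\<^esub> \<one>\<^bsub>H\<^esub>) \<in> linear_maps K H H"
    by (rule linear_smult_vec[OF Hm _ j.counit_V_linear]) simp
  have e1: "counit H \<one>\<^bsub>H\<^esub> = \<one>\<^bsub>K\<^esub>" using algebra_hom_one[OF counit_hom] by simp
  note d1 = algebra_hom_one[OF comult_hom]
  have lj: "?l (j x) = counit H (j x) \<odot>\<^bsub>H\<^esub> \<one>\<^bsub>H\<^esub>" and rj: "?r (j x) = counit H (j x) \<odot>\<^bsub>H\<^esub> \<one>\<^bsub>H\<^esub>"
    if x: "x \<in> carrier V" for x
  proof -
    have "?l (j x) = sweedler K V H (\<lambda>a b. antipode H (j a) \<otimes>\<^bsub>H\<^esub> j b) x"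
      by (rule j.sweedler_inc[OF Hm left_bilinear x])
    also have "\<dots> = sweedler K V H (\<lambda>a b. j (\<sigma> a) \<otimes>\<^bsub>H\<^esub> j b) x"
      by (rule V.sweedler_cong[OF Hm j.bilinear_inc[OF left_bilinear] x]) (simp add: antipode_j)
    finally show "?l (j x) = counit H (j x) \<odot>\<^bsub>H\<^esub> \<one>\<^bsub>H\<^esub>" by (simp add: inverse_left[OF x] counit_j[OF x])
    have "?r (j x) = sweedler K V H (\<lambda>a b. j a \<otimes>\<^bsub>H\<^esub> antipode H (j b)) x"
      by (rule j.sweedler_inc[OF Hm right_bilinear x])
    also have "\<dots> = sweedler K V H (\<lambda>a b. j a \<otimes>\<^bsub>H\<^esub> j (\<sigma> b)) x"
      by (rule V.sweedler_cong[OF Hm j.bilinear_inc[OF right_bilinear] x]) (simp add: antipode_j)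
    finally show "?r (j x) = counit H (j x) \<odot>\<^bsub>H\<^esub> \<one>\<^bsub>H\<^esub>" by (simp add: inverse_right[OF x] counit_j[OF x])
  qed
  have "carrier H \<subseteq> {x \<in> carrier H. ?l x = counit H x \<odot>\<^bsub>H\<^esub> \<one>\<^bsub>H\<^esub>}"
  proof (rule generated[OF submodule_equalizer[OF Hm Hm j.V.sweedler_linear[OF Hm left_bilinear] e]])
    show "\<one>\<^bsub>H\<^esub> \<in> {x \<in> carrier H. ?l x = counit H x \<odot>\<^bsub>H\<^esub> \<one>\<^bsub>H\<^esub>}"
      by (simp add: d1 HH.tensor_one j.V.CC.tensor_lift_pure[OF Hm left_bilinear] antipode_one e1)
  qed (use antipode_left_mult lj j_closed in auto)
  then show "?l x = counit H x \<odot>\<^bsub>H\<^esub> \<one>\<^bsub>H\<^esub>" using x by blast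
  have "carrier H \<subseteq> {x \<in> carrier H. ?r x = counit H x \<odot>\<^bsub>H\<^esub> \<one>\<^bsub>H\<^esub>}"
  proof (rule generated[OF submodule_equalizer[OF Hm Hm j.V.sweedler_linear[OF Hm right_bilinear] e]])
    show "\<one>\<^bsub>H\<^esub> \<in> {x \<in> carrier H. ?r x = counit H x \<odot>\<^bsub>H\<^esub> \<one>\<^bsub>H\<^esub>}"
      by (simp add: d1 HH.tensor_one j.V.CC.tensor_lift_pure[OF Hm right_bilinear] antipode_one e1)
  qed (use antipode_right_mult rj j_closed in auto)
  then show "?r x = counit H x \<odot>\<^bsub>H\<^esub> \<one>\<^bsub>H\<^esub>" using x by blast
qed

sublocale cocommutative_hopf_algebra K H
proof unfold_locales
  show "comult H \<in> linear_maps K H (tensor K H H)" by (rule algebra_hom_linear[OF comult_hom])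
  show "counit H \<in> linear_maps K H (self_module K)" by (rule algebra_hom_linear[OF counit_hom])
  show "comult H \<in> ring_hom H (tensor K H H)" using comult_hom by (simp add: algebra_hom_def)
  show "counit H \<in> ring_hom H K" using counit_hom by (simp add: algebra_hom_def ring_hom_def)
qed (rule coassoc_H counit_H antipode_linear_H antipode_H cocommutative_H; assumption?)+

end

section \<open>Takeuchi's free Hopf algebra\<close>

lemma linear_extension_codomain_cong:
  assumes "carrier A = carrier B" "add A = add B" "zero A = zero B" "smult A = smult B"
  shows "linear_extension K A = linear_extension K B"
  by (simp add: fun_eq_iff linear_extension_def finsum_def finprod_def assms)

lemma tensor_lift_codomain_cong:
  assumes "carrier A = carrier B" "add A = add B" "zero A = zero B" "smult A = smult B"
  shows "tensor_lift K A f = tensor_lift K B f"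
  by (simp add: tensor_lift_def linear_extension_codomain_cong[OF assms])

lemma tensor_lift_opposite: "tensor_lift K (opposite A) f = tensor_lift K A f"
  by (rule tensor_lift_codomain_cong) simp_all

lemma linear_maps_opposite: "linear_maps K M (opposite A) = linear_maps K M A"
  by (simp add: linear_maps_def)

lemma algebra_hom_kernel_ideal:
  assumes A: "assoc_algebra K A" and B: "assoc_algebra K B" and f: "f \<in> algebra_hom K A B"
  shows "ideal {x \<in> carrier A. f x = \<zero>\<^bsub>B\<^esub>} A"
proof -
  interpret ring_hom_ring A B f
    using f by (intro ring_hom_ringI2 assoc_algebra_ring[OF A] assoc_algebra_ring[OF B])
      (simp add: algebra_hom_def)
  show ?thesis using kernel_is_ideal unfolding a_kernel_def' .
qed

text \<open>\<open>Idl\<close> is generated by ring operations alone. It absorbs scalars because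
  multiplying by the scalar \<open>a\<close> is multiplying by the algebra element \<open>a\<close>
  times one.\<close>

lemma ideal_submodule:
  assumes A: "assoc_algebra K A" and I: "ideal I A"
  shows "submodule I K A"
proof -
  interpret A: assoc_algebra K A by (rule A)
  interpret I: ideal I A by (rule I)
  show ?thesis
  proof (rule submodule.intro)
    show "subgroup I (add_monoid A)" by (rule I.a_subgroup)
    show "submodule_axioms I K A"
    proof
      fix a x assume a: "a \<in> carrier K" and x: "x \<in> I"
      then have "(a \<odot>\<^bsub>A\<^esub> \<one>\<^bsub>A\<^esub>) \<otimes>\<^bsub>A\<^esub> x \<in> I" by (intro I.I_l_closed) auto
      then show "a \<odot>\<^bsub>A\<^esub> x \<in> I" using a x by (simp add: A.smult_mult_left)
    qed
  qed
qed

section \<open>The algebra T(V)/I and the maps out of it\<close>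

context takeuchi
begin

abbreviation "T \<equiv> tensor_algebra K TV"
abbreviation "\<iota> \<equiv> tensor_algebra_inc K TV"
abbreviation "S \<equiv> takeuchi_antipode K C"
abbreviation "I \<equiv> takeuchi_ideal K C"
abbreviation "Q \<equiv> quotient_module T I"
abbreviation "proj \<equiv> (\<lambda>t. I +>\<^bsub>T\<^esub> t)"
abbreviation "F \<equiv> free_hopf K C"
abbreviation "gen \<equiv> (\<lambda>x. proj (\<iota> x))"

lemmas T_algebra = module.assoc_algebra_tensor_algebra[OF module_takeuchi]
lemmas \<iota>_linear = module.tensor_algebra_inc_linear[OF module_takeuchi]
lemmas T_lift_hom = module.tensor_algebra_lift_hom[OF module_takeuchi]
lemmas T_lift_inc = module.tensor_algebra_lift_inc[OF module_takeuchi]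

lemma \<iota>_closed: "x \<in> carrier TV \<Longrightarrow> \<iota> x \<in> carrier T"
  by (rule linear_closed[OF \<iota>_linear])

lemma shift_closed: "x \<in> carrier TV \<Longrightarrow> shift x \<in> carrier TV"
  by (rule linear_closed[OF shift_linear])

lemma S_hom: "S \<in> algebra_hom K T (opposite T)"
  and S_inc: "x \<in> carrier TV \<Longrightarrow> S (\<iota> x) = \<iota> (shift x)"
proof -
  have l: "(\<lambda>x. \<iota> (shift x)) \<in> linear_maps K TV (opposite T)"
    unfolding linear_maps_opposite by (rule linear_comp[OF \<iota>_linear shift_linear])
  show "S \<in> algebra_hom K T (opposite T)"
    unfolding takeuchi_antipode_def Let_def by (rule T_lift_hom[OF assoc_algebra_opposite[OF T_algebra] l])
  show "S (\<iota> x) = \<iota> (shift x)" if "x \<in> carrier TV"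
    unfolding takeuchi_antipode_def Let_def by (rule T_lift_inc[OF assoc_algebra_opposite[OF T_algebra] l that])
qed

definition "relations = (\<Union>x \<in> carrier TV.
  {sweedler K TV T (\<lambda>a b. \<iota> a \<otimes>\<^bsub>T\<^esub> S (\<iota> b)) x \<ominus>\<^bsub>T\<^esub> counit TV x \<odot>\<^bsub>T\<^esub> \<one>\<^bsub>T\<^esub>,
   sweedler K TV T (\<lambda>a b. S (\<iota> a) \<otimes>\<^bsub>T\<^esub> \<iota> b) x \<ominus>\<^bsub>T\<^esub> counit TV x \<odot>\<^bsub>T\<^esub> \<one>\<^bsub>T\<^esub>})"

lemma takeuchi_ideal_eq: "I = Idl\<^bsub>T\<^esub> relations"
  by (simp add: takeuchi_ideal_def relations_def Let_def)

lemma module_T: "module K T"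
  by (rule assoc_algebra_module[OF T_algebra])

lemma S_linear: "S \<in> linear_maps K T T"
  using algebra_hom_linear[OF S_hom] by (simp add: linear_maps_opposite)

lemma relation_bilinear:
  "(\<lambda>a b. \<iota> a \<otimes>\<^bsub>T\<^esub> S (\<iota> b)) \<in> bilinear_maps K TV TV T"
  "(\<lambda>a b. S (\<iota> a) \<otimes>\<^bsub>T\<^esub> \<iota> b) \<in> bilinear_maps K TV TV T"
  by (rule bilinear_comp[OF bilinear_mult[OF T_algebra] \<iota>_linear linear_comp[OF S_linear \<iota>_linear]]
      bilinear_comp[OF bilinear_mult[OF T_algebra] linear_comp[OF S_linear \<iota>_linear] \<iota>_linear])+

lemma relations_closed: "relations \<subseteq> carrier T"
proof -
  interpret T: assoc_algebra K T by (rule T_algebra)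
  show ?thesis
    using V.V.sweedler_closed[OF module_T relation_bilinear(1)] V.V.sweedler_closed[OF module_T relation_bilinear(2)]
      V.counit_V_closed
    by (auto simp: relations_def intro!: T.M.minus_closed)
qed

lemma I_ideal: "ideal I T"
  unfolding takeuchi_ideal_eq
  by (rule ring.genideal_ideal[OF assoc_algebra_ring[OF T_algebra] relations_closed])

lemma I_submodule: "submodule I K T"
  by (rule ideal_submodule[OF T_algebra I_ideal])

lemma Q_algebra: "assoc_algebra K Q"
  by (rule assoc_algebra_quotient[OF T_algebra I_submodule I_ideal])

lemma proj_hom: "proj \<in> algebra_hom K T Q"
  by (rule quotient_algebra_hom[OF T_algebra I_submodule I_ideal])

text \<open>On letters S is the shift, so the value of an algebra map at a relation depends only on
  its restriction to V.\<close>

lemma sweedler_algebra_hom: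
  assumes A: "assoc_algebra K A" and f: "f \<in> algebra_hom K T A" and x: "x \<in> carrier TV"
  shows "f (sweedler K TV T (\<lambda>a b. \<iota> a \<otimes>\<^bsub>T\<^esub> S (\<iota> b)) x) =
      sweedler K TV A (\<lambda>a b. f (\<iota> a) \<otimes>\<^bsub>A\<^esub> f (\<iota> (shift b))) x"
    and "f (sweedler K TV T (\<lambda>a b. S (\<iota> a) \<otimes>\<^bsub>T\<^esub> \<iota> b) x) =
      sweedler K TV A (\<lambda>a b. f (\<iota> (shift a)) \<otimes>\<^bsub>A\<^esub> f (\<iota> b)) x"
proof -
  note Am = assoc_algebra_module[OF A] and fl = algebra_hom_linear[OF f]
  show "f (sweedler K TV T (\<lambda>a b. \<iota> a \<otimes>\<^bsub>T\<^esub> S (\<iota> b)) x) =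
      sweedler K TV A (\<lambda>a b. f (\<iota> a) \<otimes>\<^bsub>A\<^esub> f (\<iota> (shift b))) x"
    unfolding V.V.sweedler_comp[OF module_T Am relation_bilinear(1) fl x]
    by (rule V.V.sweedler_cong[OF Am bilinear_comp_linear[OF relation_bilinear(1) fl] x])
      (simp add: S_inc algebra_hom_mult[OF f] \<iota>_closed shift_closed)
  show "f (sweedler K TV T (\<lambda>a b. S (\<iota> a) \<otimes>\<^bsub>T\<^esub> \<iota> b) x) =
      sweedler K TV A (\<lambda>a b. f (\<iota> (shift a)) \<otimes>\<^bsub>A\<^esub> f (\<iota> b)) x"
    unfolding V.V.sweedler_comp[OF module_T Am relation_bilinear(2) fl x]
    by (rule V.V.sweedler_cong[OF Am bilinear_comp_linear[OF relation_bilinear(2) fl] x])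
      (simp add: S_inc algebra_hom_mult[OF f] \<iota>_closed shift_closed)
qed

text \<open>Says that \<open>f \<circ> shift\<close> is a two-sided convolution inverse of
  \<open>f\<close>. For linear \<open>f\<close> this is the condition under which the induced
  algebra map on T(V) kills Takeuchi's relations.\<close>

definition "respects_relations A f \<longleftrightarrow> (\<forall>x \<in> carrier TV.
  sweedler K TV A (\<lambda>a b. f a \<otimes>\<^bsub>A\<^esub> f (shift b)) x = counit TV x \<odot>\<^bsub>A\<^esub> \<one>\<^bsub>A\<^esub> \<and>
  sweedler K TV A (\<lambda>a b. f (shift a) \<otimes>\<^bsub>A\<^esub> f b) x = counit TV x \<odot>\<^bsub>A\<^esub> \<one>\<^bsub>A\<^esub>)"

lemma respects_relations_cong:
  assumes A: "assoc_algebra K A" and g: "g \<in> linear_maps K TV A"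
    and eq: "\<And>x. x \<in> carrier TV \<Longrightarrow> g x = f x" and r: "respects_relations A g"
  shows "respects_relations A f"
proof -
  note Am = assoc_algebra_module[OF A]
  have b: "(\<lambda>a b. g a \<otimes>\<^bsub>A\<^esub> g (shift b)) \<in> bilinear_maps K TV TV A"
    "(\<lambda>a b. g (shift a) \<otimes>\<^bsub>A\<^esub> g b) \<in> bilinear_maps K TV TV A"
    by (rule bilinear_comp[OF bilinear_mult[OF A] g linear_comp[OF g shift_linear]]
      bilinear_comp[OF bilinear_mult[OF A] linear_comp[OF g shift_linear] g])+
  have "sweedler K TV A (\<lambda>a b. g a \<otimes>\<^bsub>A\<^esub> g (shift b)) x = sweedler K TV A (\<lambda>a b. f a \<otimes>\<^bsub>A\<^esub> f (shift b)) x"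
    "sweedler K TV A (\<lambda>a b. g (shift a) \<otimes>\<^bsub>A\<^esub> g b) x = sweedler K TV A (\<lambda>a b. f (shift a) \<otimes>\<^bsub>A\<^esub> f b) x"
    if "x \<in> carrier TV" for x
    by (rule V.V.sweedler_cong[OF Am b(1) that] V.V.sweedler_cong[OF Am b(2) that]; simp add: eq shift_closed)+
  then show ?thesis using r by (simp add: respects_relations_def)
qed

text \<open>The kernel of an algebra map is an ideal. Once it contains the relations, it contains
  the ideal generated by them.\<close>

lemma vanishes_on_ideal:
  assumes A: "assoc_algebra K A" and f: "f \<in> algebra_hom K T A"
    and r: "respects_relations A (\<lambda>x. f (\<iota> x))" and t: "t \<in> I"
  shows "f t = \<zero>\<^bsub>A\<^esub>"
proof -
  interpret T: assoc_algebra K T by (rule T_algebra)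
  interpret A: assoc_algebra K A by (rule A)
  note Am = A.module_axioms and fl = algebra_hom_linear[OF f]
  note s = V.V.sweedler_closed[OF module_T relation_bilinear(1)] V.V.sweedler_closed[OF module_T relation_bilinear(2)]
  have "relations \<subseteq> {x \<in> carrier T. f x = \<zero>\<^bsub>A\<^esub>}"
  proof
    fix z assume z: "z \<in> relations"
    then obtain x y where x: "x \<in> carrier TV" and zy: "z = y \<ominus>\<^bsub>T\<^esub> counit TV x \<odot>\<^bsub>T\<^esub> \<one>\<^bsub>T\<^esub>"
      and y: "y = sweedler K TV T (\<lambda>a b. \<iota> a \<otimes>\<^bsub>T\<^esub> S (\<iota> b)) x \<or> y = sweedler K TV T (\<lambda>a b. S (\<iota> a) \<otimes>\<^bsub>T\<^esub> \<iota> b) x"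
      unfolding relations_def by blast
    have yc: "y \<in> carrier T" using y s x by auto
    have e: "counit TV x \<in> carrier K" by (rule V.counit_V_closed[OF x])
    have "f y = counit TV x \<odot>\<^bsub>A\<^esub> \<one>\<^bsub>A\<^esub>"
      using y r x by (auto simp: sweedler_algebra_hom[OF A f x] respects_relations_def)
    moreover have "f z = f y \<ominus>\<^bsub>A\<^esub> counit TV x \<odot>\<^bsub>A\<^esub> \<one>\<^bsub>A\<^esub>"
      unfolding zy using yc e
      by (simp add: linear_minus[OF module_T Am fl] linear_smult[OF fl] algebra_hom_one[OF f])
    ultimately have "f z = \<zero>\<^bsub>A\<^esub>" using e by (simp add: A.M.minus_eq A.M.r_neg)
    then show "z \<in> {x \<in> carrier T. f x = \<zero>\<^bsub>A\<^esub>}" using z relations_closed by auto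
  qed
  then have "I \<subseteq> {x \<in> carrier T. f x = \<zero>\<^bsub>A\<^esub>}"
    unfolding takeuchi_ideal_eq by (rule T.A.genideal_minimal[OF algebra_hom_kernel_ideal[OF T_algebra A f]])
  then show ?thesis using t by auto
qed

text \<open>The universal property of T(V)/I. It yields the comultiplication, the counit and the
  antipode of F(C), and later the map into \<open>M\<close>.\<close>

lemma Q_lift:
  assumes A: "assoc_algebra K A" and f: "f \<in> algebra_hom K T A"
    and r: "respects_relations A (\<lambda>x. f (\<iota> x))"
  shows "quotient_lift f \<in> algebra_hom K Q A"
    and "t \<in> carrier T \<Longrightarrow> quotient_lift f (proj t) = f t"
  by (rule quotient_lift_algebra_hom[OF T_algebra I_submodule I_ideal A f vanishes_on_ideal[OF A f r]], assumption)
    (rule quotient_lift[OF module_T I_submodule assoc_algebra_module[OF A] algebra_hom_linear[OF f]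
        vanishes_on_ideal[OF A f r]]; assumption)

section \<open>The structure maps of F(C)\<close>

abbreviation "B \<equiv> tensor_bialgebra K TV"

lemma B_simps:
  "carrier B = carrier T" "add B = add T" "zero B = zero T" "smult B = smult T" "mult B = mult T" "one B = one T"
  "counit B = tensor_algebra_lift K (self_module K) (counit TV)"
  "comult B = tensor_algebra_lift K (tensor K T T) (\<lambda>x. tensor_map K T T \<iota> \<iota> (comult TV x))"
  by (simp_all add: tensor_bialgebra_def Let_def module.defs coalg.defs)

lemma coset_B: "I' +>\<^bsub>B\<^esub> x = I' +>\<^bsub>T\<^esub> x"
  by (simp add: a_r_coset_def' B_simps)

text \<open>\<open>quotient_hopf\<close> divides the record with coalgebra fields, while
  \<open>I\<close> is an ideal of the bare tensor algebra. Both quotients are the same record, as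
  only shared fields enter.\<close>

lemma quotient_B: "quotient_module B I = Q"
proof -
  have "a_rcosets\<^bsub>B\<^esub> I = a_rcosets\<^bsub>T\<^esub> I" by (simp add: A_RCOSETS_def' a_r_coset_def' B_simps)
  moreover have "set_add B = set_add T" by (simp add: fun_eq_iff set_add_def' B_simps)
  moreover have "rcoset_mult B I = rcoset_mult T I" by (simp add: fun_eq_iff rcoset_mult_def coset_B B_simps)
  ultimately show ?thesis by (simp add: quotient_module_def coset_B B_simps)
qed

lemma F_simps:
  "carrier F = carrier Q" "add F = add Q" "zero F = zero Q" "smult F = smult Q" "mult F = mult Q" "one F = one Q"
  "counit F = quotient_lift (counit B)"
  "comult F = quotient_lift (\<lambda>x. tensor_map K Q Q proj proj (comult B x))"
  "antipode F = quotient_lift (\<lambda>x. proj (S x))"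
  by (simp_all add: free_hopf_def quotient_hopf_def Let_def module.defs coalg.defs hopf.defs quotient_B coset_B)

lemma tensor_F: "tensor K F F = tensor K Q Q"
  by (rule tensor_cong; simp add: F_simps)

lemma tensor_map_F: "tensor_map K F F = tensor_map K Q Q"
  by (rule tensor_map_cong; simp add: F_simps)

lemma algebra_hom_F: "algebra_hom K F A = algebra_hom K Q A" "algebra_hom K A F = algebra_hom K A Q"
  "algebra_hom K A (opposite F) = algebra_hom K A (opposite Q)" "linear_maps K M F = linear_maps K M Q"
  by (simp_all add: algebra_hom_def linear_maps_def ring_hom_def F_simps)

lemma tensor_lift_F: "tensor_lift K F f = tensor_lift K Q f"
  by (rule tensor_lift_codomain_cong) (simp_all add: F_simps)

lemma F_algebra: "assoc_algebra K F"
  by (rule assoc_algebra_surj[OF Q_algebra, of _ "\<lambda>x. x"]) (simp_all add: F_simps)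

lemma gen_linear: "gen \<in> linear_maps K TV Q"
  by (rule linear_comp[OF algebra_hom_linear[OF proj_hom] \<iota>_linear])

text \<open>The generators of \<open>I\<close> are exactly the failures of these two identities, and
  \<open>proj\<close> kills them.\<close>

lemma gen_respects: "respects_relations Q gen"
  unfolding respects_relations_def
proof (intro ballI)
  interpret Q: assoc_algebra K Q by (rule Q_algebra)
  interpret T: assoc_algebra K T by (rule T_algebra)
  fix x assume x: "x \<in> carrier TV"
  note pl = algebra_hom_linear[OF proj_hom]
  have e: "counit TV x \<in> carrier K" by (rule V.counit_V_closed[OF x])
  have key: "proj y = counit TV x \<odot>\<^bsub>Q\<^esub> \<one>\<^bsub>Q\<^esub>"
    if y: "y \<in> carrier T" and r: "y \<ominus>\<^bsub>T\<^esub> counit TV x \<odot>\<^bsub>T\<^esub> \<one>\<^bsub>T\<^esub> \<in> relations" for y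
  proof -
    have "y \<ominus>\<^bsub>T\<^esub> counit TV x \<odot>\<^bsub>T\<^esub> \<one>\<^bsub>T\<^esub> \<in> I"
      using T.A.genideal_self[OF relations_closed] r unfolding takeuchi_ideal_eq by (rule subsetD)
    then have "proj y = proj (counit TV x \<odot>\<^bsub>T\<^esub> \<one>\<^bsub>T\<^esub>)"
      by (intro coset_eqI[OF module_T I_submodule y]) (use e in auto)
    then show ?thesis
      by (simp add: linear_smult[OF pl e] algebra_hom_one[OF proj_hom])
  qed
  have "proj (sweedler K TV T (\<lambda>a b. \<iota> a \<otimes>\<^bsub>T\<^esub> S (\<iota> b)) x) = counit TV x \<odot>\<^bsub>Q\<^esub> \<one>\<^bsub>Q\<^esub>"
    by (rule key[OF V.V.sweedler_closed[OF module_T relation_bilinear(1) x]])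
      (use x in \<open>auto simp: relations_def\<close>)
  moreover have "proj (sweedler K TV T (\<lambda>a b. S (\<iota> a) \<otimes>\<^bsub>T\<^esub> \<iota> b) x) = counit TV x \<odot>\<^bsub>Q\<^esub> \<one>\<^bsub>Q\<^esub>"
    by (rule key[OF V.V.sweedler_closed[OF module_T relation_bilinear(2) x]])
      (use x in \<open>auto simp: relations_def\<close>)
  ultimately show "sweedler K TV Q (\<lambda>a b. gen a \<otimes>\<^bsub>Q\<^esub> gen (shift b)) x = counit TV x \<odot>\<^bsub>Q\<^esub> \<one>\<^bsub>Q\<^esub> \<and>
    sweedler K TV Q (\<lambda>a b. gen (shift a) \<otimes>\<^bsub>Q\<^esub> gen b) x = counit TV x \<odot>\<^bsub>Q\<^esub> \<one>\<^bsub>Q\<^esub>"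
    by (simp add: sweedler_algebra_hom[OF Q_algebra proj_hom x])
qed

lemma gen_shift_linear: "(\<lambda>x. gen (shift x)) \<in> linear_maps K TV Q"
  by (rule linear_comp[OF gen_linear shift_linear])

text \<open>The map to descend restricts on V to (\<open>gen\<close> \<otimes> \<open>gen\<close>)
  \<Delta>. By \<open>convolution_inverse_tensor\<close>, its inverse is built in the same way from
  the inverse \<open>gen \<circ> shift\<close> of \<open>gen\<close>; exchanging the roles of the
  two maps gives the other relation.\<close>

lemma comult_F_hom: "comult F \<in> algebra_hom K Q (tensor K Q Q)"
  and comult_F_gen: "x \<in> carrier TV \<Longrightarrow> comult F (gen x) = tensor_map K Q Q gen gen (comult TV x)"
proof -
  interpret TT: algebra_tensor_product K T T by (rule algebra_tensor_product.intro[OF T_algebra T_algebra])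
  interpret QQ: algebra_tensor_product K Q Q by (rule algebra_tensor_product.intro[OF Q_algebra Q_algebra])
  note Tm = module_T and Qm = assoc_algebra_module[OF Q_algebra] and Vm = V.V.module_axioms
  note QQm = QQ.module_tensor
  have l: "(\<lambda>x. tensor_map K T T \<iota> \<iota> (comult TV x)) \<in> linear_maps K TV (tensor K T T)"
    by (rule linear_comp[OF tensor_map_linear[OF Vm Vm Tm Tm \<iota>_linear \<iota>_linear] V.V.comult_linear])
  note dB = T_lift_hom[OF TT.assoc_algebra_tensor l, folded B_simps(8)]
  note dBi = T_lift_inc[OF TT.assoc_algebra_tensor l, folded B_simps(8)]
  let ?f = "\<lambda>x. tensor_map K Q Q proj proj (comult B x)"
  have f: "?f \<in> algebra_hom K T (tensor K Q Q)"
    by (rule algebra_hom_comp[OF tensor_map_algebra_hom[OF T_algebra T_algebra Q_algebra Q_algebra proj_hom proj_hom] dB])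
  have fi: "?f (\<iota> x) = tensor_map K Q Q gen gen (comult TV x)" if x: "x \<in> carrier TV" for x
  proof -
    note b = tensor_map_bilinear[OF Tm Tm Qm Qm algebra_hom_linear[OF proj_hom] algebra_hom_linear[OF proj_hom]]
    show ?thesis
      unfolding dBi[OF x] tensor_map_eq_lift[of K Q Q]
      by (rule tensor_lift_tensor_map[OF Vm Vm Tm Tm \<iota>_linear \<iota>_linear QQm b V.V.comult_closed[OF x]])
  qed
  let ?D = "\<lambda>x. tensor_map K Q Q gen gen (comult TV x)"
  have Dl: "?D \<in> linear_maps K TV (tensor K Q Q)"
    by (rule linear_comp[OF tensor_map_linear[OF Vm Vm Qm Qm gen_linear gen_linear] V.V.comult_linear])
  \<comment> \<open>Identifies the shifted map with the candidate inverse; this is where the shift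
    has to be compatible with the coproduct.\<close>
  have Ds: "?D (shift x) = tensor_map K Q Q (\<lambda>x. gen (shift x)) (\<lambda>x. gen (shift x)) (comult TV x)"
    if x: "x \<in> carrier TV" for x
    unfolding tensor_map_eq_lift
    by (rule sweedler_shift[OF QQm tensor_map_bilinear[OF Vm Vm Qm Qm gen_linear gen_linear] x])
  have r0: "respects_relations (tensor K Q Q) ?D"
    unfolding respects_relations_def
  proof (intro ballI conjI)
    note Dsl = linear_comp[OF Dl shift_linear]
    note gr = gen_respects[unfolded respects_relations_def, rule_format]
    note m = bilinear_mult[OF QQ.assoc_algebra_tensor]
    fix x assume x: "x \<in> carrier TV"
    have "sweedler K TV (tensor K Q Q) (\<lambda>a b. ?D a \<otimes>\<^bsub>tensor K Q Q\<^esub> ?D (shift b)) x =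
      sweedler K TV (tensor K Q Q) (\<lambda>a b. ?D a \<otimes>\<^bsub>tensor K Q Q\<^esub>
        tensor_map K Q Q (\<lambda>x. gen (shift x)) (\<lambda>x. gen (shift x)) (comult TV b)) x"
      by (rule V.V.sweedler_cong[OF QQm bilinear_comp[OF m Dl Dsl] x]) (simp add: Ds)
    then show "sweedler K TV (tensor K Q Q) (\<lambda>a b. ?D a \<otimes>\<^bsub>tensor K Q Q\<^esub> ?D (shift b)) x =
      counit TV x \<odot>\<^bsub>tensor K Q Q\<^esub> \<one>\<^bsub>tensor K Q Q\<^esub>"
      using V.V.convolution_inverse_tensor[OF Q_algebra gen_linear gen_shift_linear conjunct1[OF gr] x] by simp
    have "sweedler K TV (tensor K Q Q) (\<lambda>a b. ?D (shift a) \<otimes>\<^bsub>tensor K Q Q\<^esub> ?D b) x =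
      sweedler K TV (tensor K Q Q) (\<lambda>a b.
        tensor_map K Q Q (\<lambda>x. gen (shift x)) (\<lambda>x. gen (shift x)) (comult TV a) \<otimes>\<^bsub>tensor K Q Q\<^esub> ?D b) x"
      by (rule V.V.sweedler_cong[OF QQm bilinear_comp[OF m Dsl Dl] x]) (simp add: Ds)
    then show "sweedler K TV (tensor K Q Q) (\<lambda>a b. ?D (shift a) \<otimes>\<^bsub>tensor K Q Q\<^esub> ?D b) x =
      counit TV x \<odot>\<^bsub>tensor K Q Q\<^esub> \<one>\<^bsub>tensor K Q Q\<^esub>"
      using V.V.convolution_inverse_tensor[OF Q_algebra gen_shift_linear gen_linear conjunct2[OF gr] x] by simp
  qed
  have r: "respects_relations (tensor K Q Q) (\<lambda>x. ?f (\<iota> x))"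
    by (rule respects_relations_cong[OF QQ.assoc_algebra_tensor Dl _ r0], rule fi[symmetric])
  show "comult F \<in> algebra_hom K Q (tensor K Q Q)"
    unfolding F_simps by (rule Q_lift(1)[OF QQ.assoc_algebra_tensor f r])
  show "comult F (gen x) = tensor_map K Q Q gen gen (comult TV x)" if "x \<in> carrier TV"
    unfolding F_simps Q_lift(2)[OF QQ.assoc_algebra_tensor f r \<iota>_closed[OF that]] by (rule fi[OF that])
qed

text \<open>The counit is invariant under the shift, and it is its own convolution inverse because
  it is the unit of convolution.\<close>

lemma counit_F_hom: "counit F \<in> algebra_hom K Q (self_module K)"
  and counit_F_gen: "x \<in> carrier TV \<Longrightarrow> counit F (gen x) = counit TV x"
proof -
  note s = assoc_algebra_self[OF R.is_cring]
  note sm = assoc_algebra_module[OF s]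
  note l = V.counit_V_linear
  note f = T_lift_hom[OF s l, folded B_simps(7)]
  note fi = T_lift_inc[OF s l, folded B_simps(7)]
  have r0: "respects_relations (self_module K) (counit TV)"
    unfolding respects_relations_def
  proof (intro ballI conjI)
    fix x assume x: "x \<in> carrier TV"
    note m = bilinear_mult[OF s]
    have "sweedler K TV (self_module K) (\<lambda>a b. counit TV a \<otimes>\<^bsub>self_module K\<^esub> counit TV b) x = counit TV x"
      using V.V.sweedler_counit_left[OF sm l x] by simp
    moreover have "sweedler K TV (self_module K) (\<lambda>a b. counit TV a \<otimes>\<^bsub>self_module K\<^esub> counit TV b) x =
      sweedler K TV (self_module K) (\<lambda>a b. counit TV a \<otimes>\<^bsub>self_module K\<^esub> counit TV (shift b)) x"
      "sweedler K TV (self_module K) (\<lambda>a b. counit TV a \<otimes>\<^bsub>self_module K\<^esub> counit TV b) x =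
      sweedler K TV (self_module K) (\<lambda>a b. counit TV (shift a) \<otimes>\<^bsub>self_module K\<^esub> counit TV b) x"
      by (rule V.V.sweedler_cong[OF sm bilinear_comp[OF m l l] x]; simp add: counit_shift)+
    ultimately show "sweedler K TV (self_module K) (\<lambda>a b. counit TV a \<otimes>\<^bsub>self_module K\<^esub> counit TV (shift b)) x =
        counit TV x \<odot>\<^bsub>self_module K\<^esub> \<one>\<^bsub>self_module K\<^esub>"
      "sweedler K TV (self_module K) (\<lambda>a b. counit TV (shift a) \<otimes>\<^bsub>self_module K\<^esub> counit TV b) x =
        counit TV x \<odot>\<^bsub>self_module K\<^esub> \<one>\<^bsub>self_module K\<^esub>"
      using V.counit_V_closed[OF x] by simp_all
  qed
  have r: "respects_relations (self_module K) (\<lambda>x. counit B (\<iota> x))"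
    by (rule respects_relations_cong[OF s l _ r0], rule fi[symmetric])
  show "counit F \<in> algebra_hom K Q (self_module K)"
    unfolding F_simps by (rule Q_lift(1)[OF s f r])
  show "counit F (gen x) = counit TV x" if "x \<in> carrier TV"
    unfolding F_simps Q_lift(2)[OF s f r \<iota>_closed[OF that]] by (rule fi[OF that])
qed

text \<open>Taking the opposite algebra as target makes the antipode an algebra map. Its relations
  read \<Sum> \<sigma>\<sigma>(\<open>x\<^sub>2\<close>) \<sigma>(\<open>x\<^sub>1\<close>) =
  \<epsilon>(x) 1 and \<Sum> \<sigma>(\<open>x\<^sub>2\<close>)
  \<sigma>\<sigma>(\<open>x\<^sub>1\<close>) = \<epsilon>(x) 1, with \<sigma> the shift.
  Cocommutativity restores the order of the factors, leaving the relations of \<open>gen\<close> at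
  the element \<sigma>(x).\<close>

lemma antipode_F_hom: "antipode F \<in> algebra_hom K Q (opposite Q)"
  and antipode_F_gen: "x \<in> carrier TV \<Longrightarrow> antipode F (gen x) = gen (shift x)"
proof -
  note o = assoc_algebra_opposite[OF Q_algebra]
  note Qm = assoc_algebra_module[OF Q_algebra]
  have "proj \<in> algebra_hom K (opposite T) (opposite Q)"
    using proj_hom by (simp add: algebra_hom_def linear_maps_def ring_hom_def)
  note f = algebra_hom_comp[OF this S_hom]
  have fi: "proj (S (\<iota> x)) = gen (shift x)" if "x \<in> carrier TV" for x
    by (simp add: S_inc[OF that])
  have gl: "(\<lambda>x. gen (shift x)) \<in> linear_maps K TV (opposite Q)"
    unfolding linear_maps_opposite by (rule gen_shift_linear)
  have r0: "respects_relations (opposite Q) (\<lambda>x. gen (shift x))"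
    unfolding respects_relations_def tensor_lift_opposite opposite_simps
  proof (intro ballI conjI)
    note gr = gen_respects[unfolded respects_relations_def, rule_format]
    note b = bilinear_comp[OF bilinear_mult[OF Q_algebra] gen_linear gen_shift_linear]
      bilinear_comp[OF bilinear_mult[OF Q_algebra] gen_shift_linear gen_linear]
    note c = bilinear_comp[OF b(1) shift_linear shift_linear] bilinear_comp[OF b(2) shift_linear shift_linear]
    fix x assume x: "x \<in> carrier TV"
    note sx = shift_closed[OF x]
    show "sweedler K TV Q (\<lambda>a b. gen (shift (shift b)) \<otimes>\<^bsub>Q\<^esub> gen (shift a)) x = counit TV x \<odot>\<^bsub>Q\<^esub> \<one>\<^bsub>Q\<^esub>"
      unfolding V.V.sweedler_commute[OF V.V.cocommutative Qm c(2) x]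
      unfolding sweedler_shift[OF Qm b(2) x, symmetric]
      using gr[OF sx] by (simp add: counit_shift[OF x])
    show "sweedler K TV Q (\<lambda>a b. gen (shift b) \<otimes>\<^bsub>Q\<^esub> gen (shift (shift a))) x = counit TV x \<odot>\<^bsub>Q\<^esub> \<one>\<^bsub>Q\<^esub>"
      unfolding V.V.sweedler_commute[OF V.V.cocommutative Qm c(1) x]
      unfolding sweedler_shift[OF Qm b(1) x, symmetric]
      using gr[OF sx] by (simp add: counit_shift[OF x])
  qed
  have r: "respects_relations (opposite Q) (\<lambda>x. proj (S (\<iota> x)))"
    by (rule respects_relations_cong[OF o gl _ r0], rule fi[symmetric])
  show "antipode F \<in> algebra_hom K Q (opposite Q)"
    unfolding F_simps by (rule Q_lift(1)[OF o f r])
  show "antipode F (gen x) = gen (shift x)" if "x \<in> carrier TV"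
    unfolding F_simps Q_lift(2)[OF o f r \<iota>_closed[OF that]] by (rule fi[OF that])
qed

text \<open>The preimage of \<open>N\<close> in T(V) meets the conditions of
  \<open>tensor_algebra_induct\<close>, and \<open>proj\<close> is surjective.\<close>

lemma generated_F:
  assumes N: "submodule N K F" and o: "\<one>\<^bsub>F\<^esub> \<in> N"
    and m: "\<And>x t. \<lbrakk>x \<in> carrier TV; t \<in> N\<rbrakk> \<Longrightarrow> gen x \<otimes>\<^bsub>F\<^esub> t \<in> N"
  shows "carrier F \<subseteq> N"
proof -
  have pF: "proj \<in> linear_maps K T F"
    using algebra_hom_linear[OF proj_hom] by (simp add: algebra_hom_F)
  have "carrier T \<subseteq> {t \<in> carrier T. proj t \<in> N}"
  proof (rule module.tensor_algebra_induct[OF module_takeuchi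
        submodule_preimage[OF module_T assoc_algebra_module[OF F_algebra] pF N]])
    interpret T: assoc_algebra K T by (rule T_algebra)
    show "\<one>\<^bsub>T\<^esub> \<in> {t \<in> carrier T. proj t \<in> N}"
      using o by (simp add: F_simps algebra_hom_one[OF proj_hom])
    show "\<iota> x \<otimes>\<^bsub>T\<^esub> t \<in> {t \<in> carrier T. proj t \<in> N}" if "x \<in> carrier TV" "t \<in> {t \<in> carrier T. proj t \<in> N}" for x t
      using that m[of x "proj t"] by (simp add: F_simps algebra_hom_mult[OF proj_hom] \<iota>_closed)
  qed
  then show ?thesis by (auto simp: F_simps carrier_quotient)
qed

sublocale F: generated_hopf K TV F shift gen
proof (rule generated_hopf.intro[OF V.V.cocommutative_coalgebra_axioms F_algebra], unfold_locales)
qed (use gen_respects[unfolded respects_relations_def, rule_format] generated_F in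
  \<open>simp_all add: algebra_hom_F tensor_F tensor_map_F tensor_lift_F gen_linear comult_F_hom comult_F_gen
    counit_F_hom counit_F_gen antipode_F_hom antipode_F_gen F_simps(1-6)\<close>)

end

section \<open>Morphisms of coalgebras and antipodes\<close>

lemma coalgebra_homD:
  assumes "f \<in> coalgebra_hom K C D"
  shows "f \<in> linear_maps K C D"
    and "x \<in> carrier C \<Longrightarrow> comult D (f x) = tensor_map K D D f f (comult C x)"
    and "x \<in> carrier C \<Longrightarrow> counit D (f x) = counit C x"
  using assms by (simp_all add: coalgebra_hom_def)

lemma coalgebra_homI:
  assumes "f \<in> linear_maps K C D"
    and "\<And>x. x \<in> carrier C \<Longrightarrow> comult D (f x) = tensor_map K D D f f (comult C x)"
    and "\<And>x. x \<in> carrier C \<Longrightarrow> counit D (f x) = counit C x"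
  shows "f \<in> coalgebra_hom K C D"
  using assms by (simp add: coalgebra_hom_def)

text \<open>Change of variables along a coalgebra map: summing over the coproduct of
  \<open>f x\<close> is summing over the image of the coproduct of \<open>x\<close>.\<close>

lemma sweedler_coalgebra_hom:
  assumes "comultiplication K C" "module K D" "f \<in> coalgebra_hom K C D" "module K W"
    and "h \<in> bilinear_maps K D D W" "x \<in> carrier C"
  shows "sweedler K D W h (f x) = sweedler K C W (\<lambda>a b. h (f a) (f b)) x"
proof -
  interpret C: comultiplication K C by fact
  note fl = coalgebra_homD(1)[OF assms(3)]
  show ?thesis
    unfolding coalgebra_homD(2)[OF assms(3,6)]
    by (rule tensor_lift_tensor_map[OF C.module_axioms C.module_axioms assms(2) assms(2) fl fl
          assms(4,5) C.comult_closed[OF assms(6)]])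
qed

lemma coalgebra_hom_comp:
  assumes C: "comultiplication K C" and D: "module K D" and E: "module K E"
    and f: "f \<in> coalgebra_hom K C D" and g: "g \<in> coalgebra_hom K D E"
  shows "(\<lambda>x. g (f x)) \<in> coalgebra_hom K C E"
proof (rule coalgebra_homI)
  interpret EE: tensor_product K E E by (rule tensor_productI[OF E E])
  note fl = coalgebra_homD(1)[OF f] and gl = coalgebra_homD(1)[OF g]
  show "(\<lambda>x. g (f x)) \<in> linear_maps K C E" by (rule linear_comp[OF gl fl])
  fix x assume x: "x \<in> carrier C"
  then have fx: "f x \<in> carrier D" by (rule linear_closed[OF fl])
  show "counit E (g (f x)) = counit C x" by (simp add: coalgebra_homD(3)[OF g fx] coalgebra_homD(3)[OF f x])
  show "comult E (g (f x)) = tensor_map K E E (\<lambda>x. g (f x)) (\<lambda>x. g (f x)) (comult C x)"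
    unfolding coalgebra_homD(2)[OF g fx] tensor_map_eq_lift
    by (rule sweedler_coalgebra_hom[OF C D f EE.module_tensor tensor_map_bilinear[OF D D E E gl gl] x])
qed

lemma (in hopf_algebra) comult_algebra_hom: "comult H \<in> algebra_hom K H (tensor K H H)"
  and counit_algebra_hom: "counit H \<in> algebra_hom K H (self_module K)"
  using comult_hom counit_hom comult_linear counit_linear by (simp_all add: algebra_hom_def ring_hom_def)

text \<open>Both \<open>f \<circ> S\<close> and \<open>S \<circ> f\<close> are convolution inverses of \<open>f\<close>.\<close>

lemma bialgebra_map_antipode:
  assumes "hopf_algebra K H" "hopf_algebra K L"
    and f: "f \<in> coalgebra_hom K H L" "f \<in> algebra_hom K H L" and x: "x \<in> carrier H"
  shows "f (antipode H x) = antipode L (f x)"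
proof -
  interpret H: hopf_algebra K H by fact
  interpret L: hopf_algebra K L by fact
  note Ha = H.assoc_algebra_axioms and La = L.assoc_algebra_axioms
  note Hm = H.module_axioms and Lm = L.module_axioms
  note fl = algebra_hom_linear[OF f(2)]
  note SH = H.antipode_linear and SL = L.antipode_linear
  have f1: "f \<one>\<^bsub>H\<^esub> = \<one>\<^bsub>L\<^esub>" by (rule algebra_hom_one[OF f(2)])
  have lb: "(\<lambda>a b. antipode H a \<otimes>\<^bsub>H\<^esub> b) \<in> bilinear_maps K H H H"
    by (rule bilinear_comp[OF bilinear_mult[OF Ha] SH linear_id])
  have rb: "(\<lambda>a b. a \<otimes>\<^bsub>L\<^esub> antipode L b) \<in> bilinear_maps K L L L"
    by (rule bilinear_comp[OF bilinear_mult[OF La] linear_id SL])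
  show ?thesis
  proof (rule H.convolution_inverse_unique[OF La linear_comp[OF fl SH] fl linear_comp[OF SL fl] _ _ x])
    fix x assume x: "x \<in> carrier H"
    have "sweedler K H L (\<lambda>a b. f (antipode H a) \<otimes>\<^bsub>L\<^esub> f b) x = sweedler K H L (\<lambda>a b. f (antipode H a \<otimes>\<^bsub>H\<^esub> b)) x"
      by (rule H.sweedler_cong[OF Lm bilinear_comp_linear[OF lb fl] x, symmetric])
        (simp add: algebra_hom_mult[OF f(2)] linear_closed[OF SH])
    also have "\<dots> = f (sweedler K H H (\<lambda>a b. antipode H a \<otimes>\<^bsub>H\<^esub> b) x)"
      by (rule H.sweedler_comp[OF Hm Lm lb fl x, symmetric])
    also have "\<dots> = counit H x \<odot>\<^bsub>L\<^esub> \<one>\<^bsub>L\<^esub>"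
      unfolding H.antipode_left[OF x] by (simp add: linear_smult[OF fl H.counit_closed[OF x]] f1)
    finally show "sweedler K H L (\<lambda>a b. f (antipode H a) \<otimes>\<^bsub>L\<^esub> f b) x = counit H x \<odot>\<^bsub>L\<^esub> \<one>\<^bsub>L\<^esub>" .
    have "sweedler K H L (\<lambda>a b. f a \<otimes>\<^bsub>L\<^esub> antipode L (f b)) x = sweedler K L L (\<lambda>a b. a \<otimes>\<^bsub>L\<^esub> antipode L b) (f x)"
      by (rule sweedler_coalgebra_hom[OF H.comultiplication_axioms Lm f(1) Lm rb x, symmetric])
    then show "sweedler K H L (\<lambda>a b. f a \<otimes>\<^bsub>L\<^esub> antipode L (f b)) x = counit H x \<odot>\<^bsub>L\<^esub> \<one>\<^bsub>L\<^esub>"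
      by (simp add: L.antipode_right[OF linear_closed[OF fl x]] coalgebra_homD(3)[OF f(1) x])
  qed
qed

context cocommutative_hopf_algebra
begin

lemma cocommutative_coalgebra: "cocommutative_coalgebra K H"
  by (rule cocommutative_coalgebra.intro[OF coalgebra_axioms])
    (rule cocommutative_coalgebra_axioms.intro[OF cocommutative])

text \<open>Both \<Delta> S and (S \<otimes> S) \<Delta> are convolution inverses of \<Delta>, so
  they agree. For the first this follows by applying \<Delta> to the antipode law; for the second it
  is \<open>convolution_inverse_tensor\<close>, where cocommutativity enters.\<close>

lemma antipode_coalgebra_hom: "antipode H \<in> coalgebra_hom K H H"
proof (rule coalgebra_homI[OF antipode_linear])
  interpret co: cocommutative_coalgebra K H by (rule cocommutative_coalgebra)
  note Ha = assoc_algebra_axioms and Hm = module_axioms and S = antipode_linear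
  interpret HH: algebra_tensor_product K H H by (rule algebra_tensor_product.intro[OF Ha Ha])
  let ?T = "tensor K H H" and ?S = "antipode H"
  note Ta = HH.assoc_algebra_tensor and T = module_CC
  interpret T: assoc_algebra K ?T by (rule Ta)
  note d = comult_algebra_hom and e = counit_algebra_hom
  have lb: "(\<lambda>a b. ?S a \<otimes>\<^bsub>H\<^esub> b) \<in> bilinear_maps K H H H"
    by (rule bilinear_comp[OF bilinear_mult[OF Ha] S linear_id])
  have h: "(\<lambda>x. tensor_map K H H ?S ?S (comult H x)) \<in> linear_maps K H ?T"
    by (rule linear_comp[OF tensor_map_linear[OF Hm Hm Hm Hm S S] comult_linear])
  \<comment> \<open>\<open>convolution_inverse_tensor\<close> speaks of (u \<otimes> u) \<Delta>.
    For the identity as \<open>u\<close> this has to be recognised as \<Delta>.\<close>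
  have tid: "tensor_map K H H (\<lambda>x. x) (\<lambda>x. x) t = t" if "t \<in> carrier ?T" for t
    by (rule CC.tensor_ext[OF T tensor_map_linear[OF Hm Hm Hm Hm linear_id linear_id] linear_id _ that])
      (simp add: tensor_map_pure[OF Hm Hm Hm Hm linear_id linear_id])
  fix x assume x: "x \<in> carrier H"
  show "comult H (?S x) = tensor_map K H H ?S ?S (comult H x)"
  proof (rule convolution_inverse_unique[OF Ta linear_comp[OF comult_linear S] comult_linear h _ _ x])
    fix x assume x: "x \<in> carrier H"
    have "sweedler K H ?T (\<lambda>a b. comult H (?S a) \<otimes>\<^bsub>?T\<^esub> comult H b) x =
        sweedler K H ?T (\<lambda>a b. comult H (?S a \<otimes>\<^bsub>H\<^esub> b)) x"
      by (rule sweedler_cong[OF T bilinear_comp_linear[OF lb comult_linear] x, symmetric])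
        (simp add: algebra_hom_mult[OF d] linear_closed[OF S])
    also have "\<dots> = comult H (sweedler K H H (\<lambda>a b. ?S a \<otimes>\<^bsub>H\<^esub> b) x)"
      by (rule sweedler_comp[OF Hm T lb comult_linear x, symmetric])
    also have "\<dots> = counit H x \<odot>\<^bsub>?T\<^esub> \<one>\<^bsub>?T\<^esub>"
      unfolding antipode_left[OF x]
      by (simp add: linear_smult[OF comult_linear counit_closed[OF x]] algebra_hom_one[OF d])
    finally show "sweedler K H ?T (\<lambda>a b. comult H (?S a) \<otimes>\<^bsub>?T\<^esub> comult H b) x = counit H x \<odot>\<^bsub>?T\<^esub> \<one>\<^bsub>?T\<^esub>" .
    have "sweedler K H ?T (\<lambda>a b. comult H a \<otimes>\<^bsub>?T\<^esub> tensor_map K H H ?S ?S (comult H b)) x =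
      sweedler K H ?T (\<lambda>a b. tensor_map K H H (\<lambda>x. x) (\<lambda>x. x) (comult H a) \<otimes>\<^bsub>?T\<^esub> tensor_map K H H ?S ?S (comult H b)) x"
      by (rule sweedler_cong[OF T bilinear_comp[OF bilinear_mult[OF Ta] comult_linear h] x])
        (simp add: tid comult_closed)
    also have "\<dots> = counit H x \<odot>\<^bsub>?T\<^esub> \<one>\<^bsub>?T\<^esub>"
      by (rule co.convolution_inverse_tensor[OF Ha linear_id S antipode_right x])
    finally show "sweedler K H ?T (\<lambda>a b. comult H a \<otimes>\<^bsub>?T\<^esub> tensor_map K H H ?S ?S (comult H b)) x =
      counit H x \<odot>\<^bsub>?T\<^esub> \<one>\<^bsub>?T\<^esub>" .
  qed
  note s = assoc_algebra_module[OF assoc_algebra_self[OF R.is_cring]]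
  have eS: "(\<lambda>a. counit H (?S a)) \<in> linear_maps K H (self_module K)"
    by (rule linear_comp[OF counit_linear S])
  \<comment> \<open>A factor \<epsilon>(\<open>x\<^sub>2\<close>) is inserted by the counit law, so
    that multiplicativity of \<epsilon> leads to \<epsilon> applied to the antipode law.\<close>
  have "counit H (?S x) = sweedler K H (self_module K) (\<lambda>a b. counit H b \<odot>\<^bsub>self_module K\<^esub> counit H (?S a)) x"
    by (rule sweedler_counit_right[OF s eS x, symmetric])
  also have "\<dots> = sweedler K H (self_module K) (\<lambda>a b. counit H (?S a \<otimes>\<^bsub>H\<^esub> b)) x"
    by (rule sweedler_cong[OF s bilinear_comp_linear[OF lb counit_linear] x, symmetric])
      (simp add: algebra_hom_mult[OF e] linear_closed[OF S] counit_closed R.m_comm)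
  also have "\<dots> = counit H (sweedler K H H (\<lambda>a b. ?S a \<otimes>\<^bsub>H\<^esub> b) x)"
    by (rule sweedler_comp[OF Hm s lb counit_linear x, symmetric])
  also have "\<dots> = counit H x"
    unfolding antipode_left[OF x]
    using linear_smult[OF counit_linear counit_closed[OF x], of "\<one>\<^bsub>H\<^esub>"] algebra_hom_one[OF e] counit_closed[OF x]
    by simp
  finally show "counit H (?S x) = counit H x" .
qed

end

section \<open>Projectivity\<close>

context takeuchi
begin

lemma TV_comultiplication: "comultiplication K TV"
  by (rule V.V.comultiplication_axioms)

lemma Vinc_coalgebra_hom: "Vinc i \<in> coalgebra_hom K C TV"
  by (rule coalgebra_homI[OF V.inc_linear V.comult_inc V.counit_inc])

lemma gen_coalgebra_hom: "gen \<in> coalgebra_hom K TV F"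
  by (rule coalgebra_homI[OF F.j_linear F.comult_j F.counit_j])

section \<open>The Hopf map F(C) \<rightarrow> M extending a coalgebra map C \<rightarrow> M\<close>

context
  fixes M :: "('a, 'm) hopf" and g :: "'c \<Rightarrow> 'm"
  assumes M: "cocommutative_hopf_algebra K M" and g: "g \<in> coalgebra_hom K C M"
begin

interpretation M: cocommutative_hopf_algebra K M by (rule M)

text \<open>The powers of the antipode are forced: the extension must turn the shift into the
  antipode, so each component is the antipode after the preceding one.\<close>

definition "component i c = (antipode M ^^ i) (g c)"

definition "extension = direct_sum_lift Cop M component"

lemma component_coalgebra_hom: "component i \<in> coalgebra_hom K C M"
proof (induction i)
  case 0
  then show ?case using g by (simp add: component_def[abs_def])
next
  case (Suc i)
  have "component (Suc i) = (\<lambda>c. antipode M (component i c))"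
    by (simp add: component_def fun_eq_iff)
  then show ?case
    using coalgebra_hom_comp[OF comultiplication_axioms M.module_axioms M.module_axioms Suc M.antipode_coalgebra_hom]
    by simp
qed

lemma extension_linear: "extension \<in> linear_maps K TV M"
  unfolding extension_def
  by (rule Vlift_linear[OF M.module_axioms coalgebra_homD(1)[OF component_coalgebra_hom]])

lemma extension_inc: "c \<in> carrier C \<Longrightarrow> extension (Vinc i c) = component i c"
  unfolding extension_def
  by (rule Vlift_inc[OF M.module_axioms coalgebra_homD(1)[OF component_coalgebra_hom]])

lemma extension_coalgebra_hom: "extension \<in> coalgebra_hom K TV M"
proof (rule coalgebra_homI[OF extension_linear])
  note Mm = M.module_axioms and Vm = V.V.module_axioms and l = extension_linear
  note s = assoc_algebra_module[OF assoc_algebra_self[OF R.is_cring]]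
  fix x assume x: "x \<in> carrier TV"
  show "comult M (extension x) = tensor_map K M M extension extension (comult TV x)"
  proof (rule V.inc_ext[OF M.module_CC linear_comp[OF M.comult_linear l]
        linear_comp[OF tensor_map_linear[OF Vm Vm Mm Mm l l] V.V.comult_linear] _ x])
    fix i c assume c: "c \<in> carrier C"
    note cl = coalgebra_homD(1)[OF component_coalgebra_hom]
    have "comult M (extension (Vinc i c)) = tensor_map K M M (component i) (component i) (comult C c)"
      by (simp add: extension_inc c coalgebra_homD(2)[OF component_coalgebra_hom])
    also have "\<dots> = sweedler K C (tensor K M M) (\<lambda>a b. pure_tensor K M M (extension (Vinc i a)) (extension (Vinc i b))) c"
      unfolding tensor_map_eq_lift
      by (rule sweedler_cong[OF M.module_CC tensor_map_bilinear[OF module_axioms module_axioms Mm Mm cl cl] c])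
        (simp add: extension_inc)
    also have "\<dots> = tensor_map K M M extension extension (comult TV (Vinc i c))"
      unfolding tensor_map_eq_lift[of K M M]
      by (rule V.sweedler_inc[OF M.module_CC tensor_map_bilinear[OF Vm Vm Mm Mm l l] c, symmetric])
    finally show "comult M (extension (Vinc i c)) = tensor_map K M M extension extension (comult TV (Vinc i c))" .
  qed
  show "counit M (extension x) = counit TV x"
    by (rule V.inc_ext[OF s linear_comp[OF M.counit_linear l] V.counit_V_linear _ x])
      (simp add: extension_inc V.counit_inc coalgebra_homD(3)[OF component_coalgebra_hom])
qed

lemma extension_shift:
  assumes "x \<in> carrier TV" shows "extension (shift x) = antipode M (extension x)"
  by (rule V.inc_ext[OF M.module_axioms linear_comp[OF extension_linear shift_linear]
        linear_comp[OF M.antipode_linear extension_linear] _ assms])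
    (simp add: shift_inc extension_inc component_def)

text \<open>The extension is a coalgebra map that turns the shift into the antipode, so each
  relation at \<open>x\<close> becomes an antipode law of \<open>M\<close> at
  \<open>extension x\<close>.\<close>

lemma extension_respects: "respects_relations M extension"
  unfolding respects_relations_def
proof (intro ballI conjI)
  note Mm = M.module_axioms and Ma = M.assoc_algebra_axioms and l = extension_linear
  note ls = linear_comp[OF l shift_linear]
  note e = extension_coalgebra_hom
  fix x assume x: "x \<in> carrier TV"
  have ex: "extension x \<in> carrier M" by (rule linear_closed[OF l x])
  have "sweedler K TV M (\<lambda>a b. extension a \<otimes>\<^bsub>M\<^esub> extension (shift b)) x =
      sweedler K TV M (\<lambda>a b. extension a \<otimes>\<^bsub>M\<^esub> antipode M (extension b)) x"
    by (rule V.V.sweedler_cong[OF Mm bilinear_comp[OF bilinear_mult[OF Ma] l ls] x]) (simp add: extension_shift)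
  also have "\<dots> = sweedler K M M (\<lambda>a b. a \<otimes>\<^bsub>M\<^esub> antipode M b) (extension x)"
    by (rule sweedler_coalgebra_hom[OF TV_comultiplication Mm e Mm
          bilinear_comp[OF bilinear_mult[OF Ma] linear_id M.antipode_linear] x, symmetric])
  finally show "sweedler K TV M (\<lambda>a b. extension a \<otimes>\<^bsub>M\<^esub> extension (shift b)) x = counit TV x \<odot>\<^bsub>M\<^esub> \<one>\<^bsub>M\<^esub>"
    by (simp add: M.antipode_right[OF ex] coalgebra_homD(3)[OF e x])
  have "sweedler K TV M (\<lambda>a b. extension (shift a) \<otimes>\<^bsub>M\<^esub> extension b) x =
      sweedler K TV M (\<lambda>a b. antipode M (extension a) \<otimes>\<^bsub>M\<^esub> extension b) x"
    by (rule V.V.sweedler_cong[OF Mm bilinear_comp[OF bilinear_mult[OF Ma] ls l] x]) (simp add: extension_shift)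
  also have "\<dots> = sweedler K M M (\<lambda>a b. antipode M a \<otimes>\<^bsub>M\<^esub> b) (extension x)"
    by (rule sweedler_coalgebra_hom[OF TV_comultiplication Mm e Mm
          bilinear_comp[OF bilinear_mult[OF Ma] M.antipode_linear linear_id] x, symmetric])
  finally show "sweedler K TV M (\<lambda>a b. extension (shift a) \<otimes>\<^bsub>M\<^esub> extension b) x = counit TV x \<odot>\<^bsub>M\<^esub> \<one>\<^bsub>M\<^esub>"
    by (simp add: M.antipode_left[OF ex] coalgebra_homD(3)[OF e x])
qed

text \<open>The map corresponding to \<open>g\<close> under the adjunction between F and the
  forgetful functor.\<close>

definition "hopf_extension = quotient_lift (tensor_algebra_lift K M extension)"

lemma hopf_extension_hom: "hopf_extension \<in> algebra_hom K F M"
  and hopf_extension_gen: "x \<in> carrier TV \<Longrightarrow> hopf_extension (gen x) = extension x"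
proof -
  note Ma = M.assoc_algebra_axioms
  note f = T_lift_hom[OF Ma extension_linear] and fi = T_lift_inc[OF Ma extension_linear]
  have r: "respects_relations M (\<lambda>x. tensor_algebra_lift K M extension (\<iota> x))"
    by (rule respects_relations_cong[OF Ma extension_linear _ extension_respects], rule fi[symmetric])
  show "hopf_extension \<in> algebra_hom K F M"
    unfolding hopf_extension_def algebra_hom_F by (rule Q_lift(1)[OF Ma f r])
  show "hopf_extension (gen x) = extension x" if "x \<in> carrier TV"
    unfolding hopf_extension_def Q_lift(2)[OF Ma f r \<iota>_closed[OF that]] by (rule fi[OF that])
qed

text \<open>Compatibility with comultiplication and counit compares algebra maps on F(C), hence is
  tested on V. Compatibility with the antipode is then automatic by
  \<open>bialgebra_map_antipode\<close>.\<close>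

lemma hopf_extension_hopf_hom: "hopf_extension \<in> hopf_hom K F M"
proof -
  note Ma = M.assoc_algebra_axioms and Mm = M.module_axioms and Fm = F.H.module_axioms and Fa = F.H.assoc_algebra_axioms
  note h = hopf_extension_hom
  note hl = algebra_hom_linear[OF h]
  note s = assoc_algebra_self[OF R.is_cring]
  interpret MM: algebra_tensor_product K M M by (rule algebra_tensor_product.intro[OF Ma Ma])
  have co: "hopf_extension \<in> coalgebra_hom K F M"
  proof (rule coalgebra_homI[OF hl])
    fix x assume x: "x \<in> carrier F"
    show "counit M (hopf_extension x) = counit F x"
      by (rule F.algebra_hom_ext[OF s algebra_hom_comp[OF M.counit_algebra_hom h] F.counit_hom _ x])
        (simp add: hopf_extension_gen coalgebra_homD(3)[OF extension_coalgebra_hom] F.counit_j)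
    show "comult M (hopf_extension x) = tensor_map K M M hopf_extension hopf_extension (comult F x)"
    proof (rule F.algebra_hom_ext[OF MM.assoc_algebra_tensor algebra_hom_comp[OF M.comult_algebra_hom h]
          algebra_hom_comp[OF tensor_map_algebra_hom[OF Fa Fa Ma Ma h h] F.comult_hom] _ x])
      fix x assume x: "x \<in> carrier TV"
      note el = extension_linear and Vm = V.V.module_axioms
      have "comult M (hopf_extension (gen x)) = tensor_map K M M extension extension (comult TV x)"
        by (simp only: hopf_extension_gen[OF x] coalgebra_homD(2)[OF extension_coalgebra_hom x])
      also have "\<dots> = sweedler K TV (tensor K M M)
          (\<lambda>a b. pure_tensor K M M (hopf_extension (gen a)) (hopf_extension (gen b))) x"
        unfolding tensor_map_eq_lift
        by (rule V.V.sweedler_cong[OF M.module_CC tensor_map_bilinear[OF Vm Vm Mm Mm el el] x])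
          (simp add: hopf_extension_gen)
      also have "\<dots> = tensor_map K M M hopf_extension hopf_extension (comult F (gen x))"
        unfolding tensor_map_eq_lift[of K M M]
        by (rule sweedler_coalgebra_hom[OF TV_comultiplication Fm gen_coalgebra_hom M.module_CC
              tensor_map_bilinear[OF Fm Fm Mm Mm hl hl] x, symmetric])
      finally show "comult M (hopf_extension (gen x)) =
        tensor_map K M M hopf_extension hopf_extension (comult F (gen x))" .
    qed
  qed
  then show ?thesis
    using h bialgebra_map_antipode[OF F.hopf_algebra_axioms M.hopf_algebra_axioms co h]
    by (simp add: hopf_hom_def algebra_hom_def)
qed

end

lemma E_projective_free_hopf: "E_projective TYPE('m) TYPE('n) K F"
  unfolding E_projective_def
proof (intro conjI allI impI)
  show "cocommutative_hopf_algebra K F" by (rule F.cocommutative_hopf_algebra_axioms)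
  fix M :: "('a, 'm) hopf" and N :: "('a, 'n) hopf" and p \<phi>
  assume M: "cocommutative_hopf_algebra K M" and N: "cocommutative_hopf_algebra K N"
    and p: "coalgebra_split_epi K M N p" and \<phi>: "\<phi> \<in> hopf_hom K F N"
  interpret M: cocommutative_hopf_algebra K M by (rule M)
  interpret N: cocommutative_hopf_algebra K N by (rule N)
  obtain s where s: "s \<in> coalgebra_hom K N M" and ps: "\<And>x. x \<in> carrier N \<Longrightarrow> p (s x) = x"
    and p: "p \<in> hopf_hom K M N"
    using p by (auto simp: coalgebra_split_epi_def)
  have pa: "p \<in> algebra_hom K M N" and \<phi>a: "\<phi> \<in> algebra_hom K F N" and \<phi>c: "\<phi> \<in> coalgebra_hom K F N"
    using p \<phi> by (auto simp: hopf_hom_def algebra_hom_def coalgebra_hom_def)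
  have pS: "p (antipode M x) = antipode N (p x)" if "x \<in> carrier M" for x
    using p that by (simp add: hopf_hom_def)
  have \<phi>S: "\<phi> (antipode F x) = antipode N (\<phi> x)" if "x \<in> carrier F" for x
    using \<phi> that by (simp add: hopf_hom_def)
  \<comment> \<open>The summand with index 0 is C itself. A composite with \<open>s\<close> is only
    a coalgebra map, and this is exactly what the extension takes as input.\<close>
  define g where "g = (\<lambda>c. s (\<phi> (gen (Vinc 0 c))))"
  note Mm = M.module_axioms and Nm = N.module_axioms and Fm = F.H.module_axioms and Vm = V.V.module_axioms
  note cm = comultiplication_axioms
  have g: "g \<in> coalgebra_hom K C M"
    unfolding g_def
    by (rule coalgebra_hom_comp[OF cm Nm Mm coalgebra_hom_comp[OF cm Fm Nm
          coalgebra_hom_comp[OF cm Vm Fm Vinc_coalgebra_hom gen_coalgebra_hom] \<phi>c] s])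
  note h = hopf_extension_hopf_hom[OF M g]
  note ha = hopf_extension_hom[OF M g] and hg = hopf_extension_gen[OF M g]
  \<comment> \<open>The section is used only at index 0, where \<open>p\<close> cancels
    \<open>s\<close>. Each further step applies an antipode, with which both \<open>p\<close> and
    \<open>\<phi>\<close> commute.\<close>
  have comp: "p (component M g i c) = \<phi> (gen (Vinc i c))" if c: "c \<in> carrier C" for i c
  proof (induction i)
    case 0
    have "\<phi> (gen (Vinc 0 c)) \<in> carrier N"
      by (rule linear_closed[OF coalgebra_homD(1)[OF \<phi>c] F.j_closed[OF V.inc_closed[OF c]]])
    then show ?case unfolding component_def[OF M g] by (simp add: g_def ps)
  next
    case (Suc i)
    note ci = component_coalgebra_hom[OF M g, of i]
    have "p (component M g (Suc i) c) = antipode N (p (component M g i c))"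
      using pS[OF linear_closed[OF coalgebra_homD(1)[OF ci] c]] by (simp add: component_def[OF M g])
    also have "\<dots> = \<phi> (antipode F (gen (Vinc i c)))"
      unfolding Suc by (rule \<phi>S[OF F.j_closed[OF V.inc_closed[OF c]], symmetric])
    also have "\<dots> = \<phi> (gen (Vinc (Suc i) c))"
      by (simp add: F.antipode_j[OF V.inc_closed[OF c]] shift_inc)
    finally show ?case .
  qed
  \<comment> \<open>Both sides are algebra maps on F(C), so agreement on V suffices; there both are
    linear, so agreement on the copies of C suffices.\<close>
  have "p (hopf_extension M g x) = \<phi> x" if x: "x \<in> carrier F" for x
  proof (rule F.algebra_hom_ext[OF N.assoc_algebra_axioms algebra_hom_comp[OF pa ha] \<phi>a _ x])
    fix x assume x: "x \<in> carrier TV"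
    have "p (extension M g x) = \<phi> (gen x)"
      by (rule V.inc_ext[OF Nm linear_comp[OF algebra_hom_linear[OF pa] extension_linear[OF M g]]
            linear_comp[OF algebra_hom_linear[OF \<phi>a] F.j_linear] _ x])
        (simp add: extension_inc[OF M g] comp)
    then show "p (hopf_extension M g (gen x)) = \<phi> (gen x)" by (simp add: hg[OF x])
  qed
  with h show "\<exists>\<psi>\<in>hopf_hom K F M. \<forall>x\<in>carrier F. p (\<psi> x) = \<phi> x" by blast
qed

end

theorem lemma3p6:
  fixes K :: "('k, 'r) ring_scheme" and C :: "('k, 'c) coalg"
  assumes "field K" and "cocommutative_coalgebra K C"
  shows "E_projective TYPE('m) TYPE('n) K (free_hopf K C)"
  by (rule takeuchi.E_projective_free_hopf[OF takeuchi.intro[OF assms(2)]])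

end
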